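(* Let $p\in[0,1]$ and let $S$ be a multi-dimensional elephant random walk on $\mathbb{Z}^2$ with memory parameter $p$. Then $S$ is recurrent if $p<5/8$, and $S$ is transient if $p\ge 5/8$.
   Context: Multi-dimensional elephant random walk (MERW) on $\mathbb{Z}^d$ (here $d=2$): let $e_1,\dots,e_d$ be the standard basis of $\mathbb{R}^d$ and $p\in[0,1]$. Set $S_0=0$ and $S_1=\sigma_1=e_1$. For each $n\ge 1$, choose $n'$ uniformly at random in $\{1,\dots,n\}$ (independently of the past); given the past and $n'$, let $\sigma_{n+1}=\sigma_{n'}$ with probability $p$, and $\sigma_{n+1}=\sigma$ with probability $\frac{1-p}{2d-1}$ for each $\sigma\in\{\pm e_1,\dots,\pm e_d\}\setminus\{\sigma_{n'}\}$. Set $S_{n+1}=S_n+\sigma_{n+1}$. A random walk $(S_n)$ on $\mathbb{Z}^d$ is called recurrent if for every $x\in\mathbb{Z}^d$, $\mathbb{P}(S_n=x\text{ for infinitely many }n)=1$, and transient if for every $x\in\mathbb{Z}^d$, $\mathbb{P}(S_n=x\text{ for only finitely many }n)=1$. *)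

theory Defs
  imports "HOL-Probability.Probability"
begin

text \<open>The points of \<open>\<int>\<^sup>d\<close> are modelled by the type \<open>int ^ 'd\<close>, the basis vector \<open>e\<^sub>i\<close> by
  \<open>axis i 1\<close>.\<close>

definition steps :: "(int ^ 'd) set" where
  "steps = (\<Union>i. {axis i 1, - axis i 1})"

text \<open>The past at time \<open>n\<close> is \<open>(\<sigma> 1, \<dots>, \<sigma> n; N 1, \<dots>, N (n - 1))\<close>, where \<open>N n\<close> is the time \<open>n'\<close>
  recalled for the choice of \<open>\<sigma> (n + 1)\<close>.\<close>

definition past ::
    "(nat \<Rightarrow> 'w \<Rightarrow> nat) \<Rightarrow> (nat \<Rightarrow> 'w \<Rightarrow> int ^ 'd) \<Rightarrow> nat \<Rightarrow> 'w \<Rightarrow> (int ^ 'd) list \<times> nat list" where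
  "past N \<sigma> n \<omega> = (map (\<lambda>i. \<sigma> i \<omega>) [1..<n + 1], map (\<lambda>j. N j \<omega>) [1..<n])"

text \<open>The past takes countably many values, so conditioning on it and on \<open>N n\<close> means conditioning
  on each event of positive probability on which both are constant. Here \<open>s i\<close> and \<open>m j\<close> are the
  given values of \<open>\<sigma> i\<close> and \<open>N j\<close>. The variables \<open>\<sigma> 0\<close> and \<open>N 0\<close> play no role, and the class \<open>one\<close>
  on \<open>'d\<close> only serves to name the first coordinate.\<close>

locale elephant_random_walk = prob_space M
  for M :: "'w measure" +
  fixes p :: real
    and N :: "nat \<Rightarrow> 'w \<Rightarrow> nat"
    and \<sigma> :: "nat \<Rightarrow> 'w \<Rightarrow> int ^ ('d :: {finite, one})"
    and S :: "nat \<Rightarrow> 'w \<Rightarrow> int ^ ('d :: {finite, one})"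
  assumes measurable_step: "n \<ge> 1 \<Longrightarrow> random_variable (count_space UNIV) (\<sigma> n)"
    and measurable_recall: "n \<ge> 1 \<Longrightarrow> random_variable (count_space UNIV) (N n)"
    and first_step: "AE \<omega> in M. \<sigma> 1 \<omega> = axis 1 1"
    and recall_uniform:
      "n \<ge> 1 \<Longrightarrow> distr M (count_space UNIV) (N n) = measure_pmf (pmf_of_set {1..n})"
    and recall_indep:
      "n \<ge> 1 \<Longrightarrow> indep_set
        (sets (vimage_algebra (space M) (N n) (count_space UNIV)))
        (sets (vimage_algebra (space M) (past N \<sigma> n) (count_space UNIV)))"
    and next_step:
      "\<lbrakk>n \<ge> 1; k \<in> {1..n}; v \<in> steps;
        \<P>(\<omega> in M. past N \<sigma> n \<omega> = (map s [1..<n + 1], map m [1..<n]) \<and> N n \<omega> = k) > 0\<rbrakk>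
       \<Longrightarrow> \<P>(\<omega> in M. \<sigma> (n + 1) \<omega> = v \<bar>
             past N \<sigma> n \<omega> = (map s [1..<n + 1], map m [1..<n]) \<and> N n \<omega> = k)
         = (if v = s k then p else (1 - p) / (2 * real CARD('d) - 1))"
    and walk_0: "\<omega> \<in> space M \<Longrightarrow> S 0 \<omega> = 0"
    and walk_Suc: "\<omega> \<in> space M \<Longrightarrow> S (n + 1) \<omega> = S n \<omega> + \<sigma> (n + 1) \<omega>"

definition recurrent :: "'w measure \<Rightarrow> (nat \<Rightarrow> 'w \<Rightarrow> 'a) \<Rightarrow> bool" where
  "recurrent M S \<longleftrightarrow> (\<forall>x. \<P>(\<omega> in M. infinite {n. S n \<omega> = x}) = 1)"

definition transient :: "'w measure \<Rightarrow> (nat \<Rightarrow> 'w \<Rightarrow> 'a) \<Rightarrow> bool" where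
  "transient M S \<longleftrightarrow> (\<forall>x. \<P>(\<omega> in M. finite {n. S n \<omega> = x}) = 1)"

end

theory Submission
  imports Defs "HOL-Real_Asymp.Real_Asymp"
begin

text \<open>Put \<open>a = (4 p - 1) / 3\<close>, so that \<open>p = 5/8\<close> is \<open>a = 1/2\<close>. Given the first \<open>n\<close> steps, the next step is \<open>v\<close>
  with probability \<open>(1 - a) / 4 + a c\<^sub>v / n\<close>, where \<open>c\<^sub>v\<close> counts the earlier steps \<open>v\<close>; its mean is
  \<open>a S\<^sub>n / n\<close>. For \<open>a < 1\<close> the numbers of horizontal and vertical steps differ by at most \<open>n\<^bsup>1-\<delta>\<^esup>\<close> for large \<open>n\<close>,
  hence the covariance of the next step is nearly isotropic and \<open>Q = |S\<^sub>n|\<^sup>2\<close> is nearly Markovian, with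
  drift \<open>1 + 2 a Q / n\<close> and second moment of the increment about \<open>2 Q\<close>. Both regimes follow from
  time-dependent supermartingales in \<open>Q\<close> and Doob's maximal inequality.

  For \<open>1/2 \<le> a < 1\<close> the function \<open>sqrt (ln (1 + 4 n ln n / Q) / ln n)\<close> is a supermartingale outside the ball
  \<open>Q \<le> sqrt n\<close>. It is at least \<open>sqrt (1/2)\<close> in that ball and tends to \<open>0\<close> along the times with \<open>Q \<ge> n\<close>, which
  occur infinitely often since \<open>Q / n - ln n / 2\<close> is a submartingale (for \<open>a = 1\<close> the walk is a straight line). The square root makes the second-order
  term strictly negative, which absorbs the anisotropy and the Taylor errors.

  For \<open>a < 1/2\<close> the function \<open>ln (ln n) + c (ln Q + ln (ln Q) - ln (n/8 + Q) / 2 - ln n / 2) / ln n\<close> is a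
  supermartingale outside a fixed ball, bounded below by \<open>ln (ln n) - c\<close>; hence the walk returns to this ball
  infinitely often. From a vertex visited infinitely often each neighbour is visited infinitely often.\<close>

section \<open>Means under a finite distribution\<close>

text \<open>Both potentials are built on \<open>ln Q\<close> because the logarithm is harmonic for
  an isotropic planar step: its drift is \<open>2 a / n\<close> up to errors of the form (anisotropy
  + 1 / distance) / Q. The obstacle is the region where Q is far below n. There those errors dwarf
  any gain of order 1 / n, so a gain of order 1 / Q up to logarithms has to come from the
  second-order term of a concave outer function: the square root in one regime,
  \<open>ln (ln Q)\<close> in the other. The former gains about 1 / (Q (ln n)^2), the latter about 1
  / (Q (ln Q)^2). Hence the polynomial rate in the balance of the steps, and hence the different
  balls: against (ln n)^2 the quantity 1 / distance must be a power of 1 / n, while (ln Q)^2 is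
  beaten by the distance alone. The scale \<open>n ln n\<close> in the transient potential is the
  order of the mean of Q at \<open>a = 1/2\<close>; as the drift of Q enters only through a lower
  bound, larger \<open>a\<close> are covered by the same computation. In the recurrent potential the
  growth of \<open>ln (ln n)\<close> is paid for by the strict deficit
  \<open>1 - 2 a\<close>.\<close>

lemma ln_add_one_le_cubic:
  fixes t :: real
  assumes "-1 < t"
  shows "ln (1 + t) \<le> t - t\<^sup>2 / 2 + t ^ 3 / 3"
proof -
  define f where "f x = x - x\<^sup>2 / 2 + x ^ 3 / 3 - ln (1 + x)" for x :: real
  \<comment> \<open>The derivative has the sign of \<open>x\<close>, so \<open>f\<close> is minimal
    at 0 on the whole half-line.\<close>
  have d: "(f has_real_derivative x ^ 3 / (1 + x)) (at x)" if "-1 < x" for x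
    unfolding f_def using that
    by (auto intro!: derivative_eq_intros simp: field_simps power2_eq_square power3_eq_cube)
  have "f 0 \<le> f t"
  proof (cases "0 \<le> t")
    case True
    have "\<exists>y. (f has_real_derivative y) (at x) \<and> 0 \<le> y" if "0 \<le> x" "x \<le> t" for x
      using d[of x] that by force
    then show ?thesis using DERIV_nonneg_imp_nondecreasing[OF True, of f] by blast
  next
    case False
    have "\<exists>y. (f has_real_derivative y) (at x) \<and> y \<le> 0" if "t \<le> x" "x \<le> 0" for x
      using d[of x] that assms by (intro exI[of _ "x ^ 3 / (1 + x)"]) (auto simp: divide_nonpos_pos)
    then show ?thesis using DERIV_nonpos_imp_nonincreasing[of t 0 f] False by auto
  qed
  then show ?thesis by (simp add: f_def)
qed

lemma ln_add_one_ge_cubic: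
  fixes t :: real
  assumes "\<bar>t\<bar> \<le> 1/2"
  shows "t - t\<^sup>2 / 2 - \<bar>t\<bar> ^ 3 \<le> ln (1 + t)"
proof (cases "0 \<le> t")
  case True
  define f where "f x = ln (1 + x) - x + x\<^sup>2 / 2" for x :: real
  have "\<exists>y. (f has_real_derivative y) (at x) \<and> 0 \<le> y" if "0 \<le> x" "x \<le> t" for x
    unfolding f_def using that
    by (intro exI[of _ "x\<^sup>2 / (1 + x)"] conjI)
       (auto intro!: derivative_eq_intros simp: field_simps power2_eq_square)
  then have "f 0 \<le> f t" using DERIV_nonneg_imp_nondecreasing[OF True, of f] by blast
  then have "0 \<le> ln (1 + t) - t + t\<^sup>2 / 2" by (simp add: f_def)
  moreover have "0 \<le> t ^ 3" using True by simp
  ultimately show ?thesis unfolding abs_of_nonneg[OF True] by linarith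
next
  case False
  define f where "f x = ln (1 + x) - x + x\<^sup>2 / 2 - x ^ 3" for x :: real
  have "\<exists>y. (f has_real_derivative y) (at x) \<and> y \<le> 0" if "t \<le> x" "x \<le> 0" for x
  proof (intro exI[of _ "x\<^sup>2 * (1 / (1 + x) - 3)"] conjI)
    have x: "1/2 \<le> 1 + x" using that assms by auto
    then show "(f has_real_derivative x\<^sup>2 * (1 / (1 + x) - 3)) (at x)"
      unfolding f_def
      by (auto intro!: derivative_eq_intros simp: field_simps power2_eq_square power3_eq_cube)
    have "1 / (1 + x) \<le> 3" using x by (simp add: field_simps)
    then show "x\<^sup>2 * (1 / (1 + x) - 3) \<le> 0" by (simp add: mult_nonneg_nonpos)
  qed
  then have "f 0 \<le> f t" using DERIV_nonpos_imp_nonincreasing[of t 0 f] False by auto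
  then show ?thesis using False by (simp add: f_def)
qed

lemma sqrt_one_plus_le:
  fixes z :: real
  assumes "-1 \<le> z"
  shows "sqrt (1 + z) \<le> 1 + z / 2"
proof (rule real_le_lsqrt)
  show "1 + z \<le> (1 + z / 2)\<^sup>2" by (simp add: power2_eq_square algebra_simps)
qed (use assms in auto)

text \<open>The Taylor coefficient 1/8 is weakened to 1/16 so that the bound holds on all of
  \<open>\<bar>z\<bar> \<le> 1/2\<close>. The strictly negative quadratic term is the gain for which
  the transient potential carries a square root.\<close>

lemma sqrt_one_plus_le_quadratic:
  fixes z :: real
  assumes "\<bar>z\<bar> \<le> 1/2"
  shows "sqrt (1 + z) \<le> 1 + z / 2 - z\<^sup>2 / 16"
proof (rule real_le_lsqrt)
  have z2: "z\<^sup>2 \<le> 1/4" using assms abs_le_square_iff[of z "1/2"] by (simp add: power2_eq_square)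
  then show "0 \<le> 1 + z / 2 - z\<^sup>2 / 16" using assms by linarith
  have "(1 + z / 2 - z\<^sup>2 / 16)\<^sup>2 - (1 + z) = z\<^sup>2 * (1/8 - z / 16 + z\<^sup>2 / 256)"
    by (simp add: power2_eq_square field_simps)
  also have "\<dots> \<ge> 0" using assms by (intro mult_nonneg_nonneg) (auto intro: add_nonneg_nonneg)
  finally show "1 + z \<le> (1 + z / 2 - z\<^sup>2 / 16)\<^sup>2" by simp
qed

text \<open>Serves with \<open>h = ln (n + 1) / ln n - 1\<close>, the relative growth of the
  normalising logarithm. For \<open>h > 8\<close> the left side is below 1, for smaller
  \<open>h\<close> squaring works.\<close>

lemma sqrt_one_plus_ge:
  fixes h :: real
  assumes "0 \<le> h"
  shows "1 + h / 2 - h\<^sup>2 / 8 \<le> sqrt (1 + h)"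
proof (cases "h \<le> 8")
  case True
  have "1 + h - (1 + h / 2 - h\<^sup>2 / 8)\<^sup>2 = h ^ 3 * (8 - h) / 64"
    by (simp add: power2_eq_square power3_eq_cube field_simps)
  also have "\<dots> \<ge> 0" using assms True by simp
  finally show ?thesis by (intro real_le_rsqrt) simp
next
  case False
  then have "8 * h \<le> h * h" using assms by (intro mult_right_mono) auto
  then have "1 + h / 2 - h\<^sup>2 / 8 \<le> 1" using False by (simp add: power2_eq_square)
  also have "1 \<le> sqrt (1 + h)" using assms by simp
  finally show ?thesis .
qed

text \<open>Stands for the conditional law of one step given the history. The drift estimates become
  statements about finite sums, in which the increment of Q appears only through a uniform bound and
  its first two moments.\<close>

locale finite_distribution =
  fixes V :: "'a set" and q :: "'a \<Rightarrow> real"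
  assumes finite_V: "finite V"
    and q_nonneg: "v \<in> V \<Longrightarrow> 0 \<le> q v"
    and q_sum: "sum q V = 1"
begin

definition mean :: "('a \<Rightarrow> real) \<Rightarrow> real" where
  "mean f = (\<Sum>v\<in>V. q v * f v)"

lemma mean_mono: "(\<And>v. v \<in> V \<Longrightarrow> f v \<le> g v) \<Longrightarrow> mean f \<le> mean g"
  unfolding mean_def by (intro sum_mono mult_left_mono q_nonneg)

lemma mean_cong: "(\<And>v. v \<in> V \<Longrightarrow> f v = g v) \<Longrightarrow> mean f = mean g"
  unfolding mean_def by (intro sum.cong) auto

lemma mean_const: "mean (\<lambda>_. c) = c"
  using q_sum by (simp add: mean_def flip: sum_distrib_right)

lemma mean_add: "mean (\<lambda>v. f v + g v) = mean f + mean g"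
  by (simp add: mean_def algebra_simps sum.distrib)

lemma mean_diff: "mean (\<lambda>v. f v - g v) = mean f - mean g"
  by (simp add: mean_def algebra_simps sum_subtractf)

lemma mean_cmult: "mean (\<lambda>v. c * f v) = c * mean f"
  by (simp add: mean_def algebra_simps sum_distrib_left)

lemma mean_divide: "mean (\<lambda>v. f v / c) = mean f / c"
  by (simp add: mean_def sum_divide_distrib)

lemmas mean_linear = mean_add mean_diff mean_cmult mean_divide mean_const

text \<open>Second-order expansion; the cubic remainder is bounded by its uniform size because
  nothing beyond two moments is known.\<close>

lemma mean_ln_le:
  assumes "\<And>v. v \<in> V \<Longrightarrow> \<bar>t v\<bar> \<le> e" "e \<le> 1/2"
  shows "mean (\<lambda>v. ln (1 + t v)) \<le> mean t - mean (\<lambda>v. (t v)\<^sup>2) / 2 + e ^ 3"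
proof -
  have "mean (\<lambda>v. ln (1 + t v)) \<le> mean (\<lambda>v. t v - (t v)\<^sup>2 / 2 + e ^ 3)"
  proof (rule mean_mono)
    fix v assume v: "v \<in> V"
    have "t v ^ 3 \<le> \<bar>t v\<bar> ^ 3" by (metis abs_ge_self power_abs)
    also have "\<dots> \<le> e ^ 3" by (intro power_mono assms v) auto
    finally have "t v ^ 3 \<le> e ^ 3" .
    moreover have "0 \<le> e ^ 3" using assms(1)[OF v] by (meson abs_ge_zero order_trans zero_le_power)
    moreover have "ln (1 + t v) \<le> t v - (t v)\<^sup>2 / 2 + t v ^ 3 / 3"
      using assms(1)[OF v] assms(2) by (intro ln_add_one_le_cubic) auto
    ultimately show "ln (1 + t v) \<le> t v - (t v)\<^sup>2 / 2 + e ^ 3" by linarith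
  qed
  then show ?thesis by (simp add: mean_linear)
qed

lemma mean_ln_ge:
  assumes "\<And>v. v \<in> V \<Longrightarrow> \<bar>t v\<bar> \<le> e" "e \<le> 1/2"
  shows "mean t - mean (\<lambda>v. (t v)\<^sup>2) / 2 - e ^ 3 \<le> mean (\<lambda>v. ln (1 + t v))"
proof -
  have "mean (\<lambda>v. t v - (t v)\<^sup>2 / 2 - e ^ 3) \<le> mean (\<lambda>v. ln (1 + t v))"
  proof (rule mean_mono)
    fix v assume v: "v \<in> V"
    have "\<bar>t v\<bar> ^ 3 \<le> e ^ 3" by (intro power_mono assms v) auto
    moreover have "t v - (t v)\<^sup>2 / 2 - \<bar>t v\<bar> ^ 3 \<le> ln (1 + t v)"
      using assms(1)[OF v] assms(2) by (intro ln_add_one_ge_cubic) auto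
    ultimately show "t v - (t v)\<^sup>2 / 2 - e ^ 3 \<le> ln (1 + t v)" by linarith
  qed
  then show ?thesis by (simp add: mean_linear)
qed

end

section \<open>Drift of the potential in the transient regime\<close>

text \<open>Two cancellations leave only small terms. The terms with \<open>1 / n\<close> vanish
  because \<open>R / Q\<close> does not change when Q and \<open>R - Q\<close> grow by the same
  factor. The terms \<open>1 / Q\<close> vanish because the second moment \<open>2 Q\<close> makes
  \<open>ln Q\<close> harmonic.\<close>

lemma drift_main_terms:
  fixes Q R n c \<rho> :: real
  assumes "Q \<noteq> 0" "R \<noteq> 0" "n \<noteq> 0"
  shows "(Q / n + 1) * (1 / R - 1 / Q) + ((R - Q) / n + c) / R + (Q * (2 + \<rho>)) * (1 / Q\<^sup>2 - 1 / R\<^sup>2) / 2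
    = c / R + (R - Q) / R\<^sup>2 + \<rho> / 2 * ((R - Q) / (Q * R) + (R - Q) / R\<^sup>2)"
proof -
  define x y z t where "x = 1 / R" and "y = 1 / Q" and "z = Q / R\<^sup>2" and "t = (Q / R - 1) / n"
  have e1: "(Q / n + 1) * (1 / R - 1 / Q) = t + (x - y)"
    using assms by (simp add: x_def y_def t_def field_simps)
  have e2: "((R - Q) / n + c) / R = - t + c / R"
    using assms by (simp add: t_def field_simps)
  have "Q * (1 / Q\<^sup>2 - 1 / R\<^sup>2) = y - z"
    using assms by (simp add: y_def z_def field_simps power2_eq_square)
  then have e3: "(Q * (2 + \<rho>)) * (1 / Q\<^sup>2 - 1 / R\<^sup>2) = (2 + \<rho>) * (y - z)"
    by (metis mult.assoc mult.commute)
  have e4: "(R - Q) / R\<^sup>2 = x - z" "(R - Q) / (Q * R) = y - x"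
    using assms by (simp_all add: x_def y_def z_def field_simps power2_eq_square)
  show ?thesis unfolding e1 e2 e3 e4 by (simp add: field_simps)
qed

context finite_distribution
begin

text \<open>The increment of \<open>ln (1 + B / Q) = ln (Q + B) - ln Q\<close>, with
  \<open>k\<close> the distance from the origin. The four terms of the bound are the growth of the
  factor \<open>ln n\<close> in \<open>B\<close>, the second-order term of
  \<open>ln (Q + B)\<close>, the anisotropy \<open>\<rho>\<close>, and the Taylor remainders, where
  \<open>152 = 5^3 + 3^3\<close>.\<close>

lemma transience_mean_increment:
  fixes k n s s' \<rho> :: real and D :: "'a \<Rightarrow> real"
  defines "Q \<equiv> k\<^sup>2" and "B \<equiv> 4 * n * s" and "B' \<equiv> 4 * (n + 1) * s'"
  assumes s: "s = ln n" "s' = ln (n + 1)" "2 \<le> s"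
    and k: "100 \<le> k" "k \<le> n"
    and D: "\<And>v. v \<in> V \<Longrightarrow> \<bar>D v\<bar> \<le> 3 * k"
    and m1: "Q / n + 1 \<le> mean D"
    and m2: "mean (\<lambda>v. (D v)\<^sup>2) \<le> Q * (2 + \<rho>)" and \<rho>: "0 \<le> \<rho>"
  shows "mean (\<lambda>v. ln (1 + (D v + (B' - B)) / (Q + B)) - ln (1 + D v / Q))
      \<le> 4 * (1 + 1 / n) / (Q + B) + B / (Q + B)\<^sup>2 + \<rho> * B / (Q * (Q + B)) + 152 / k ^ 3"
    and "\<And>v. v \<in> V \<Longrightarrow> \<bar>(D v + (B' - B)) / (Q + B)\<bar> \<le> 5 / k"
    and "\<And>v. v \<in> V \<Longrightarrow> \<bar>D v / Q\<bar> \<le> 3 / k"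
    and "0 \<le> B' - B" "(B' - B) / B \<le> 2 / n" "B' - B \<le> B / n + 4 * (1 + 1 / n)"
proof -
  have n: "100 \<le> n" using k by linarith
  have Q: "Q > 0" and B: "B > 0" using k n s by (auto simp: Q_def B_def)
  have "s' - s = ln (1 + 1 / n)"
    using n unfolding s by (simp add: ln_divide_pos[symmetric] add_divide_distrib add.commute flip: ln_div)
  then have s's: "0 \<le> s' - s" "s' - s \<le> 1 / n"
    using n ln_add_one_self_le_self[of "1 / n"] by auto
  have dB: "B' - B = B / n + 4 * (n + 1) * (s' - s)"
    using n by (simp add: B_def B'_def field_simps)
  have "4 * (n + 1) * (s' - s) \<le> 4 * (n + 1) * (1 / n)"
    using n s's by (intro mult_left_mono) auto
  also have "\<dots> = 4 * (1 + 1 / n)" using n by (simp add: field_simps)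
  finally show dB_le: "B' - B \<le> B / n + 4 * (1 + 1 / n)" using dB by linarith
  show dB_nonneg: "0 \<le> B' - B" unfolding dB using n s's B by (intro add_nonneg_nonneg) auto
  have "4 * (1 + 1 / n) \<le> B / n" 
  proof -
    have "1 / n \<le> 1" "B / n = 4 * s" using n by (auto simp: B_def)
    then show ?thesis using \<open>2 \<le> s\<close> unfolding distrib_left by linarith
  qed
  then have "B' - B \<le> 2 * (B / n)" using dB_le by linarith
  then show dBB: "(B' - B) / B \<le> 2 / n" using B n by (simp add: field_simps)
  have DQ: "\<bar>D v\<bar> / Q \<le> 3 / k" if "v \<in> V" for v
    using D[OF that] k by (simp add: Q_def field_simps power2_eq_square)
  then show T1: "\<And>v. v \<in> V \<Longrightarrow> \<bar>D v / Q\<bar> \<le> 3 / k" using Q by simp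
  show T2: "\<bar>(D v + (B' - B)) / (Q + B)\<bar> \<le> 5 / k" if "v \<in> V" for v
  proof -
    have "\<bar>(D v + (B' - B)) / (Q + B)\<bar> \<le> \<bar>D v\<bar> / (Q + B) + (B' - B) / (Q + B)"
      using dB_nonneg Q B by (simp add: add_divide_distrib[symmetric] divide_right_mono)
    also have "\<bar>D v\<bar> / (Q + B) \<le> \<bar>D v\<bar> / Q" using Q B by (intro divide_left_mono) auto
    also have "(B' - B) / (Q + B) \<le> (B' - B) / B"
      using Q B dB_nonneg by (intro divide_left_mono) auto
    also have "\<bar>D v\<bar> / Q + (B' - B) / B \<le> 3 / k + 2 / n" using DQ[OF that] dBB by linarith
    also have "2 / n \<le> 2 / k" using k by (intro divide_left_mono) auto
    finally show ?thesis using k by (simp add: field_simps)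
  qed
  define d where "d = B' - B"
  define m where "m = mean D"
  define M where "M = mean (\<lambda>v. (D v)\<^sup>2)"
  define R where "R = Q + B"
  have R: "R > 0" "R > Q" using Q B by (auto simp: R_def)
  have pos: "m \<ge> 0" using m1 Q n unfolding m_def by (smt (verit) divide_nonneg_pos)
  have "mean (\<lambda>v. ln (1 + (D v + d) / R) - ln (1 + D v / Q))
      \<le> (mean (\<lambda>v. (D v + d) / R) - mean (\<lambda>v. ((D v + d) / R)\<^sup>2) / 2 + (5 / k) ^ 3)
        - (mean (\<lambda>v. D v / Q) - mean (\<lambda>v. (D v / Q)\<^sup>2) / 2 - (3 / k) ^ 3)"
    unfolding mean_diff
    using mean_ln_le[of "\<lambda>v. (D v + d) / R" "5 / k"] mean_ln_ge[of "\<lambda>v. D v / Q" "3 / k"] T1 T2 k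
    by (simp add: d_def R_def diff_mono)
  also have "mean (\<lambda>v. (D v + d) / R) = (m + d) / R"
    by (simp add: mean_linear m_def)
  also have "mean (\<lambda>v. ((D v + d) / R)\<^sup>2) = (M + 2 * d * m + d\<^sup>2) / R\<^sup>2"
  proof -
    have "mean (\<lambda>v. ((D v + d) / R)\<^sup>2) = mean (\<lambda>v. ((D v)\<^sup>2 + 2 * d * D v + d\<^sup>2) / R\<^sup>2)"
      by (intro mean_cong) (simp add: power_divide power2_sum algebra_simps)
    then show ?thesis by (simp add: mean_linear m_def M_def)
  qed
  also have "mean (\<lambda>v. D v / Q) = m / Q" by (simp add: mean_linear m_def)
  also have "mean (\<lambda>v. (D v / Q)\<^sup>2) = M / Q\<^sup>2" by (simp add: mean_linear M_def power_divide)
  also have "((m + d) / R - (M + 2 * d * m + d\<^sup>2) / R\<^sup>2 / 2 + (5 / k) ^ 3) - (m / Q - M / Q\<^sup>2 / 2 - (3 / k) ^ 3)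
      \<le> m * (1 / R - 1 / Q) + d / R + M * (1 / Q\<^sup>2 - 1 / R\<^sup>2) / 2 + 152 / k ^ 3"
  proof -
    have "0 \<le> (2 * d * m + d\<^sup>2) / R\<^sup>2" using pos dB_nonneg by (simp add: d_def)
    then have 1: "M / R\<^sup>2 \<le> (M + 2 * d * m + d\<^sup>2) / R\<^sup>2" by (simp add: add_divide_distrib)
    have 2: "(5 / k) ^ 3 + (3 / k) ^ 3 = 152 / k ^ 3" by (simp add: power_divide)
    have 3: "x - w / 2 + a - (y - z / 2 - b) \<le> x - y + (z - u) / 2 + c"
      if "u \<le> w" "a + b = c" for x w a y z b u c :: real
      using that by (simp add: field_simps)
    show ?thesis
      using 3[OF 1 2, of "(m + d) / R" "m / Q" "M / Q\<^sup>2"]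
      by (simp add: right_diff_distrib add_divide_distrib diff_divide_distrib)
  qed
  \<comment> \<open>The coefficient is negative since \<open>R > Q\<close>: a stronger outward drift
    lowers the potential, so a lower bound on the mean suffices. The coefficient of the second
    moment is positive, which calls for the upper bound \<open>m2\<close>.\<close>
  also have "m * (1 / R - 1 / Q) \<le> (Q / n + 1) * (1 / R - 1 / Q)"
    using m1 R Q unfolding m_def by (intro mult_right_mono_neg) (auto simp: field_simps)
  also have "d / R \<le> (B / n + 4 * (1 + 1 / n)) / R"
    using dB_le R by (intro divide_right_mono) (auto simp: d_def)
  also have "M * (1 / Q\<^sup>2 - 1 / R\<^sup>2) / 2 \<le> (Q * (2 + \<rho>)) * (1 / Q\<^sup>2 - 1 / R\<^sup>2) / 2"
    using m2 R Q unfolding M_def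
    by (intro divide_right_mono mult_right_mono) (auto simp: frac_le power_mono)
  also have "(Q / n + 1) * (1 / R - 1 / Q) + (B / n + 4 * (1 + 1 / n)) / R
        + (Q * (2 + \<rho>)) * (1 / Q\<^sup>2 - 1 / R\<^sup>2) / 2 + 152 / k ^ 3
      = 4 * (1 + 1 / n) / R + B / R\<^sup>2 + \<rho> / 2 * (B / (Q * R) + B / R\<^sup>2) + 152 / k ^ 3"
    using drift_main_terms[of Q R n "4 * (1 + 1 / n)"] R Q n by (simp add: R_def)
  also have "\<rho> / 2 * (B / (Q * R) + B / R\<^sup>2) \<le> \<rho> / 2 * (B / (Q * R) + B / (Q * R))"
    using R Q B \<rho> by (intro mult_left_mono add_left_mono divide_left_mono) (auto simp: power2_eq_square)
  also have "\<dots> = \<rho> * B / (Q * R)" by simp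
  finally show "mean (\<lambda>v. ln (1 + (D v + (B' - B)) / (Q + B)) - ln (1 + D v / Q))
      \<le> 4 * (1 + 1 / n) / (Q + B) + B / (Q + B)\<^sup>2 + \<rho> * B / (Q * (Q + B)) + 152 / k ^ 3"
    unfolding d_def R_def by simp
qed

text \<open>Divided by \<open>sqrt (G / s)\<close>, the claim says that the mean of
  \<open>sqrt (1 + \<Delta> / G)\<close> is at most \<open>sqrt (1 + h)\<close>, where
  \<open>G = ln (1 + B / Q)\<close>, \<open>\<Delta>\<close> is its increment and \<open>h\<close>
  the relative growth of \<open>ln n\<close>. To first order this compares
  \<open>(w + w^2 / 4) / (n s G)\<close> with \<open>1 / (n s)\<close>, where
  \<open>w = B / (Q + B)\<close>.\<close>

lemma transience_drift:
  fixes k n s s' \<rho> :: real and D :: "'a \<Rightarrow> real"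
  defines "Q \<equiv> k\<^sup>2" and "B \<equiv> 4 * n * s" and "B' \<equiv> 4 * (n + 1) * s'"
  assumes s: "s = ln n" "s' = ln (n + 1)" "1000 \<le> s"
    and k: "2000000 * s\<^sup>2 \<le> k" "k \<le> n"
    and D: "\<And>v. v \<in> V \<Longrightarrow> \<bar>D v\<bar> \<le> 3 * k"
    and m1: "Q / n + 1 \<le> mean D"
    and m2: "mean (\<lambda>v. (D v)\<^sup>2) \<le> Q * (2 + \<rho>)" "Q \<le> mean (\<lambda>v. (D v)\<^sup>2)"
    and \<rho>: "0 \<le> \<rho>" "\<rho> * s\<^sup>2 \<le> 1 / 5000"
  shows "mean (\<lambda>v. sqrt (ln (1 + B' / (Q + D v)) / s')) \<le> sqrt (ln (1 + B / Q) / s)"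
proof -
  have s2: "1000000 \<le> s\<^sup>2" using power_mono[OF \<open>1000 \<le> s\<close>, of 2] by simp
  then have k6: "2000000000000 \<le> k" using k by linarith
  have n: "2000000000000 \<le> n" using k k6 by linarith
  have Q: "Q > 0" and B: "B > 0" using k6 n s by (auto simp: Q_def B_def)
  define R where "R = Q + B"
  define w where "w = B / R"
  define G where "G = ln (1 + B / Q)"
  define T where "T v = (D v + (B' - B)) / R" for v
  define t where "t v = D v / Q" for v
  define \<Delta> where "\<Delta> v = ln (1 + T v) - ln (1 + t v)" for v
  define h where "h = s' / s - 1"
  have R: "R > 0" "R > Q" using Q B by (auto simp: R_def)
  have w: "0 < w" "w < 1" using B R Q by (auto simp: w_def R_def)
  note inc = transience_mean_increment[OF s(1,2) _ _ k(2), of D \<rho>, folded Q_def B_def B'_def]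
  have inc1: "mean \<Delta> \<le> 4 * (1 + 1 / n) / R + B / R\<^sup>2 + \<rho> * B / (Q * R) + 152 / k ^ 3"
    using inc(1) s k6 D m1 m2 \<rho> unfolding \<Delta>_def T_def t_def R_def by auto
  have T: "\<bar>T v\<bar> \<le> 5 / k" "\<bar>t v\<bar> \<le> 3 / k" if "v \<in> V" for v
    using inc(2,3) that s k6 D m1 m2 \<rho> unfolding T_def t_def R_def by auto
  have k35: "5 / k \<le> 1/2" "3 / k \<le> 1/2" using k6 by (simp_all add: field_simps)
  have dB: "0 \<le> B' - B" "(B' - B) / B \<le> 2 / n"
    using inc(4,5) s k6 D m1 m2 \<rho> by auto
  \<comment> \<open>\<open>G\<close> equals \<open>- ln (1 - w)\<close>. A factor b in place of 4 in
    \<open>B\<close> would turn the drift term \<open>w^2 / 4\<close> into \<open>w^2 / b\<close>;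
    the factor 4 leaves a margin of \<open>w^2 / 4\<close> below the \<open>w^2 / 2\<close> found
    here.\<close>
  have G_ge: "w + w\<^sup>2 / 2 \<le> G"
  proof -
    have "G = - ln (1 + (- w))"
      using Q B by (simp add: G_def w_def R_def ln_div field_simps)
    moreover have "ln (1 + (- w)) \<le> - w - w\<^sup>2 / 2 + (- w) ^ 3 / 3"
      using ln_add_one_le_cubic[of "- w"] w by simp
    moreover have "(- w) ^ 3 \<le> 0" using w by simp
    ultimately show ?thesis by linarith
  qed
  have G_pos: "0 < G" "w \<le> G" using G_ge w zero_le_power2[of w] by linarith+
  have G': "ln (1 + B' / (Q + D v)) = G * (1 + \<Delta> v / G)" "0 \<le> 1 + \<Delta> v / G" if "v \<in> V" for v
  proof -
    have "\<bar>t v\<bar> \<le> 1/2" "\<bar>T v\<bar> \<le> 1/2"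
      using T[OF that] k35 by linarith+
    then have pos: "0 < 1 + t v" "0 < 1 + T v" by auto
    have 1: "Q + D v = Q * (1 + t v)" using Q by (simp add: t_def field_simps)
    have 2: "Q + D v + B' = R * (1 + T v)" using R by (simp add: T_def R_def field_simps)
    have Qpos: "0 < Q + D v" using 1 pos Q by simp
    have 3: "1 + B' / (Q + D v) = (R * (1 + T v)) / (Q * (1 + t v))"
      using Qpos unfolding 1[symmetric] 2[symmetric] by (simp add: field_simps)
    have 4: "1 + B / Q = R / Q" using Q by (simp add: R_def field_simps)
    have *: "ln (1 + B' / (Q + D v)) = G + \<Delta> v"
      unfolding 3 G_def 4 \<Delta>_def using pos R Q by (simp add: ln_div ln_mult)
    then show "ln (1 + B' / (Q + D v)) = G * (1 + \<Delta> v / G)" using G_pos by (simp add: field_simps)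
    have "0 \<le> B'" using dB B by linarith
    then have "0 \<le> G + \<Delta> v" unfolding *[symmetric] using Qpos by (intro ln_ge_zero) auto
    then show "0 \<le> 1 + \<Delta> v / G" using G_pos by (simp add: field_simps)
  qed
  have s's: "s' = s * (1 + h)" using s by (simp add: h_def)
  have "s' - s = ln (1 + 1 / n)"
    using n unfolding s
    by (simp add: ln_divide_pos[symmetric] add_divide_distrib add.commute flip: ln_div)
  moreover have "ln (1 + 1 / n) \<le> 1 / n" using n by (intro ln_add_one_self_le_self) auto
  moreover have "1 / n - (1 / n)\<^sup>2 / 2 - (1 / n) ^ 3 \<le> ln (1 + 1 / n)"
    using ln_add_one_ge_cubic[of "1 / n"] n by simp
  moreover have "(1 / n) ^ 3 \<le> (1 / n)\<^sup>2 / 2"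
    using n by (simp add: power2_eq_square power3_eq_cube field_simps)
  ultimately have d: "1 / n - 1 / n\<^sup>2 \<le> s' - s" "s' - s \<le> 1 / n"
    by (simp_all add: power_divide)
  have h_eq: "h = (s' - s) / s" using s by (simp add: h_def field_simps)
  have h1: "1 / (n * s) - 1 / (n\<^sup>2 * s) \<le> h" and h2: "h \<le> 1 / (n * s)"
    using divide_right_mono[OF d(1), of s] divide_right_mono[OF d(2), of s] s
    unfolding h_eq by (simp_all add: diff_divide_distrib)
  have "1 / n\<^sup>2 \<le> 1 / n" using n by (simp add: field_simps power2_eq_square)
  then have "0 \<le> s' - s" using d by linarith
  then have h0: "0 \<le> h" using s by (simp add: h_eq)
  have h3: "h\<^sup>2 / 4 \<le> 1 / (n\<^sup>2 * s)"
  proof -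
    have "h\<^sup>2 \<le> (1 / (n * s))\<^sup>2" using h2 h0 by (intro power_mono) auto
    also have "\<dots> = 1 / (n\<^sup>2 * s) * (1 / s)" by (simp add: power2_eq_square)
    also have "\<dots> \<le> 1 / (n\<^sup>2 * s) * 1" using s n by (intro mult_left_mono) auto
    finally have "h\<^sup>2 \<le> 1 / (n\<^sup>2 * s)" by simp
    then show ?thesis using zero_le_power2[of h] by linarith
  qed
  have z1: "mean (\<lambda>v. \<Delta> v / G) \<le> (w + w\<^sup>2 / 4) / (n * s * G) + 1 / (n\<^sup>2 * s) + \<rho> / Q + 152 / (k ^ 3 * G)"
  proof -
    have "4 * (1 + 1 / n) / R = w / (n * s) + w / (n\<^sup>2 * s)"
      using n s R by (simp add: w_def B_def field_simps power2_eq_square)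
    moreover have "B / R\<^sup>2 = w\<^sup>2 / (4 * n * s)"
      using n s R B by (simp add: w_def B_def field_simps power2_eq_square)
    moreover have "\<rho> * B / (Q * R) = \<rho> * w / Q" by (simp add: w_def)
    ultimately have "mean \<Delta> \<le> w / (n * s) + w / (n\<^sup>2 * s) + w\<^sup>2 / (4 * n * s) + \<rho> * w / Q + 152 / k ^ 3"
      using inc1 by simp
    also have "w / (n\<^sup>2 * s) \<le> G / (n\<^sup>2 * s)" using G_pos n s by (intro divide_right_mono) auto
    also have "\<rho> * w / Q \<le> \<rho> * G / Q" using G_pos \<rho> Q by (intro divide_right_mono mult_left_mono) auto
    finally have "mean \<Delta> / G \<le> (w / (n * s) + G / (n\<^sup>2 * s) + w\<^sup>2 / (4 * n * s) + \<rho> * G / Q + 152 / k ^ 3) / G"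
      using G_pos by (intro divide_right_mono) auto
    also have "\<dots> = (w + w\<^sup>2 / 4) / (n * s * G) + 1 / (n\<^sup>2 * s) + \<rho> / Q + 152 / (k ^ 3 * G)"
      using G_pos by (simp add: add_divide_distrib)
    finally show ?thesis by (simp add: mean_linear)
  qed
  \<comment> \<open>For \<open>B \<le> Q\<close> the first-order margin is already of order
    \<open>1 / Q\<close> and absorbs all errors. For \<open>B > Q\<close> it is at most of order
    \<open>1 / (n s)\<close>, possibly far below \<open>\<rho> / Q\<close>; there the quadratic term
    of the square root gains a multiple of \<open>1 / (s^2 Q)\<close>, because
    \<open>G \<le> 2 s\<close>.\<close>
  have main: "mean (\<lambda>v. sqrt (1 + \<Delta> v / G)) \<le> 1 + h / 2 - h\<^sup>2 / 8"
  proof (cases "B \<le> Q")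
    case True
    have n2: "1 / n\<^sup>2 \<le> 1 / Q"
      using k k6 Q unfolding Q_def by (intro divide_left_mono power_mono) auto
    have w2: "2 * n * s / Q \<le> w"
    proof -
      have "B / (2 * Q) \<le> B / R" using True B Q by (intro divide_left_mono) (auto simp: R_def)
      then show ?thesis by (simp add: w_def B_def)
    qed
    have "G \<le> B / Q" unfolding G_def using B Q by (intro ln_add_one_self_le_self) auto
    also have "B / Q \<le> 2 * w" using True B Q by (simp add: w_def R_def field_simps)
    finally have G2: "G \<le> 2 * w" .
    \<comment> \<open>Since \<open>G \<le> 2 w\<close> here, the surplus \<open>w^2 / 4\<close> of
      \<open>G\<close> is at least \<open>G w / 8\<close>. With \<open>w \<ge> 2 n s / Q\<close>
      this becomes the margin \<open>1 / (4 Q)\<close>.\<close>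
    have "(w + w\<^sup>2 / 4) \<le> G * (1 - w / 8)"
    proof -
      have "G * (w / 8) \<le> 2 * w * (w / 8)" using G2 w by (intro mult_right_mono) auto
      then show ?thesis using G_ge by (simp add: algebra_simps power2_eq_square)
    qed
    then have "(w + w\<^sup>2 / 4) / (n * s * G) \<le> G * (1 - w / 8) / (n * s * G)"
      using n s G_pos by (intro divide_right_mono) auto
    also have "\<dots> = 1 / (n * s) - w / (8 * n * s)" using G_pos n s by (simp add: field_simps)
    also have "\<dots> \<le> 1 / (n * s) - (2 * n * s / Q) / (8 * n * s)"
      using w2 n s by (intro diff_left_mono divide_right_mono) auto
    also have "\<dots> = 1 / (n * s) - 1 / (4 * Q)" using n s Q by (simp add: field_simps)
    finally have a: "(w + w\<^sup>2 / 4) / (n * s * G) \<le> 1 / (n * s) - (1 / Q) * (1 / 4)" by simp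
    have b: "1 / (n\<^sup>2 * s) \<le> (1 / Q) * (1 / 1000)"
    proof -
      have "1 / (n\<^sup>2 * s) = (1 / n\<^sup>2) * (1 / s)" by simp
      also have "\<dots> \<le> (1 / Q) * (1 / 1000)" using n2 s Q n by (intro mult_mono) auto
      finally show ?thesis .
    qed
    have c: "152 / (k ^ 3 * G) \<le> (1 / Q) * (76 / 1000)"
    proof -
      have "152 / (k ^ 3 * G) \<le> 152 / (k ^ 3 * (2 * n * s / Q))"
        using w2 G_pos k6 n s Q by (intro divide_left_mono mult_left_mono mult_pos_pos) auto
      also have "\<dots> = 76 / (k * n * s)"
        using k6 n s unfolding Q_def by (simp add: field_simps power2_eq_square power3_eq_cube)
      also have "\<dots> \<le> 76 / (k * k * 1000)"
        using k k6 s n by (intro divide_left_mono mult_mono mult_left_mono mult_pos_pos) auto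
      finally show ?thesis by (simp add: Q_def power2_eq_square)
    qed
    have "\<rho> * 1 \<le> \<rho> * s\<^sup>2" using \<rho> s2 by (intro mult_left_mono) auto
    then have "\<rho> \<le> 1 / 5000" using \<rho> by linarith
    then have "\<rho> / Q \<le> (1 / 5000) / Q" using Q by (intro divide_right_mono) auto
    then have e: "\<rho> / Q \<le> (1 / Q) * (1 / 5000)" by simp
    have "mean (\<lambda>v. sqrt (1 + \<Delta> v / G)) \<le> mean (\<lambda>v. 1 + (\<Delta> v / G) / 2)"
    proof (intro mean_mono sqrt_one_plus_le)
      show "-1 \<le> \<Delta> v / G" if "v \<in> V" for v using G'(2)[OF that] by linarith
    qed
    also have "\<dots> = 1 + mean (\<lambda>v. \<Delta> v / G) / 2" by (simp add: mean_linear)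
    finally have f: "mean (\<lambda>v. sqrt (1 + \<Delta> v / G)) \<le> 1 + mean (\<lambda>v. \<Delta> v / G) / 2" .
    define u where "u = 1 / Q"
    have "0 < u" using Q by (simp add: u_def)
    then have "mean (\<lambda>v. \<Delta> v / G) \<le> h - h\<^sup>2 / 4"
      using z1 a b c e h1 h3 unfolding u_def[symmetric] by linarith
    then show ?thesis using f by linarith
  next
    case False
    have w2: "1 / 2 < w" using False B Q by (simp add: w_def R_def field_simps)
    have G_le: "G \<le> 2 * s"
    proof -
      have "Q \<ge> 1" using k6 unfolding Q_def by (simp add: power2_eq_square mult_ge1_I)
      then have "1 + B / Q \<le> 1 + B" using B by (simp add: field_simps)
      also have "\<dots> \<le> n * n"
      proof -
        have "s \<le> s\<^sup>2" using s by (simp add: power2_eq_square)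
        then have "1 + 4 * s \<le> n" using k s by linarith
        then have "n * (1 + 4 * s) \<le> n * n" using n by (intro mult_left_mono) auto
        then show ?thesis using n by (simp add: B_def algebra_simps)
      qed
      finally have "ln (1 + B / Q) \<le> ln (n * n)" using B Q n by (intro ln_mono) (auto intro: add_pos_pos)
      also have "\<dots> = 2 * s" using n s by (simp add: ln_mult)
      finally show ?thesis by (simp add: G_def)
    qed
    \<comment> \<open>Linearisation of the increment: \<open>68 = 2 * (9 + 25)\<close> comes from
      the quadratic remainders of the two logarithms, \<open>2 / n\<close> from the growth of
      \<open>B\<close>.\<close>
    have \<Delta>w: "\<bar>\<Delta> v + w * t v\<bar> \<le> 68 / Q + 2 / n" if v: "v \<in> V" for v
    proof -
      have small: "\<bar>t v\<bar> \<le> 1/2" "\<bar>T v\<bar> \<le> 1/2"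
        using T[OF that] k35 by linarith+
      have "\<bar>ln (1 + t v) - t v\<bar> \<le> 2 * (t v)\<^sup>2" "\<bar>ln (1 + T v) - T v\<bar> \<le> 2 * (T v)\<^sup>2"
        by (rule abs_ln_one_plus_x_minus_x_bound; fact small)+
      moreover have "(t v)\<^sup>2 \<le> (3 / k)\<^sup>2" "(T v)\<^sup>2 \<le> (5 / k)\<^sup>2"
        using T[OF v] by (metis abs_ge_zero power2_abs power_mono)+
      moreover have "(3 / k)\<^sup>2 = 9 / Q" "(5 / k)\<^sup>2 = 25 / Q" by (simp_all add: Q_def power_divide)
      moreover have "T v - t v = (B' - B) / R - w * t v"
      proof -
        have "w / Q = 1 / Q - 1 / R"
          using R Q by (simp add: w_def field_simps) (simp add: R_def algebra_simps)
        moreover have "w * t v = D v * (w / Q)" by (simp add: t_def)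
        ultimately have "w * t v = D v * (1 / Q - 1 / R)" by (simp only:)
        then show ?thesis by (simp add: T_def t_def right_diff_distrib add_divide_distrib)
      qed
      moreover have "0 \<le> (B' - B) / R" "(B' - B) / R \<le> (B' - B) / B"
        using dB R B Q by (auto simp: R_def intro!: divide_left_mono)
      ultimately show ?thesis unfolding \<Delta>_def using dB(2) by linarith
    qed
    have n2: "1 / n\<^sup>2 \<le> (1 / Q) * (4 * s / n)"
      using False Q n by (simp add: B_def field_simps power2_eq_square)
    have sn: "s\<^sup>2 / n \<le> 1 / 2000000" "s\<^sup>2 / k \<le> 1 / 2000000" using k k6 n by (auto simp: field_simps)
    have ssn: "s / n \<le> 1 / 2000000000"
    proof -
      have "1000 * s \<le> s\<^sup>2" using s by (simp add: power2_eq_square)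
      then have "1000 * s / n \<le> s\<^sup>2 / n" using n by (intro divide_right_mono) auto
      moreover have "1000 * s / n = 1000 * (s / n)" by simp
      ultimately show ?thesis using sn by linarith
    qed
    have e2: "(68 / Q + 2 / n)\<^sup>2 \<le> 1 / (16 * Q)"
    proof -
      have "(68 / Q + 2 / n)\<^sup>2 \<le> 2 * (68 / Q)\<^sup>2 + 2 * (2 / n)\<^sup>2"
        using zero_le_power2[of "68 / Q - 2 / n"] by (simp add: power2_eq_square algebra_simps)
      also have "(68 / Q)\<^sup>2 \<le> (1 / Q) * (1 / 200)"
      proof -
        have "k * 1 \<le> k * k" using k6 by (intro mult_left_mono) auto
        then have "k \<le> Q" by (simp only: Q_def power2_eq_square mult_1_right)
        then have "924800 \<le> Q" using k6 by linarith
        then have "4624 / Q \<le> 1 / 200" using Q by (simp add: field_simps)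
        then have "(1 / Q) * (4624 / Q) \<le> (1 / Q) * (1 / 200)" using Q by (intro mult_left_mono) auto
        then show ?thesis by (simp add: power2_eq_square)
      qed
      also have "(2 / n)\<^sup>2 \<le> (1 / Q) * (1 / 200)"
      proof -
        have "(2 / n)\<^sup>2 = 4 * (1 / n\<^sup>2)" by (simp add: power_divide)
        also have "\<dots> \<le> (1 / Q) * (16 * (s / n))" using n2 by simp
        also have "\<dots> \<le> (1 / Q) * (1 / 200)"
        proof (rule mult_left_mono)
          show "16 * (s / n) \<le> 1 / 200" using ssn by linarith
        qed (use Q in auto)
        finally show ?thesis .
      qed
      also have "2 * ((1 / Q) * (1 / 200)) + 2 * ((1 / Q) * (1 / 200)) \<le> 1 / (16 * Q)"
        using Q by (simp add: field_simps)
      finally show ?thesis by simp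
    qed
    \<comment> \<open>The increment is \<open>- w t\<close> up to a small error. As
      \<open>w > 1/2\<close> and the mean of \<open>t^2\<close> is at least \<open>1 / Q\<close>,
      half of the square of \<open>w t\<close> contributes \<open>1 / (8 Q)\<close>, of which the
      squared error takes away at most half.\<close>
    have sq: "1 / (16 * Q) \<le> mean (\<lambda>v. (\<Delta> v)\<^sup>2)"
    proof -
      have "1 / (16 * Q) \<le> (1 / 8) * (1 / Q) - 1 / (16 * Q)" using Q by (simp add: field_simps)
      also have "(1 / 8) * (1 / Q) \<le> (w\<^sup>2 / 2) * (mean (\<lambda>v. (D v)\<^sup>2) / Q\<^sup>2)"
      proof (intro mult_mono)
        have "(1 / 2)\<^sup>2 \<le> w\<^sup>2" using w2 by (intro power_mono) auto
        then show "1 / 8 \<le> w\<^sup>2 / 2" by (simp add: power2_eq_square)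
        show "1 / Q \<le> mean (\<lambda>v. (D v)\<^sup>2) / Q\<^sup>2"
          using m2(2) Q by (simp add: field_simps power2_eq_square)
      qed (use Q in auto)
      also have "mean (\<lambda>v. (D v)\<^sup>2) / Q\<^sup>2 = mean (\<lambda>v. (t v)\<^sup>2)"
        by (simp add: t_def power_divide mean_linear)
      also have "(w\<^sup>2 / 2) * mean (\<lambda>v. (t v)\<^sup>2) - 1 / (16 * Q) = mean (\<lambda>v. (w\<^sup>2 / 2) * (t v)\<^sup>2 - 1 / (16 * Q))"
        by (simp only: mean_linear)
      also have "\<dots> \<le> mean (\<lambda>v. (\<Delta> v)\<^sup>2)"
      proof (rule mean_mono)
        fix v assume v: "v \<in> V"
        have "(\<Delta> v + w * t v)\<^sup>2 \<le> (68 / Q + 2 / n)\<^sup>2"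
          using \<Delta>w[OF v] by (metis abs_ge_zero power2_abs power_mono)
        then have "(\<Delta> v + w * t v)\<^sup>2 \<le> 1 / (16 * Q)" using e2 by linarith
        moreover have "(w\<^sup>2 / 2) * (t v)\<^sup>2 \<le> (\<Delta> v)\<^sup>2 + (\<Delta> v + w * t v)\<^sup>2"
          using zero_le_power2[of "2 * \<Delta> v + w * t v"] by (simp add: power2_eq_square algebra_simps)
        ultimately show "(w\<^sup>2 / 2) * (t v)\<^sup>2 - 1 / (16 * Q) \<le> (\<Delta> v)\<^sup>2" by linarith
      qed
      finally show ?thesis by simp
    qed
    have "1 / (64 * s\<^sup>2 * Q) \<le> mean (\<lambda>v. (\<Delta> v / G)\<^sup>2)"
    proof -
      have "1 / (64 * s\<^sup>2 * Q) = (1 / (16 * Q)) / (2 * s)\<^sup>2" by (simp add: power2_eq_square)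
      also have "\<dots> \<le> mean (\<lambda>v. (\<Delta> v)\<^sup>2) / G\<^sup>2"
      proof (intro frac_le power_mono)
        have "0 \<le> 1 / (16 * Q)" using Q by simp
        then show "0 \<le> mean (\<lambda>v. (\<Delta> v)\<^sup>2)" using sq by linarith
      qed (use sq G_le G_pos in auto)
      finally show ?thesis by (simp add: power_divide mean_linear)
    qed
    then have g: "(1 / Q) * (1 / s\<^sup>2) * (1 / 512) \<le> mean (\<lambda>v. (\<Delta> v / G)\<^sup>2) / 8"
      by (simp add: mult_ac)
    have zsmall: "\<bar>\<Delta> v / G\<bar> \<le> 1 / 2" if v: "v \<in> V" for v
    proof -
      have "\<bar>w * t v\<bar> \<le> 1 * (3 / k)"
        unfolding abs_mult using T[OF v] w by (intro mult_mono) auto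
      moreover have "68 / Q \<le> 1 / 100" "2 / n \<le> 1 / 100" "3 / k \<le> 1 / 100"
        using k6 n mult_mono[of 1 k 1000000 k] by (auto simp: Q_def field_simps power2_eq_square)
      ultimately have "\<bar>\<Delta> v\<bar> \<le> 1 / 4" using \<Delta>w[OF v] by linarith
      then have "\<bar>\<Delta> v\<bar> \<le> G / 2" using G_pos w2 by linarith
      then show ?thesis using G_pos by (simp add: field_simps)
    qed
    have "mean (\<lambda>v. sqrt (1 + \<Delta> v / G)) \<le> mean (\<lambda>v. 1 + (\<Delta> v / G) / 2 - (\<Delta> v / G)\<^sup>2 / 16)"
      using zsmall by (intro mean_mono sqrt_one_plus_le_quadratic)
    also have "\<dots> = 1 + mean (\<lambda>v. \<Delta> v / G) / 2 - mean (\<lambda>v. (\<Delta> v / G)\<^sup>2) / 16"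
      by (simp only: mean_linear)
    finally have f: "mean (\<lambda>v. sqrt (1 + \<Delta> v / G))
      \<le> 1 + mean (\<lambda>v. \<Delta> v / G) / 2 - mean (\<lambda>v. (\<Delta> v / G)\<^sup>2) / 16" .
    have "w + w\<^sup>2 / 4 \<le> G" using G_ge zero_le_power2[of w] by linarith
    then have "(w + w\<^sup>2 / 4) / (n * s * G) \<le> G / (n * s * G)"
      using n s G_pos by (intro divide_right_mono) auto
    then have a: "(w + w\<^sup>2 / 4) / (n * s * G) \<le> 1 / (n * s)" using G_pos by simp
    define u where "u = (1 / Q) * (1 / s\<^sup>2)"
    have u: "u > 0" using Q s by (simp add: u_def)
    have sn4: "4 * (s\<^sup>2 / n) \<le> 1 / 5000" "304 * (s\<^sup>2 / k) \<le> 1 / 5000" using sn by linarith+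
    have b: "1 / (n\<^sup>2 * s) \<le> u * (1 / 5000)"
    proof -
      have "1 / (n\<^sup>2 * s) = (1 / n\<^sup>2) * (1 / s)" by simp
      also have "\<dots> \<le> (1 / Q) * (4 * s / n) * (1 / s)" using n2 s by (intro mult_right_mono) auto
      also have "\<dots> = u * (4 * (s\<^sup>2 / n))" using s by (simp add: u_def field_simps power2_eq_square)
      also have "\<dots> \<le> u * (1 / 5000)" using sn4 u by (intro mult_left_mono) auto
      finally show ?thesis .
    qed
    have c: "152 / (k ^ 3 * G) \<le> u * (1 / 5000)"
    proof -
      have "152 / (k ^ 3 * G) \<le> 152 / (k ^ 3 * (1 / 2))"
        using w2 G_pos k6 by (intro divide_left_mono mult_left_mono mult_pos_pos) auto
      also have "\<dots> = u * (304 * (s\<^sup>2 / k))"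
        using k6 s unfolding Q_def u_def by (simp add: field_simps power2_eq_square power3_eq_cube)
      also have "\<dots> \<le> u * (1 / 5000)" using sn4 u by (intro mult_left_mono) auto
      finally show ?thesis .
    qed
    have e: "\<rho> / Q \<le> u * (1 / 5000)"
    proof -
      have "\<rho> / Q = u * (\<rho> * s\<^sup>2)" using s by (simp add: u_def)
      also have "\<dots> \<le> u * (1 / 5000)" using \<rho> u by (intro mult_left_mono) auto
      finally show ?thesis .
    qed
    \<comment> \<open>Five errors of at most \<open>u / 5000\<close> each stand against a gain of
      \<open>u / 512\<close>; the term \<open>1 / (n^2 s)\<close> occurs three times among them,
      once in \<open>z1\<close>, once in \<open>h1\<close> and once in \<open>h3\<close>.\<close>
    have "mean (\<lambda>v. \<Delta> v / G) - mean (\<lambda>v. (\<Delta> v / G)\<^sup>2) / 8 \<le> h - h\<^sup>2 / 4"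
      using z1 a b c e h1 h3 g[folded u_def] u by linarith
    then show ?thesis using f by linarith
  qed
  have "mean (\<lambda>v. sqrt (ln (1 + B' / (Q + D v)) / s'))
      = mean (\<lambda>v. (sqrt (G / s) / sqrt (1 + h)) * sqrt (1 + \<Delta> v / G))"
    using G' by (intro mean_cong) (simp add: s's real_sqrt_divide real_sqrt_mult)
  also have "\<dots> = (sqrt (G / s) / sqrt (1 + h)) * mean (\<lambda>v. sqrt (1 + \<Delta> v / G))"
    by (simp only: mean_linear)
  also have "\<dots> \<le> (sqrt (G / s) / sqrt (1 + h)) * sqrt (1 + h)"
    using main sqrt_one_plus_ge[OF h0] G_pos s h0 by (intro mult_left_mono) auto
  also have "\<dots> = sqrt (G / s)" using h0 by simp
  finally show ?thesis by (simp add: G_def)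
qed

end

section \<open>Drift of the potential in the recurrent regime\<close>

text \<open>Each logarithm has its task. \<open>ln Q\<close> is almost a martingale for small Q, and
  \<open>ln (ln Q)\<close> adds the negative drift that beats the errors. The subtracted terms
  remove the growth in time: for Q at most of order n they amount to \<open>ln n\<close> up to a
  constant, with drift \<open>- 1 / n\<close> against the \<open>2 a / n\<close> of
  \<open>ln Q\<close>. For larger Q half of the deficit \<open>1 - 2 a\<close> remains, and the
  transition between the two ranges yields the additional gain \<open>n / (16 R^2)\<close> with
  \<open>R = n / 8 + Q\<close>.\<close>

definition log_profile :: "real \<Rightarrow> real \<Rightarrow> real" where
  "log_profile n Q = ln Q + ln (ln Q) - ln (n / 8 + Q) / 2 - ln n / 2"

definition log_potential :: "real \<Rightarrow> real \<Rightarrow> real \<Rightarrow> real" where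
  "log_potential c n Q = ln (ln n) + c / ln n * log_profile n Q + c"

text \<open>The profile is at least \<open>- ln n\<close>, because
  \<open>n / 8 + Q \<le> n * Q\<^sup>2\<close>; the summand \<open>c\<close> in the potential
  compensates for this. The lower bound tends to infinity wherever the walk is, which is what
  forbids staying outside the ball forever.\<close>

lemma log_potential_ge:
  assumes "0 \<le> c" "3 \<le> n" "3 \<le> Q"
  shows "ln (ln n) \<le> log_potential c n Q"
proof -
  have e: "exp 1 \<le> (3::real)" by (rule exp_le)
  then have l: "1 \<le> ln n" "1 \<le> ln Q" using assms by (auto simp: ln_ge_iff intro: order_trans)
  have "n / 8 + Q \<le> n * Q\<^sup>2"
  proof -
    have "n * 1 \<le> n * Q\<^sup>2" using assms by (intro mult_left_mono one_le_power) auto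
    moreover have "2 * Q \<le> n * Q\<^sup>2"
      using assms unfolding power2_eq_square mult.assoc[symmetric]
      by (intro mult_right_mono) (auto intro: order_trans[OF _ mult_mono[of 3 n 3 Q]])
    ultimately show ?thesis using assms by linarith
  qed
  then have "ln (n / 8 + Q) \<le> ln (n * Q\<^sup>2)" using assms by (intro ln_mono) (auto intro: add_pos_pos)
  also have "\<dots> = ln n + 2 * ln Q" using assms by (simp add: ln_mult ln_realpow)
  finally have "- ln n \<le> log_profile n Q" using l ln_ge_zero[of "ln Q"] unfolding log_profile_def by linarith
  then have "c / ln n * (- ln n) \<le> c / ln n * log_profile n Q"
    using assms l by (intro mult_left_mono) auto
  moreover have "c / ln n * (- ln n) = - c" using l by auto
  ultimately show ?thesis unfolding log_potential_def by linarith
qed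

context finite_distribution
begin

text \<open>The four logarithms are expanded separately in \<open>p1\<close> to \<open>p4\<close>.
  The hypothesis \<open>err\<close> covers two ranges: for Q below n the negative term from
  \<open>ln (ln Q)\<close> has to dominate the errors, for Q above n a fraction of the deficit on
  the right side does.\<close>

lemma recurrence_mean_log_profile:
  fixes k n a \<rho> :: real and D :: "'a \<Rightarrow> real"
  defines "Q \<equiv> k\<^sup>2"
  defines "u \<equiv> ln Q" and "R \<equiv> n / 8 + Q" and "\<rho>' \<equiv> \<rho> + 1 / Q + 1 / n"
  assumes a: "-1/2 \<le> a" "a \<le> 1/2"
    and k: "100 \<le> k" "k \<le> n"
    and D: "\<And>v. v \<in> V \<Longrightarrow> \<bar>D v\<bar> \<le> 3 * k"
    and m1: "mean D = 1 + 2 * a * Q / n"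
    and m2: "\<bar>mean (\<lambda>v. (D v)\<^sup>2) - 2 * Q\<bar> \<le> \<rho> * Q" and \<rho>: "0 \<le> \<rho>" "\<rho> \<le> 1"
    and slow: "1 / u + 1 / n \<le> (1 - 2 * a) / 16"
    and err: "n * (2 * \<rho>' + 86 / k - 1 / (16 * u\<^sup>2)) \<le> (1 - 2 * a) / 16 * Q"
  shows "mean (\<lambda>v. log_profile (n + 1) (Q + D v)) - log_profile n Q \<le> - (3 * (1 - 2 * a) / (8 * n)) - n / (16 * R\<^sup>2)"
proof -
  have n: "100 \<le> n" using k by linarith
  have "100\<^sup>2 \<le> k\<^sup>2" using k by (intro power_mono) auto
  then have Q: "10000 \<le> Q" by (simp add: Q_def)
  have "exp 1 \<le> Q" using exp_le Q by linarith
  then have u: "1 \<le> u" using Q unfolding u_def by (subst ln_ge_iff) auto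
  have R: "R > 0" "R > Q" using Q n by (auto simp: R_def)
  define t where "t v = D v / Q" for v
  define T where "T v = (D v + 1 / 8) / R" for v
  define L where "L v = ln (1 + t v)" for v
  define M where "M = mean (\<lambda>v. (D v)\<^sup>2)"
  have k2: "1 / k \<le> 1 / 100" using k by (intro divide_left_mono) auto
  have kQ: "1 / Q = (1 / k) * (1 / k)" by (simp add: Q_def power2_eq_square)
  have t: "\<bar>t v\<bar> \<le> 3 / k" if "v \<in> V" for v
    using D[OF that] k by (simp add: t_def Q_def abs_mult field_simps power2_eq_square)
  have T: "\<bar>T v\<bar> \<le> 4 / k" if "v \<in> V" for v
  proof -
    have "\<bar>T v\<bar> = \<bar>D v + 1 / 8\<bar> / R" using R by (simp add: T_def)
    also have "\<dots> \<le> (4 * k) / Q"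
      using D[OF that] k R Q by (intro frac_le) auto
    also have "\<dots> = 4 / k" using k by (simp add: Q_def power2_eq_square)
    finally show ?thesis .
  qed
  have t2: "(t v)\<^sup>2 \<le> 9 / Q" if "v \<in> V" for v
  proof -
    have "(t v)\<^sup>2 \<le> (3 / k)\<^sup>2" using t[OF that] by (metis abs_ge_zero power2_abs power_mono)
    then show ?thesis by (simp add: Q_def power_divide)
  qed
  have Q4: "1 / Q \<le> 1 / 10000" using Q by (intro divide_left_mono) auto
  have L: "\<bar>L v - t v\<bar> \<le> 2 * (t v)\<^sup>2" "\<bar>L v\<bar> \<le> 1 / 4" if "v \<in> V" for v
  proof -
    have "\<bar>t v\<bar> \<le> 1/2" using t[OF that] k2 by linarith
    then show 1: "\<bar>L v - t v\<bar> \<le> 2 * (t v)\<^sup>2" unfolding L_def by (rule abs_ln_one_plus_x_minus_x_bound)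
    show "\<bar>L v\<bar> \<le> 1 / 4" using 1 t2[OF that] t[OF that] k2 Q4 by linarith
  qed
  have lnQ: "ln (Q + D v) = u + L v" "ln (u + L v) = ln u + ln (1 + L v / u)"
    "ln ((n + 1) / 8 + (Q + D v)) = ln R + ln (1 + T v)" if "v \<in> V" for v
  proof -
    have pos: "0 < 1 + t v" "0 < 1 + T v" using t[OF that] T[OF that] k2 by linarith+
    have "Q + D v = Q * (1 + t v)" using Q by (simp add: t_def field_simps)
    then show 1: "ln (Q + D v) = u + L v" using pos Q by (simp add: u_def L_def ln_mult)
    have "\<bar>L v / u\<bar> \<le> 1 / 4"
      using L(2)[OF that] u by (simp add: field_simps)
    then have "0 < 1 + L v / u" by linarith
    moreover have "u + L v = u * (1 + L v / u)" using u by (simp add: field_simps)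
    ultimately show "ln (u + L v) = ln u + ln (1 + L v / u)" using u by (simp add: ln_mult)
    have "(n + 1) / 8 + (Q + D v) = R * (1 + T v)" using R by (simp add: T_def R_def field_simps)
    then show "ln ((n + 1) / 8 + (Q + D v)) = ln R + ln (1 + T v)" using pos R by (simp add: ln_mult)
  qed
  have p1: "mean L \<le> 2 * a / n + \<rho> / (2 * Q) + 27 / k ^ 3"
  proof -
    have "mean L \<le> mean t - mean (\<lambda>v. (t v)\<^sup>2) / 2 + (3 / k) ^ 3"
      unfolding L_def using t k2 by (intro mean_ln_le) auto
    also have "mean t = 1 / Q + 2 * a / n"
      unfolding t_def mean_linear m1 using Q by (simp add: add_divide_distrib)
    also have "mean (\<lambda>v. (t v)\<^sup>2) = M / Q\<^sup>2" by (simp add: t_def M_def mean_linear power_divide)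
    also have "(3 / k) ^ 3 = 27 / k ^ 3" by (simp add: power_divide)
    finally have 1: "mean L \<le> 1 / Q + 2 * a / n - M / Q\<^sup>2 / 2 + 27 / k ^ 3" .
    have "(2 - \<rho>) * Q \<le> M" using m2 unfolding M_def by (simp add: algebra_simps)
    then have 2: "(2 - \<rho>) * Q / Q\<^sup>2 \<le> M / Q\<^sup>2" by (intro divide_right_mono) auto
    have 3: "(2 - \<rho>) * Q / Q\<^sup>2 = 2 * (1 / Q) - 2 * (\<rho> / (2 * Q))"
      using Q by (simp add: field_simps power2_eq_square)
    have "l \<le> A + r + K" if "l \<le> i + A - m / 2 + K" "x \<le> m" "x = 2 * i - 2 * r"
      for l i A m K x r :: real using that by linarith
    from this[OF 1 2 3] show ?thesis .
  qed
  \<comment> \<open>The gain \<open>1 / (16 u^2 Q)\<close> is the second-order term of the outer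
    logarithm, fed by a lower bound \<open>1 / (4 Q)\<close> for the mean square of the increment of
    \<open>ln Q\<close>.\<close>
  have p2: "mean (\<lambda>v. ln (1 + L v / u)) \<le> (2 * a / n + \<rho> / (2 * Q) + 27 / k ^ 3) / u - 1 / (16 * u\<^sup>2 * Q)"
  proof -
    have "1 / (4 * Q) \<le> mean (\<lambda>v. (L v)\<^sup>2)"
    proof -
      have "1 * Q \<le> M" using m2 mult_right_mono[OF \<rho>(2), of Q] Q unfolding M_def by (simp only: abs_le_iff) linarith
      then have "Q / Q\<^sup>2 \<le> M / Q\<^sup>2" by (intro divide_right_mono) auto
      moreover have "Q / Q\<^sup>2 = 1 / Q" using Q by (simp add: power2_eq_square)
      moreover have "M / Q\<^sup>2 = mean (\<lambda>v. (t v)\<^sup>2)" by (simp add: t_def M_def mean_linear power_divide)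
      ultimately have 1: "1 / Q \<le> mean (\<lambda>v. (t v)\<^sup>2)" by simp
      have 2: "mean (\<lambda>v. (t v)\<^sup>2 / 2 - 324 * (1 / Q)\<^sup>2) \<le> mean (\<lambda>v. (L v)\<^sup>2)"
      proof (rule mean_mono)
        fix v assume v: "v \<in> V"
        have "\<bar>L v - t v\<bar> \<le> 18 / Q" using L(1)[OF v] t2[OF v] by linarith
        then have "(L v - t v)\<^sup>2 \<le> (18 / Q)\<^sup>2" by (metis abs_ge_zero power2_abs power_mono)
        moreover have "(18 / Q)\<^sup>2 = 324 * (1 / Q)\<^sup>2" by (simp add: power_divide)
        moreover have "(t v)\<^sup>2 / 2 \<le> (L v)\<^sup>2 + (L v - t v)\<^sup>2"
          using zero_le_power2[of "2 * L v - t v"] by (simp add: power2_eq_square algebra_simps)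
        ultimately show "(t v)\<^sup>2 / 2 - 324 * (1 / Q)\<^sup>2 \<le> (L v)\<^sup>2" by linarith
      qed
      have 3: "(1 / Q)\<^sup>2 \<le> (1 / Q) * (1 / 10000)"
        unfolding power2_eq_square using Q4 Q by (intro mult_left_mono) auto
      have "i4 \<le> z" if "i \<le> y" "y / 2 - 324 * j \<le> z" "j \<le> i * (1 / 10000)" "i4 = i / 4" "0 \<le> i"
        for i i4 j y z :: real using that by linarith
      from this[OF 1 2[unfolded mean_linear] 3] show ?thesis using Q by simp
    qed
    then have sq: "1 / (16 * u\<^sup>2 * Q) \<le> mean (\<lambda>v. (L v)\<^sup>2) / (4 * u\<^sup>2)"
      using divide_right_mono[of "1 / (4 * Q)" "mean (\<lambda>v. (L v)\<^sup>2)" "4 * u\<^sup>2"] by (simp add: mult_ac)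
    have "mean (\<lambda>v. ln (1 + L v / u)) \<le> mean (\<lambda>v. L v / u - (L v)\<^sup>2 / (4 * u\<^sup>2))"
    proof (rule mean_mono)
      fix v assume v: "v \<in> V"
      define x where "x = L v / u"
      have x: "\<bar>x\<bar> \<le> 1 / 4" unfolding x_def using L(2)[OF v] u by (simp add: field_simps)
      have "x ^ 3 = x * x\<^sup>2" by (simp add: power2_eq_square power3_eq_cube)
      also have "\<dots> \<le> (1 / 4) * x\<^sup>2" using x by (intro mult_right_mono) auto
      finally have "x ^ 3 / 3 \<le> x\<^sup>2 / 4" using zero_le_power2[of x] by linarith
      moreover have "ln (1 + x) \<le> x - x\<^sup>2 / 2 + x ^ 3 / 3" using x by (intro ln_add_one_le_cubic) linarith
      ultimately have "ln (1 + x) \<le> x - x\<^sup>2 / 4" by linarith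
      then show "ln (1 + L v / u) \<le> L v / u - (L v)\<^sup>2 / (4 * u\<^sup>2)" by (simp add: x_def power_divide)
    qed
    also have "\<dots> = mean L / u - mean (\<lambda>v. (L v)\<^sup>2) / (4 * u\<^sup>2)" by (simp only: mean_linear)
    also have "mean L / u \<le> (2 * a / n + \<rho> / (2 * Q) + 27 / k ^ 3) / u"
      using p1 u by (intro divide_right_mono) auto
    finally show ?thesis using sq by linarith
  qed
  have p3: "(1 + 2 * a * Q / n + 1 / 8) / R - Q / R\<^sup>2 - \<rho>' / (2 * Q) - 64 / k ^ 3 \<le> mean (\<lambda>v. ln (1 + T v))"
  proof -
    have "mean T - mean (\<lambda>v. (T v)\<^sup>2) / 2 - (4 / k) ^ 3 \<le> mean (\<lambda>v. ln (1 + T v))"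
      using T k2 by (intro mean_ln_ge) auto
    moreover have "mean T = (1 + 2 * a * Q / n + 1 / 8) / R"
      unfolding T_def mean_linear m1 ..
    moreover have "(4 / k) ^ 3 = 64 / k ^ 3" by (simp add: power_divide)
    moreover have "mean (\<lambda>v. (T v)\<^sup>2) / 2 \<le> Q / R\<^sup>2 + \<rho>' / (2 * Q)"
    proof -
      have "mean (\<lambda>v. (T v)\<^sup>2) = mean (\<lambda>v. ((D v)\<^sup>2 + 1 / 4 * D v + 1 / 64) / R\<^sup>2)"
        by (intro mean_cong) (simp add: T_def power_divide power2_eq_square algebra_simps)
      also have "\<dots> = (M + 1 / 4 * (1 + 2 * a * Q / n) + 1 / 64) / R\<^sup>2"
        by (simp only: mean_linear m1 M_def)
      also have "\<dots> \<le> (2 * Q + \<rho>' * Q) / R\<^sup>2"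
      proof (intro divide_right_mono)
        have "M \<le> 2 * Q + \<rho> * Q" using m2 unfolding M_def by linarith
        moreover have "2 * a * (Q / n) \<le> 1 * (Q / n)" using a Q n by (intro mult_right_mono) auto
        moreover have "\<rho>' * Q = \<rho> * Q + 1 + Q / n" using Q by (simp add: \<rho>'_def distrib_right)
        moreover have "0 \<le> Q / n" using Q n by simp
        ultimately show "M + 1 / 4 * (1 + 2 * a * Q / n) + 1 / 64 \<le> 2 * Q + \<rho>' * Q"
          by (simp add: algebra_simps)
      qed simp
      finally have "mean (\<lambda>v. (T v)\<^sup>2) / 2 \<le> Q / R\<^sup>2 + \<rho>' * Q / (2 * R\<^sup>2)"
        by (simp add: add_divide_distrib mult.commute)
      also have "\<rho>' * Q / (2 * R\<^sup>2) \<le> \<rho>' * Q / (2 * Q\<^sup>2)"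
        using R Q \<rho> n unfolding \<rho>'_def by (intro divide_left_mono mult_left_mono power_mono mult_nonneg_nonneg) auto
      also have "\<dots> = \<rho>' / (2 * Q)" using Q by (simp add: power2_eq_square)
      finally show ?thesis by simp
    qed
    ultimately show ?thesis by linarith
  qed
  have p4: "1 / n - 1 / n\<^sup>2 \<le> ln (n + 1) - ln n"
  proof -
    have "1 / n - (1 / n)\<^sup>2 / 2 - (1 / n) ^ 3 \<le> ln (1 + 1 / n)"
      using ln_add_one_ge_cubic[of "1 / n"] n by simp
    moreover have "(1 / n) ^ 3 \<le> (1 / n)\<^sup>2 / 2"
      using n by (simp add: power2_eq_square power3_eq_cube field_simps)
    moreover have "ln (1 + 1 / n) = ln (n + 1) - ln n"
      using n by (simp add: ln_divide_pos[symmetric] add_divide_distrib add.commute flip: ln_div)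
    ultimately show ?thesis by (simp add: power_divide)
  qed
  have "mean (\<lambda>v. log_profile (n + 1) (Q + D v))
      = mean (\<lambda>v. u + L v + (ln u + ln (1 + L v / u)) - (ln R + ln (1 + T v)) / 2 - ln (n + 1) / 2)"
    by (intro mean_cong) (simp only: log_profile_def lnQ)
  also have "\<dots> = u + mean L + (ln u + mean (\<lambda>v. ln (1 + L v / u)))
      - (ln R + mean (\<lambda>v. ln (1 + T v))) / 2 - ln (n + 1) / 2"
    by (simp only: mean_linear)
  finally have inc: "mean (\<lambda>v. log_profile (n + 1) (Q + D v)) - log_profile n Q
    = mean L + mean (\<lambda>v. ln (1 + L v / u)) - mean (\<lambda>v. ln (1 + T v)) / 2 - (ln (n + 1) - ln n) / 2"
    unfolding log_profile_def R_def u_def by (simp add: diff_divide_distrib add_divide_distrib)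
  define x where "x = \<rho> / Q / 2 + 27 / k ^ 3"
  have x: "0 \<le> x" using \<rho> Q k unfolding x_def by (intro add_nonneg_nonneg) auto
  have x_u: "(2 * a / n + \<rho> / (2 * Q) + 27 / k ^ 3) / u \<le> 1 / (u * n) + x"
  proof -
    have "2 * a / n / u \<le> 1 / n / u" using a n u by (intro divide_right_mono) auto
    moreover have "x / u \<le> x / 1" using x u by (intro divide_left_mono) auto
    moreover have "(2 * a / n + \<rho> / (2 * Q) + 27 / k ^ 3) / u = 2 * a / n / u + x / u"
      by (simp add: x_def add_divide_distrib)
    ultimately show ?thesis by (simp add: mult.commute)
  qed
  \<comment> \<open>Up to errors, the drift of \<open>ln R\<close> is exactly
    \<open>n / (8 R^2) + 1 / n - (1 - 2 a) Q / (n R)\<close>. Half of it is subtracted, and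
    \<open>Q \<le> R\<close> limits the damage of the last term to half of the deficit.\<close>
  have id: "2 * a / n - ((1 + 2 * a * Q / n + 1 / 8) / R - Q / R\<^sup>2) / 2 - 1 / (2 * n)
      \<le> - ((1 - 2 * a) / (2 * n)) - n / (16 * R\<^sup>2)"
  proof -
    have Rn: "n / 8 = R - Q" by (simp add: R_def)
    have 1: "1 / R - Q / R\<^sup>2 = n / (8 * R\<^sup>2)"
    proof -
      have "1 / R - Q / R\<^sup>2 = (R - Q) / R\<^sup>2" using R by (simp add: field_simps power2_eq_square)
      then show ?thesis unfolding Rn[symmetric] by simp
    qed
    have 2: "1 / 8 / R = 1 / n - Q / (n * R)"
      using R n by (simp add: field_simps) (simp add: R_def field_simps)
    have "(1 + 2 * a * Q / n + 1 / 8) / R - Q / R\<^sup>2 = (1 / R - Q / R\<^sup>2) + 2 * a * (Q / (n * R)) + 1 / 8 / R"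
      by (simp add: add_divide_distrib)
    also have "\<dots> = n / (8 * R\<^sup>2) + 1 / n - (1 - 2 * a) * (Q / (n * R))"
      unfolding 1 2 by (simp add: algebra_simps)
    finally have 3: "(1 + 2 * a * Q / n + 1 / 8) / R - Q / R\<^sup>2
      = n / (8 * R\<^sup>2) + 1 / n - (1 - 2 * a) * (Q / (n * R))" .
    have 4: "(1 - 2 * a) * (Q / (n * R)) \<le> (1 - 2 * a) * (1 / n)"
      using a R n Q by (intro mult_left_mono) (auto simp: field_simps)
    have 5: "(1 - 2 * a) * (1 / n) = 1 / n - 2 * a / n" "(1 - 2 * a) / (2 * n) = 1 / n / 2 - 2 * a / n / 2"
      by (simp_all add: left_diff_distrib diff_divide_distrib)
    have 6: "n / (16 * R\<^sup>2) = n / (8 * R\<^sup>2) / 2" "1 / (2 * n) = 1 / n / 2" by simp_all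
    have "A - (r + N - z) / 2 - N2 \<le> - y - R2"
      if "z \<le> w" "w = N - A" "y = N / 2 - A / 2" "R2 = r / 2" "N2 = N / 2"
      for A r N z N2 y R2 w :: real using that by (simp add: field_simps)
    from this[OF 4 5 6] show ?thesis unfolding 3 .
  qed
  \<comment> \<open>Here \<open>86 = 2 * 27 + 64 / 2\<close> collects the cubic remainders: twice
    that of \<open>ln Q\<close>, since it recurs inside \<open>ln (ln Q)\<close>, and half that of
    \<open>ln R\<close>.\<close>
  have e: "1 / (u * n) + 2 * x + \<rho>' / (4 * Q) + 32 / k ^ 3 + 1 / n\<^sup>2 / 2 - 1 / (16 * u\<^sup>2 * Q)
      \<le> (1 - 2 * a) / (8 * n)"
  proof -
    have 1: "1 / (u * n) + 1 / n\<^sup>2 \<le> (1 - 2 * a) / (16 * n)"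
      using divide_right_mono[OF slow, of n] n by (simp add: add_divide_distrib power2_eq_square)
    have "(2 * \<rho>' + 86 / k - 1 / (16 * u\<^sup>2)) / Q \<le> (1 - 2 * a) / (16 * n)"
      using err n Q by (simp add: field_simps)
    moreover have "(2 * \<rho>' + 86 / k - 1 / (16 * u\<^sup>2)) / Q = 2 * (\<rho>' / Q) + 86 / k ^ 3 - 1 / (16 * u\<^sup>2 * Q)"
      using k by (simp add: add_divide_distrib diff_divide_distrib Q_def power2_eq_square power3_eq_cube)
    ultimately have 2: "2 * (\<rho>' / Q) + 86 * (1 / k ^ 3) - 1 / (16 * u\<^sup>2 * Q) \<le> (1 - 2 * a) / (16 * n)"
      by simp
    have 3: "\<rho> / Q \<le> \<rho>' / Q" using Q n unfolding \<rho>'_def by (intro divide_right_mono) auto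
    have 4: "0 \<le> \<rho> / Q" "0 \<le> 1 / n\<^sup>2" using \<rho> Q by auto
    have 5: "2 * x = \<rho> / Q + 54 * (1 / k ^ 3)" "\<rho>' / (4 * Q) = \<rho>' / Q / 4" "32 / k ^ 3 = 32 * (1 / k ^ 3)"
      "(1 - 2 * a) / (8 * n) = (1 - 2 * a) / (16 * n) + (1 - 2 * a) / (16 * n)"
      by (simp_all add: x_def)
    have "A + X + P4 + K32 + N / 2 - U \<le> C"
      if "A + N \<le> C2" "2 * P + 86 * K - U \<le> C2" "r \<le> P" "0 \<le> r" "0 \<le> N"
        "X = r + 54 * K" "P4 = P / 4" "K32 = 32 * K" "C = C2 + C2"
      for A X P P4 K K32 N U C C2 r :: real using that by linarith
    from this[OF 1 2 3 4 5] show ?thesis .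
  qed
  have 1: "\<rho> / (2 * Q) + 27 / k ^ 3 = x" "\<rho>' / (2 * Q) / 2 = \<rho>' / (4 * Q)" "64 / k ^ 3 / 2 = 32 / k ^ 3"
    by (simp_all add: x_def)
  have 2: "1 / n / 2 = 1 / (2 * n)" "3 * (1 - 2 * a) / (8 * n) = (1 - 2 * a) / (2 * n) - (1 - 2 * a) / (8 * n)"
    using n by (simp_all add: field_simps)
  \<comment> \<open>Linear bookkeeping: the premises mirror, in this order, the estimates that are
    supplied to them below.\<close>
  have "I \<le> - C3 - R16"
    if "I = l + m - T / 2 - dl / 2" "l \<le> A + r + K" "m \<le> XU - U" "P - Qr - r2 - K64 \<le> T" "N - NN \<le> dl"
      "XU \<le> Y1 + x" "A - (P - Qr) / 2 - N2 \<le> - C - R16" "Y1 + 2 * x + r4 + K32 + NN / 2 - U \<le> C8"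
      "r + K = x" "r2 / 2 = r4" "K64 / 2 = K32" "N / 2 = N2" "C3 = C - C8"
    for I C C3 C8 R16 l m T dl A r K XU U P Qr r2 r4 K64 K32 N NN N2 Y1 x :: real
    using that by (simp add: field_simps)
  from this[OF inc p1 p2 p3 p4 x_u id e 1 2] show ?thesis .
qed

text \<open>After multiplication by \<open>n * ln (n + 1)\<close>, and with \<open>y\<close> as
  defined below, the growth of \<open>ln (ln n)\<close> costs at most 2, the decrease of the
  prefactor \<open>c / ln n\<close> costs at most \<open>c * (\<alpha> / 4 + y)\<close>, and the
  profile gains \<open>c * (3 * \<alpha> / 8 + y)\<close>. With \<open>c = 16 / \<alpha>\<close> the
  balance is \<open>2 + 4 - 6 = 0\<close>.\<close>

lemma recurrence_drift:
  fixes k n a \<rho> :: real and D :: "'a \<Rightarrow> real"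
  defines "Q \<equiv> k\<^sup>2"
  defines "\<rho>' \<equiv> \<rho> + 1 / Q + 1 / n" and "\<alpha> \<equiv> 1 - 2 * a"
  assumes a: "-1/2 \<le> a" "a < 1/2"
    and k: "100 \<le> k" "k \<le> n"
    and D: "\<And>v. v \<in> V \<Longrightarrow> \<bar>D v\<bar> \<le> 3 * k"
    and m1: "mean D = 1 + 2 * a * Q / n"
    and m2: "\<bar>mean (\<lambda>v. (D v)\<^sup>2) - 2 * Q\<bar> \<le> \<rho> * Q" and \<rho>: "0 \<le> \<rho>" "\<rho> \<le> 1"
    and slow: "1 / ln Q + 1 / n \<le> \<alpha> / 16" "8 / \<alpha> \<le> ln n"
    and err: "n * (2 * \<rho>' + 86 / k - 1 / (16 * (ln Q)\<^sup>2)) \<le> \<alpha> / 16 * Q"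
  shows "mean (\<lambda>v. log_potential (16 / \<alpha>) (n + 1) (Q + D v)) \<le> log_potential (16 / \<alpha>) n Q"
proof -
  define R where "R = n / 8 + Q"
  define s where "s = ln n"
  define s' where "s' = ln (n + 1)"
  define c where "c = 16 / \<alpha>"
  define y where "y = n\<^sup>2 / (16 * R\<^sup>2)"
  have n: "100 \<le> n" using k by linarith
  have "100\<^sup>2 \<le> k\<^sup>2" using k by (intro power_mono) auto
  then have Q: "10000 \<le> Q" by (simp add: Q_def)
  have al: "0 < \<alpha>" using a by (simp add: \<alpha>_def)
  have c: "0 < c" "c * \<alpha> = 16" using al by (auto simp: c_def)
  have "exp 1 \<le> n" using exp_le n by linarith
  then have s: "1 \<le> s" using n unfolding s_def by (subst ln_ge_iff) auto
  have R: "R > 0" using Q n by (auto simp: R_def)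
  have "s' - s = ln (1 + 1 / n)"
    using n unfolding s_def s'_def
    by (simp add: ln_divide_pos[symmetric] add_divide_distrib add.commute flip: ln_div)
  then have s's: "0 \<le> s' - s" "s' - s \<le> 1 / n"
    using n ln_add_one_self_le_self[of "1 / n"] by auto
  have "1 / n \<le> 1" using n by simp
  then have s'2: "s' \<le> 2 * s" "s \<le> s'" using s's s by linarith+
  define d where "d = mean (\<lambda>v. log_profile (n + 1) (Q + D v)) - log_profile n Q"
  have "d \<le> - (3 * \<alpha> / (8 * n)) - n / (16 * R\<^sup>2)"
    unfolding d_def R_def \<alpha>_def Q_def
    by (rule recurrence_mean_log_profile) (use a k D m1 m2 \<rho> slow err in \<open>auto simp: Q_def \<alpha>_def \<rho>'_def\<close>)
  then have "n * d \<le> n * (- (3 * \<alpha> / (8 * n)) - n / (16 * R\<^sup>2))" using n by (intro mult_left_mono) auto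
  also have "\<dots> = - (3 * \<alpha> / 8) - y"
    using n by (simp add: y_def right_diff_distrib power2_eq_square)
  finally have nd: "n * d \<le> - (3 * \<alpha> / 8) - y" .
  \<comment> \<open>This is the price of the decreasing prefactor. For \<open>n / 8 \<le> Q\<close>
    the profile is at least -2. For smaller Q it can be as low as \<open>- ln n\<close>, but then
    \<open>R \<le> n / 4\<close> makes \<open>y\<close> at least 1; the weight 1/8 in the profile is
    fitted to this.\<close>
  have X: "- log_profile n Q / s \<le> \<alpha> / 4 + y"
  proof (cases "n / 8 \<le> Q")
    case True
    have "ln R \<le> ln (2 * Q)" using True Q R by (intro ln_mono) (auto simp: R_def)
    also have "\<dots> = ln 2 + ln Q" using Q by (simp add: ln_mult)
    finally have 1: "ln R \<le> ln 2 + ln Q" .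
    have "ln n \<le> ln (8 * Q)" using True n Q by (intro ln_mono) auto
    also have "\<dots> = ln (2 ^ 3) + ln Q" using Q by (simp add: ln_mult)
    also have "ln (2 ^ 3 :: real) = 3 * ln 2" by (subst ln_realpow) auto
    finally have 2: "ln n \<le> 3 * ln 2 + ln Q" .
    have "exp 1 \<le> Q" using exp_le Q by linarith
    then have "1 \<le> ln Q" using Q by (subst ln_ge_iff) auto
    then have 3: "0 \<le> ln (ln Q)" by simp
    have "ln 2 \<le> (1::real)" using ln_add_one_self_le_self[of 1] by simp
    then have "- log_profile n Q \<le> 2" using 1 2 3 unfolding log_profile_def R_def[symmetric] by linarith
    then have "- log_profile n Q / s \<le> 2 / s" using s by (intro divide_right_mono) auto
    also have "\<dots> \<le> \<alpha> / 4" using slow(2) al s unfolding s_def[symmetric] by (simp add: field_simps)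
    also have "\<dots> \<le> \<alpha> / 4 + y" by (simp add: y_def)
    finally show ?thesis .
  next
    case False
    have "ln R \<le> ln n" using False n R by (intro ln_mono) (auto simp: R_def)
    moreover have "exp 1 \<le> Q" using exp_le Q by linarith
    then have l: "1 \<le> ln Q" using Q by (subst ln_ge_iff) auto
    then have "0 \<le> ln (ln Q)" by simp
    ultimately have "- log_profile n Q \<le> s" using l unfolding log_profile_def R_def[symmetric] s_def by linarith
    then have "- log_profile n Q / s \<le> 1" using s by (simp add: field_simps)
    also have "1 \<le> y"
    proof -
      have "R\<^sup>2 \<le> (n / 4)\<^sup>2" using False R by (intro power_mono) (auto simp: R_def)
      then show ?thesis using R by (simp add: y_def power_divide field_simps)
    qed
    finally show ?thesis using al by simp
  qed
  have lnln: "ln s' - ln s \<le> (s' - s) / s"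
  proof -
    have "ln s' - ln s = ln (s' / s)" using s s'2 by (simp add: ln_div)
    also have "\<dots> \<le> s' / s - 1" using s s'2 by (intro ln_le_minus_one) auto
    finally show ?thesis using s by (simp add: diff_divide_distrib)
  qed
  have "mean (\<lambda>v. log_potential c (n + 1) (Q + D v)) = ln s' + c / s' * (log_profile n Q + d) + c"
    unfolding log_potential_def s'_def d_def by (simp only: mean_linear) simp
  moreover have "log_potential c n Q = ln s + c / s * log_profile n Q + c" by (simp add: log_potential_def s_def)
  moreover have "ln s' - ln s + c / s' * (log_profile n Q + d) - c / s * log_profile n Q \<le> 0"
  proof -
    have "ln s' - ln s + c / s' * (log_profile n Q + d) - c / s * log_profile n Q
        \<le> (s' - s) / s + (c / s') * d + (c / s') * (- log_profile n Q / s) * (s' - s)"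
    proof -
      have "c / s' * log_profile n Q - c / s * log_profile n Q = (c / s') * (- log_profile n Q / s) * (s' - s)"
        using s s'2 by (simp add: field_simps)
      then show ?thesis using lnln unfolding distrib_left by linarith
    qed
    also have "(s' - s) / s \<le> (1 / n) / s" using s's s by (intro divide_right_mono) auto
    also have "(1 / n) / s \<le> (1 / n) * (2 / s')" using s s'2 n by (simp add: field_simps)
    also have "(c / s') * (- log_profile n Q / s) * (s' - s) \<le> (c / s') * (\<alpha> / 4 + y) * (s' - s)"
      using X c s s'2 s's by (intro mult_right_mono mult_left_mono) auto
    also have "\<dots> \<le> (c / s') * (\<alpha> / 4 + y) * (1 / n)"
      using s's c s s'2 al by (intro mult_left_mono mult_nonneg_nonneg) (auto simp: y_def)
    also have "(1 / n) * (2 / s') + (c / s') * d + (c / s') * (\<alpha> / 4 + y) * (1 / n)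
        = (2 + c * (n * d) + c * (\<alpha> / 4 + y)) / (n * s')"
      using n s s'2 by (simp add: field_simps)
    also have "\<dots> \<le> 0"
    proof (rule divide_nonpos_pos)
      have "c * (n * d) \<le> c * (- (3 * \<alpha> / 8) - y)" using nd c by (intro mult_left_mono) auto
      also have "\<dots> = - 6 - c * y" using c by (simp add: algebra_simps)
      finally have "c * (n * d) \<le> - 6 - c * y" .
      moreover have "c * (\<alpha> / 4 + y) = 4 + c * y" using c by (simp add: algebra_simps)
      ultimately show "2 + c * (n * d) + c * (\<alpha> / 4 + y) \<le> 0" by linarith
    qed (use n s s'2 in auto)
    finally show ?thesis by simp
  qed
  ultimately show ?thesis unfolding c_def by linarith
qed

end

section \<open>History-dependent processes with finitely many steps\<close>

text \<open>\<open>q l\<close> is the conditional law of the next step given the whole history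
  \<open>l\<close>. The product form of \<open>law\<close> includes histories of probability 0,
  where conditioning means nothing; in return \<open>q l\<close> is a probability vector for every
  nonempty history in \<open>V\<close>.\<close>

locale step_process = prob_space M
  for M :: "'w measure" +
  fixes V :: "'a::countable set"
    and q :: "'a list \<Rightarrow> 'a \<Rightarrow> real"
    and \<sigma> :: "nat \<Rightarrow> 'w \<Rightarrow> 'a"
  assumes finite_V: "finite V"
    and step_measurable: "n \<ge> 1 \<Longrightarrow> \<sigma> n \<in> measurable M (count_space UNIV)"
    and first_in_V: "AE \<omega> in M. \<sigma> 1 \<omega> \<in> V"
    and q_nonneg: "\<lbrakk>l \<noteq> []; set l \<subseteq> V; v \<in> V\<rbrakk> \<Longrightarrow> 0 \<le> q l v"
    and q_sum: "\<lbrakk>l \<noteq> []; set l \<subseteq> V\<rbrakk> \<Longrightarrow> (\<Sum>v\<in>V. q l v) = 1"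
    and law: "\<lbrakk>n \<ge> 1; length l = n; set l \<subseteq> V; v \<in> V\<rbrakk> \<Longrightarrow>
      \<P>(\<omega> in M. map (\<lambda>i. \<sigma> i \<omega>) [1..<n + 1] = l \<and> \<sigma> (n + 1) \<omega> = v)
      = \<P>(\<omega> in M. map (\<lambda>i. \<sigma> i \<omega>) [1..<n + 1] = l) * q l v"
begin

definition X :: "nat \<Rightarrow> 'w \<Rightarrow> 'a list" where
  "X n \<omega> = map (\<lambda>i. \<sigma> i \<omega>) [1..<n + 1]"

definition paths :: "nat \<Rightarrow> 'a list set" where
  "paths n = {l. length l = n \<and> set l \<subseteq> V}"

definition weight :: "nat \<Rightarrow> 'a list \<Rightarrow> real" where
  "weight n l = \<P>(\<omega> in M. X n \<omega> = l)"

definition next_mean :: "('a list \<Rightarrow> real) \<Rightarrow> 'a list \<Rightarrow> real" where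
  "next_mean F l = (\<Sum>v\<in>V. q l v * F (l @ [v]))"

lemma length_X [simp]: "length (X n \<omega>) = n"
  by (simp add: X_def)

lemma X_Suc: "X (Suc n) \<omega> = X n \<omega> @ [\<sigma> (Suc n) \<omega>]"
  by (simp add: X_def)

lemma take_X: "j \<le> n \<Longrightarrow> take j (X n \<omega>) = X j \<omega>"
  by (simp add: X_def take_map take_upt del: upt_Suc)

lemma finite_paths: "finite (paths n)"
  unfolding paths_def using finite_lists_length_eq[OF finite_V, of n] by (simp add: conj_commute)

lemma paths_snoc: "l \<in> paths n \<Longrightarrow> v \<in> V \<Longrightarrow> l @ [v] \<in> paths (Suc n)"
  by (auto simp: paths_def)

lemma paths_Suc: "paths (Suc n) = (\<lambda>(l, v). l @ [v]) ` (paths n \<times> V)"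
proof
  show "paths (Suc n) \<subseteq> (\<lambda>(l, v). l @ [v]) ` (paths n \<times> V)"
  proof
    fix l assume l: "l \<in> paths (Suc n)"
    then obtain l' v where "l = l' @ [v]"
      by (cases l rule: rev_cases) (auto simp: paths_def)
    with l show "l \<in> (\<lambda>(l, v). l @ [v]) ` (paths n \<times> V)"
      by (intro image_eqI[of _ _ "(l', v)"]) (auto simp: paths_def)
  qed
qed (auto simp: paths_snoc)

lemma inj_snoc: "inj_on (\<lambda>(l, v). l @ [v]) A"
  by (auto simp: inj_on_def)

lemma X_measurable [measurable]: "X n \<in> measurable M (count_space UNIV)"
proof (induction n)
  case 0
  have "X 0 = (\<lambda>_. [])" by (auto simp: X_def)
  then show ?case by simp
next
  case (Suc n)
  have [measurable]: "X n \<in> measurable M (count_space UNIV)" by fact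
  have [measurable]: "\<sigma> (Suc n) \<in> measurable M (count_space UNIV)"
    by (rule step_measurable) simp
  have "X (Suc n) = (\<lambda>\<omega>. X n \<omega> @ [\<sigma> (Suc n) \<omega>])" by (auto simp: X_Suc)
  then show ?case by simp
qed

lemma weight_nonneg: "0 \<le> weight n l"
  by (simp add: weight_def)

lemma weight_snoc:
  assumes "n \<ge> 1" "l \<in> paths n" "v \<in> V"
  shows "weight (Suc n) (l @ [v]) = weight n l * q l v"
proof -
  have "weight (Suc n) (l @ [v]) = \<P>(\<omega> in M. X n \<omega> = l \<and> \<sigma> (n + 1) \<omega> = v)"
    unfolding weight_def by (simp add: X_Suc)
  also have "\<dots> = weight n l * q l v"
    using law[of n l v] assms unfolding weight_def X_def paths_def by auto
  finally show ?thesis .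
qed

text \<open>The tower property in elementary form: weighted sums over paths take the place of
  conditional expectations.\<close>

lemma weight_sum_Suc:
  assumes "n \<ge> 1"
  shows "(\<Sum>l\<in>paths (Suc n). weight (Suc n) l * F l) = (\<Sum>l\<in>paths n. weight n l * next_mean F l)"
proof -
  have "(\<Sum>l\<in>paths (Suc n). weight (Suc n) l * F l)
      = (\<Sum>(l,v)\<in>paths n \<times> V. weight (Suc n) (l @ [v]) * F (l @ [v]))"
    unfolding paths_Suc by (subst sum.reindex[OF inj_snoc]) (simp add: case_prod_unfold comp_def)
  also have "\<dots> = (\<Sum>(l,v)\<in>paths n \<times> V. weight n l * (q l v * F (l @ [v])))"
    using weight_snoc[OF assms] by (intro sum.cong refl) auto
  also have "\<dots> = (\<Sum>l\<in>paths n. weight n l * next_mean F l)"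
    by (simp add: sum.cartesian_product[symmetric] next_mean_def sum_distrib_left)
  finally show ?thesis .
qed

lemma prob_X_finite: "finite A \<Longrightarrow> \<P>(\<omega> in M. X n \<omega> \<in> A) = (\<Sum>l\<in>A. weight n l)"
  unfolding weight_def by (rule prob_sum) auto

lemma weight_total: "n \<ge> 1 \<Longrightarrow> (\<Sum>l\<in>paths n. weight n l) = 1"
proof (induction n rule: nat_induct_at_least)
  case base
  have "(\<Sum>l\<in>paths 1. weight 1 l) = \<P>(\<omega> in M. X 1 \<omega> \<in> paths 1)"
    by (simp add: prob_X_finite finite_paths)
  also have "\<dots> = 1"
  proof (subst prob_Collect_eq_1)
    show "AE \<omega> in M. X 1 \<omega> \<in> paths 1"
      using first_in_V by (auto simp: paths_def X_def)
  qed auto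
  finally show ?case .
next
  case (Suc n)
  have "(\<Sum>l\<in>paths (Suc n). weight (Suc n) l * 1) = (\<Sum>l\<in>paths n. weight n l * next_mean (\<lambda>_. 1) l)"
    using Suc by (intro weight_sum_Suc) auto
  also have "\<dots> = (\<Sum>l\<in>paths n. weight n l)"
  proof (intro sum.cong refl)
    fix l assume "l \<in> paths n"
    then have "l \<noteq> []" "set l \<subseteq> V" using Suc.hyps by (auto simp: paths_def)
    then show "weight n l * next_mean (\<lambda>_. 1) l = weight n l"
      by (simp add: next_mean_def q_sum)
  qed
  finally show ?case using Suc by simp
qed

lemma AE_X_paths: "n \<ge> 1 \<Longrightarrow> AE \<omega> in M. X n \<omega> \<in> paths n"
  using weight_total[of n] prob_X_finite[OF finite_paths, of n n]
  by (subst prob_Collect_eq_1[symmetric]) auto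

lemma prob_X_eq_sum:
  assumes "n \<ge> 1"
  shows "\<P>(\<omega> in M. X n \<omega> \<in> A) = (\<Sum>l\<in>paths n \<inter> A. weight n l)"
proof -
  have "\<P>(\<omega> in M. X n \<omega> \<in> A) = \<P>(\<omega> in M. X n \<omega> \<in> paths n \<inter> A)"
    using AE_X_paths[OF assms] by (intro prob_eq_AE) auto
  also have "\<dots> = (\<Sum>l\<in>paths n \<inter> A. weight n l)"
    by (intro prob_X_finite) (simp add: finite_paths)
  finally show ?thesis .
qed

text \<open>Doob's maximal inequality for the process run until its history leaves \<open>G\<close>,
  by splitting off the first step. That changes the starting time and the set of starting paths, so
  the induction generalises \<open>m\<close> and \<open>I\<close>. Nonnegativity is demanded where
  the stopped process can arrive: on \<open>I\<close> at time \<open>m\<close>, and one step after a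
  history in \<open>G\<close>.\<close>

lemma maximal_inequality_bounded:
  assumes "m \<ge> 1" "c > 0"
    and "\<And>l. l \<in> I \<Longrightarrow> l \<in> paths m \<Longrightarrow> F l \<ge> 0"
    and nonneg: "\<And>l v. \<lbrakk>m \<le> length l; set l \<subseteq> V; v \<in> V; G l\<rbrakk> \<Longrightarrow> F (l @ [v]) \<ge> 0"
    and drift: "\<And>l. \<lbrakk>m \<le> length l; set l \<subseteq> V; G l\<rbrakk> \<Longrightarrow> next_mean F l \<le> F l"
  shows "\<P>(\<omega> in M. X m \<omega> \<in> I \<and> (\<exists>n\<in>{m..m + k}. (\<forall>j\<in>{m..<n}. G (X j \<omega>)) \<and> F (X n \<omega>) \<ge> c))
    \<le> (\<Sum>l\<in>paths m \<inter> I. weight m l * F l) / c"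
  using assms
proof (induction k arbitrary: m I)
  case 0
  have "\<P>(\<omega> in M. X m \<omega> \<in> I \<and> F (X m \<omega>) \<ge> c) = (\<Sum>l\<in>paths m \<inter> (I \<inter> {l. F l \<ge> c}). weight m l)"
    using prob_X_eq_sum[OF \<open>m \<ge> 1\<close>, of "I \<inter> {l. F l \<ge> c}"] by simp
  also have "\<dots> \<le> (\<Sum>l\<in>paths m \<inter> (I \<inter> {l. F l \<ge> c}). weight m l * F l / c)"
    using \<open>c > 0\<close> by (intro sum_mono) (auto simp: pos_le_divide_eq intro!: mult_left_mono weight_nonneg)
  also have "\<dots> \<le> (\<Sum>l\<in>paths m \<inter> I. weight m l * F l / c)"
    using 0 by (intro sum_mono2) (auto simp: finite_paths weight_nonneg)
  finally show ?case by (simp add: sum_divide_distrib)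
next
  case (Suc k)
  \<comment> \<open>\<open>J\<close> has already reached the level and is settled by Markov's
    inequality. \<open>K\<close> is below the level and may continue; \<open>I'\<close> consists of
    its one-step extensions, and the drift condition turns their weighted sum back into one over
    \<open>K\<close>.\<close>
  define J where "J = I \<inter> {l. F l \<ge> c}"
  define K where "K = I \<inter> {l. F l < c \<and> G l}"
  define I' where "I' = (\<lambda>(l, v). l @ [v]) ` (K \<times> UNIV)"
  let ?E = "\<lambda>m k I \<omega>. X m \<omega> \<in> I \<and> (\<exists>n\<in>{m..m + k}. (\<forall>j\<in>{m..<n}. G (X j \<omega>)) \<and> F (X n \<omega>) \<ge> c)"
  have X_I': "X (Suc m) \<omega> \<in> I' \<longleftrightarrow> X m \<omega> \<in> K" for \<omega>
    by (auto simp: I'_def X_Suc)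
  have sub: "?E m (Suc k) I \<omega> \<Longrightarrow> X m \<omega> \<in> J \<or> ?E (Suc m) k I' \<omega>" for \<omega>
  proof (cases "F (X m \<omega>) \<ge> c")
    case False
    assume "?E m (Suc k) I \<omega>"
    then obtain n where n: "X m \<omega> \<in> I" "n \<in> {m..m + Suc k}" "\<forall>j\<in>{m..<n}. G (X j \<omega>)" "F (X n \<omega>) \<ge> c"
      by blast
    with False have "n \<noteq> m" by auto
    with n have *: "n \<in> {Suc m..Suc m + k}" "G (X m \<omega>)" by auto
    moreover have "\<forall>j\<in>{Suc m..<n}. G (X j \<omega>)" using n by auto
    ultimately have "?E (Suc m) k I' \<omega>"
      using n False unfolding X_I' K_def by (auto intro!: bexI[of _ n])
    then show ?thesis ..
  qed (auto simp: J_def)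
  have "\<P>(\<omega> in M. ?E m (Suc k) I \<omega>)
      \<le> measure M ({\<omega>\<in>space M. X m \<omega> \<in> J} \<union> {\<omega>\<in>space M. ?E (Suc m) k I' \<omega>})"
    using sub by (intro finite_measure_mono) auto
  also have "\<dots> \<le> \<P>(\<omega> in M. X m \<omega> \<in> J) + \<P>(\<omega> in M. ?E (Suc m) k I' \<omega>)"
    by (intro measure_Un_le) auto
  also have "\<P>(\<omega> in M. X m \<omega> \<in> J) \<le> (\<Sum>l\<in>paths m \<inter> J. weight m l * F l / c)"
    unfolding prob_X_eq_sum[OF \<open>m \<ge> 1\<close>] using \<open>c > 0\<close>
    by (intro sum_mono) (auto simp: pos_le_divide_eq J_def intro!: mult_left_mono weight_nonneg)
  also have "\<P>(\<omega> in M. ?E (Suc m) k I' \<omega>) \<le> (\<Sum>l\<in>paths (Suc m) \<inter> I'. weight (Suc m) l * F l) / c"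
  proof (rule Suc.IH)
    fix l assume "l \<in> I'" "l \<in> paths (Suc m)"
    then obtain l' v where "l = l' @ [v]" "l' \<in> paths m" "v \<in> V" "l' \<in> K"
      unfolding I'_def paths_def by auto
    then show "F l \<ge> 0" using Suc.prems(4)[of l' v] unfolding K_def paths_def by auto
  qed (use Suc.prems in auto)
  also have "(\<Sum>l\<in>paths (Suc m) \<inter> I'. weight (Suc m) l * F l)
      = (\<Sum>l\<in>paths (Suc m). weight (Suc m) l * (if l \<in> I' then F l else 0))"
    by (subst sum.inter_restrict[OF finite_paths]) (auto intro: sum.cong)
  also have "\<dots> = (\<Sum>l\<in>paths m. weight m l * next_mean (\<lambda>l. if l \<in> I' then F l else 0) l)"
    using Suc.prems by (intro weight_sum_Suc) auto
  also have "\<dots> \<le> (\<Sum>l\<in>paths m. weight m l * (if l \<in> K then F l else 0))"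
  proof (intro sum_mono mult_left_mono weight_nonneg)
    fix l assume l: "l \<in> paths m"
    have *: "l @ [v] \<in> I' \<longleftrightarrow> l \<in> K" for v by (auto simp: I'_def)
    show "next_mean (\<lambda>l. if l \<in> I' then F l else 0) l \<le> (if l \<in> K then F l else 0)"
      using Suc.prems(5)[of l] l unfolding next_mean_def * by (auto simp: K_def paths_def)
  qed
  also have "\<dots> = (\<Sum>l\<in>paths m \<inter> K. weight m l * F l)"
    by (subst sum.inter_restrict[OF finite_paths]) (auto intro: sum.cong)
  finally have "\<P>(\<omega> in M. ?E m (Suc k) I \<omega>)
      \<le> (\<Sum>l\<in>paths m \<inter> J. weight m l * F l / c) + (\<Sum>l\<in>paths m \<inter> K. weight m l * F l) / c"
    using \<open>c > 0\<close> by (simp add: divide_right_mono)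
  also have "\<dots> = (\<Sum>l\<in>(paths m \<inter> J) \<union> (paths m \<inter> K). weight m l * F l / c)"
    unfolding sum_divide_distrib
    by (rule sum.union_disjoint[symmetric]) (auto simp: finite_paths J_def K_def)
  also have "\<dots> \<le> (\<Sum>l\<in>paths m \<inter> I. weight m l * F l / c)"
    using Suc.prems by (intro sum_mono2) (auto simp: finite_paths J_def K_def weight_nonneg)
  finally show ?case by (simp add: sum_divide_distrib)
qed

lemma maximal_inequality:
  assumes "m \<ge> 1" "c > 0"
    and "\<And>l. l \<in> I \<Longrightarrow> l \<in> paths m \<Longrightarrow> F l \<ge> 0"
    and "\<And>l v. \<lbrakk>m \<le> length l; set l \<subseteq> V; v \<in> V; G l\<rbrakk> \<Longrightarrow> F (l @ [v]) \<ge> 0"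
    and "\<And>l. \<lbrakk>m \<le> length l; set l \<subseteq> V; G l\<rbrakk> \<Longrightarrow> next_mean F l \<le> F l"
  shows "\<P>(\<omega> in M. X m \<omega> \<in> I \<and> (\<exists>n\<ge>m. (\<forall>j\<in>{m..<n}. G (X j \<omega>)) \<and> F (X n \<omega>) \<ge> c))
    \<le> (\<Sum>l\<in>paths m \<inter> I. weight m l * F l) / c"
proof -
  define E where "E k = {\<omega>\<in>space M. X m \<omega> \<in> I \<and>
    (\<exists>n\<in>{m..m + k}. (\<forall>j\<in>{m..<n}. G (X j \<omega>)) \<and> F (X n \<omega>) \<ge> c)}" for k
  have E_sets: "range E \<subseteq> events" unfolding E_def by auto
  have E_inc: "incseq E"
  proof (rule incseq_SucI)
    fix k
    have "{m..m + k} \<subseteq> {m..m + Suc k}" by auto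
    then show "E k \<le> E (Suc k)"
      unfolding E_def by blast
  qed
  have "(\<lambda>k. measure M (E k)) \<longlonglongrightarrow> measure M (\<Union>k. E k)"
    by (rule finite_Lim_measure_incseq[OF E_sets E_inc])
  moreover have "measure M (E k) \<le> (\<Sum>l\<in>paths m \<inter> I. weight m l * F l) / c" for k
    unfolding E_def by (rule maximal_inequality_bounded) (use assms in auto)
  ultimately have "measure M (\<Union>k. E k) \<le> (\<Sum>l\<in>paths m \<inter> I. weight m l * F l) / c"
    by (blast intro: LIMSEQ_le_const2)
  also have "(\<Union>k. E k) = {\<omega>\<in>space M. X m \<omega> \<in> I \<and> (\<exists>n\<ge>m. (\<forall>j\<in>{m..<n}. G (X j \<omega>)) \<and> F (X n \<omega>) \<ge> c)}"
  proof (intro equalityI subsetI)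
    fix \<omega> assume "\<omega> \<in> {\<omega>\<in>space M. X m \<omega> \<in> I \<and> (\<exists>n\<ge>m. (\<forall>j\<in>{m..<n}. G (X j \<omega>)) \<and> F (X n \<omega>) \<ge> c)}"
    then obtain n where "n \<ge> m" "\<omega> \<in> space M" "X m \<omega> \<in> I" "\<forall>j\<in>{m..<n}. G (X j \<omega>)" "F (X n \<omega>) \<ge> c"
      by blast
    then have "\<omega> \<in> E (n - m)" unfolding E_def by (auto intro!: bexI[of _ n])
    then show "\<omega> \<in> (\<Union>k. E k)" by blast
  qed (auto simp: E_def)
  finally show ?thesis .
qed

end

section \<open>The law of the elephant random walk\<close>

lemma measurable_map_upt:
  fixes f :: "nat \<Rightarrow> 'w \<Rightarrow> 'a::countable"
  assumes f: "\<And>i. i \<ge> 1 \<Longrightarrow> f i \<in> measurable M (count_space UNIV)"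
  shows "(\<lambda>\<omega>. map (\<lambda>i. f i \<omega>) [1..<n + 1]) \<in> measurable M (count_space UNIV)"
proof (induction n)
  case (Suc n)
  have [measurable]: "(\<lambda>\<omega>. map (\<lambda>i. f i \<omega>) [1..<n + 1]) \<in> measurable M (count_space UNIV)"
    "f (Suc n) \<in> measurable M (count_space UNIV)"
    using Suc f by auto
  have "(\<lambda>\<omega>. map (\<lambda>i. f i \<omega>) [1..<n + 1] @ [f (Suc n) \<omega>]) \<in> measurable M (count_space UNIV)"
    by measurable
  then show ?case by simp
qed simp

context elephant_random_walk
begin

lemma recall_prob:
  assumes "n \<ge> 1" "k \<in> {1..n}"
  shows "\<P>(\<omega> in M. N n \<omega> = k) = 1 / n"
proof -
  have [measurable]: "N n \<in> measurable M (count_space UNIV)" by (rule measurable_recall[OF assms(1)])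
  have "\<P>(\<omega> in M. N n \<omega> = k) = measure (distr M (count_space UNIV) (N n)) {k}"
    by (subst measure_distr) (auto simp: vimage_def Int_def conj_commute)
  also have "\<dots> = 1 / n"
    unfolding recall_uniform[OF assms(1)] using assms by (simp add: measure_pmf_single pmf_of_set)
  finally show ?thesis .
qed

lemma AE_recall_range:
  assumes "n \<ge> 1"
  shows "AE \<omega> in M. N n \<omega> \<in> {1..n}"
proof -
  have "AE k in distr M (count_space UNIV) (N n). k \<in> {1..n}"
    unfolding recall_uniform[OF assms] using assms by (auto simp: AE_measure_pmf_iff set_pmf_of_set)
  then show ?thesis
    using measurable_recall[OF assms] by (subst (asm) AE_distr_iff) auto
qed

text \<open>The event is split by the recalled times of the past and the recall at time
  \<open>n\<close>. By independence the past together with \<open>N n = k\<close> has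
  \<open>1 / n\<close> times the probability of the past, and this recall contributes a factor
  \<open>p\<close> or \<open>r\<close>. The factor depends only on \<open>l\<close> and
  \<open>k\<close>, so the earlier recalls sum out.\<close>

lemma step_law:
  assumes n: "n \<ge> 1" and l: "length l = n" and v: "v \<in> steps"
  defines "r \<equiv> (1 - p) / (2 * real CARD('d) - 1)"
  shows "\<P>(\<omega> in M. map (\<lambda>i. \<sigma> i \<omega>) [1..<n + 1] = l \<and> \<sigma> (n + 1) \<omega> = v)
    = \<P>(\<omega> in M. map (\<lambda>i. \<sigma> i \<omega>) [1..<n + 1] = l) * ((\<Sum>k<n. if l ! k = v then p else r) / n)"
proof -
  define A where "A \<omega> = map (\<lambda>i. \<sigma> i \<omega>) [1..<n + 1]" for \<omega>
  define C where "C \<omega> = map (\<lambda>j. N j \<omega>) [1..<n]" for \<omega>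
  define Z where "Z = \<sigma> (n + 1)"
  \<comment> \<open>Almost surely all recalled times lie in \<open>{1..n}\<close>, which makes the
    split finite.\<close>
  define MS where "MS = {ms. set ms \<subseteq> {1..n} \<and> length ms = n - 1}"
  have MS: "finite MS" unfolding MS_def by (rule finite_lists_length_eq) simp
  have X [measurable]: "A \<in> measurable M (count_space UNIV)"
    unfolding A_def by (rule measurable_map_upt) (rule measurable_step)
  have Y [measurable]: "C \<in> measurable M (count_space UNIV)"
    using measurable_map_upt[of N M "n - 1"] measurable_recall n unfolding C_def by simp
  have \<sigma> [measurable]: "Z \<in> measurable M (count_space UNIV)" unfolding Z_def by (rule measurable_step) simp
  have Nn [measurable]: "N n \<in> measurable M (count_space UNIV)" by (rule measurable_recall[OF n])
  have past_eq: "past N \<sigma> n \<omega> = (l, ms) \<longleftrightarrow>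
      A \<omega> = l \<and> C \<omega> = ms" for \<omega> ms
    by (auto simp: past_def A_def C_def)
  have "AE \<omega> in M. \<forall>j\<in>{1..n}. N j \<omega> \<in> {1..j}"
    by (intro AE_finite_allI AE_recall_range) auto
  then have range: "AE \<omega> in M. C \<omega> \<in> MS \<and> N n \<omega> \<in> {1..n}"
  proof (rule AE_mp, intro AE_I2 impI)
    fix \<omega> assume "\<forall>j\<in>{1..n}. N j \<omega> \<in> {1..j}"
    then have a: "N j \<omega> \<in> {1..n}" if "j \<in> {1..n}" for j
      using that by (meson atLeastAtMost_iff order_trans)
    have "set (C \<omega>) \<subseteq> {1..n}"
    proof
      fix x assume "x \<in> set (C \<omega>)"
      then obtain j where "j \<in> set [1..<n]" "x = N j \<omega>" by (auto simp: C_def)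
      then show "x \<in> {1..n}" using a[of j] by simp
    qed
    moreover have "N n \<omega> \<in> {1..n}" using a[of n] n by simp
    ultimately show "C \<omega> \<in> MS \<and> N n \<omega> \<in> {1..n}"
      by (simp add: MS_def C_def)
  qed
  have joint: "\<P>(\<omega> in M. past N \<sigma> n \<omega> = (l, ms) \<and> N n \<omega> = k \<and> Z \<omega> = v)
      = \<P>(\<omega> in M. past N \<sigma> n \<omega> = (l, ms)) * ((if l ! (k - 1) = v then p else r) / n)"
    if k: "k \<in> {1..n}" and ms: "ms \<in> MS" for k ms
  proof -
    \<comment> \<open>Steps and recalls are numbered from 1, list positions from 0.\<close>
    define s where "s i = l ! (i - 1)" for i
    define m where "m j = ms ! (j - 1)" for j
    have s: "map s [1..<n + 1] = l"
      using l by (intro nth_equalityI) (auto simp: s_def nth_append simp del: upt_Suc)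
    have m: "map m [1..<n] = ms"
      using ms by (intro nth_equalityI) (auto simp: m_def MS_def)
    let ?B = "\<lambda>\<omega>. past N \<sigma> n \<omega> = (l, ms) \<and> N n \<omega> = k"
    have "N n -` {k} \<inter> space M \<in> sets (vimage_algebra (space M) (N n) (count_space UNIV))"
      "past N \<sigma> n -` {(l, ms)} \<inter> space M \<in> sets (vimage_algebra (space M) (past N \<sigma> n) (count_space UNIV))"
      by (auto intro: in_vimage_algebra)
    from indep_setD[OF recall_indep[OF n] this]
    have "\<P>(\<omega> in M. ?B \<omega>) = \<P>(\<omega> in M. N n \<omega> = k) * \<P>(\<omega> in M. past N \<sigma> n \<omega> = (l, ms))"
      by (simp add: vimage_def Int_def conj_ac)
    then have B: "\<P>(\<omega> in M. ?B \<omega>) = \<P>(\<omega> in M. past N \<sigma> n \<omega> = (l, ms)) / n"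
      by (simp add: recall_prob[OF n k])
    have "\<P>(\<omega> in M. past N \<sigma> n \<omega> = (l, ms) \<and> N n \<omega> = k \<and> Z \<omega> = v)
        = \<P>(\<omega> in M. ?B \<omega>) * (if v = s k then p else r)"
    \<comment> \<open>On a null event \<open>next_step\<close> is silent, but then both sides
      vanish.\<close>
    proof (cases "\<P>(\<omega> in M. ?B \<omega>) = 0")
      case True
      have "\<P>(\<omega> in M. past N \<sigma> n \<omega> = (l, ms) \<and> N n \<omega> = k \<and> Z \<omega> = v) \<le> \<P>(\<omega> in M. ?B \<omega>)"
        unfolding past_eq by (intro finite_measure_mono) auto
      then show ?thesis unfolding True mult_zero_left by (simp only: measure_le_0_iff)
    next
      case False
      then have "\<P>(\<omega> in M. ?B \<omega>) > 0" by (simp add: zero_less_measure_iff)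
      then have "\<P>(\<omega> in M. Z \<omega> = v \<bar> ?B \<omega>) = (if v = s k then p else r)"
        using next_step[OF n k v, of s m] unfolding s m r_def Z_def by simp
      then have "\<P>(\<omega> in M. Z \<omega> = v \<and> ?B \<omega>) = \<P>(\<omega> in M. ?B \<omega>) * (if v = s k then p else r)"
        using False unfolding cond_prob_def by (simp add: field_simps)
      then show ?thesis by (simp add: conj_ac)
    qed
    then show ?thesis unfolding B by (simp add: s_def eq_commute)
  qed
  have "\<P>(\<omega> in M. A \<omega> = l \<and> Z \<omega> = v)
      = (\<Sum>(k, ms)\<in>{1..n} \<times> MS. \<P>(\<omega> in M. past N \<sigma> n \<omega> = (l, ms) \<and> N n \<omega> = k \<and> Z \<omega> = v))"
    unfolding case_prod_unfold
  proof (rule prob_sum)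
    show "AE \<omega> in M. (\<forall>x\<in>{1..n} \<times> MS. past N \<sigma> n \<omega> = (l, snd x) \<and> N n \<omega> = fst x \<and> Z \<omega> = v \<longrightarrow>
            A \<omega> = l \<and> Z \<omega> = v) \<and>
          (A \<omega> = l \<and> Z \<omega> = v \<longrightarrow>
            (\<exists>!x. x \<in> {1..n} \<times> MS \<and> past N \<sigma> n \<omega> = (l, snd x) \<and> N n \<omega> = fst x \<and> Z \<omega> = v))"
      using range
    proof (rule AE_mp, intro AE_I2 impI conjI ballI)
      fix \<omega> assume r: "C \<omega> \<in> MS \<and> N n \<omega> \<in> {1..n}"
        and "A \<omega> = l \<and> Z \<omega> = v"
      then show "\<exists>!x. x \<in> {1..n} \<times> MS \<and> past N \<sigma> n \<omega> = (l, snd x) \<and> N n \<omega> = fst x \<and> Z \<omega> = v"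
        unfolding past_eq by (intro ex1I[of _ "(N n \<omega>, C \<omega>)"]) auto
    qed (auto simp: past_eq)
  qed (use MS in \<open>auto simp: past_eq\<close>)
  also have "\<dots> = (\<Sum>k\<in>{1..n}. \<Sum>ms\<in>MS. \<P>(\<omega> in M. past N \<sigma> n \<omega> = (l, ms)) * ((if l ! (k - 1) = v then p else r) / n))"
    unfolding sum.cartesian_product[symmetric] by (intro sum.cong refl joint)
  also have "\<dots> = (\<Sum>ms\<in>MS. \<P>(\<omega> in M. past N \<sigma> n \<omega> = (l, ms))) * (\<Sum>k\<in>{1..n}. (if l ! (k - 1) = v then p else r) / n)"
    by (subst sum.swap) (simp only: sum_product)
  also have "(\<Sum>ms\<in>MS. \<P>(\<omega> in M. past N \<sigma> n \<omega> = (l, ms))) = \<P>(\<omega> in M. A \<omega> = l)"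
  proof (rule prob_sum[symmetric])
    show "AE \<omega> in M. (\<forall>ms\<in>MS. past N \<sigma> n \<omega> = (l, ms) \<longrightarrow> A \<omega> = l) \<and>
      (A \<omega> = l \<longrightarrow> (\<exists>!ms. ms \<in> MS \<and> past N \<sigma> n \<omega> = (l, ms)))"
      using range by (rule AE_mp) (auto simp: past_eq)
  qed (use MS in \<open>auto simp: past_eq\<close>)
  also have "(\<Sum>k\<in>{1..n}. (if l ! (k - 1) = v then p else r) / n) = (\<Sum>k<n. if l ! k = v then p else r) / n"
    unfolding sum_divide_distrib
    by (rule sum.reindex_bij_witness[of _ "Suc" "\<lambda>k. k - 1"]) auto
  finally show ?thesis unfolding A_def Z_def .
qed

end

section \<open>Conditional moments of one planar step\<close>

abbreviation e1 :: "int ^ 2" where "e1 \<equiv> axis 1 1"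
abbreviation e2 :: "int ^ 2" where "e2 \<equiv> axis 2 1"

text \<open>For \<open>a \<ge> 0\<close> this is a mixture: with weight \<open>a\<close> the step of
  a uniformly chosen earlier time, with weight \<open>1 - a\<close> a uniform choice among the four
  steps.\<close>

definition step_prob :: "real \<Rightarrow> (int ^ 2) list \<Rightarrow> int ^ 2 \<Rightarrow> real" where
  "step_prob a l v = (1 - a) / 4 + a * (count_list l v / length l)"

definition sqdist :: "(int ^ 2) list \<Rightarrow> real" where
  "sqdist l = (real_of_int (sum_list l $ 1))\<^sup>2 + (real_of_int (sum_list l $ 2))\<^sup>2"

text \<open>Times \<open>a / (2 n)\<close>, this is the deviation from 1/2 of the probability of a
  horizontal step, the source of all anisotropy.\<close>

definition imbalance :: "(int ^ 2) list \<Rightarrow> real" where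
  "imbalance l = real (count_list l e1) + count_list l (- e1) - (real (count_list l e2) + count_list l (- e2))"

lemma steps_2: "(steps :: (int ^ 2) set) = {e1, - e1, e2, - e2}"
  by (auto simp: steps_def UNIV_2)

lemma steps_distinct: "e1 \<noteq> - e1" "e1 \<noteq> e2" "e1 \<noteq> - e2" "- e1 \<noteq> e2" "- e1 \<noteq> - e2" "e2 \<noteq> - e2"
  "- e1 \<noteq> e1" "e2 \<noteq> e1" "- e2 \<noteq> e1" "e2 \<noteq> - e1" "- e2 \<noteq> - e1" "- e2 \<noteq> e2"
  by (auto simp: vec_eq_iff forall_2 axis_def)

lemma sum_steps: "(\<Sum>v\<in>(steps :: (int ^ 2) set). f v) = f e1 + f (- e1) + f e2 + f (- e2)"
  for f :: "int ^ 2 \<Rightarrow> real"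
proof -
  have "- e1 \<notin> {e2, - e2}" "e1 \<notin> {- e1, e2, - e2}" "e2 \<notin> {- e2}" using steps_distinct by blast+
  then show ?thesis unfolding steps_2 by simp
qed

lemma axis_component: "e1 $ 1 = 1" "e1 $ 2 = 0" "e2 $ 1 = 0" "e2 $ 2 = 1"
  by (auto simp: axis_def)

lemma counts:
  assumes "set l \<subseteq> steps"
  shows "real (length l) = real (count_list l e1) + count_list l (- e1) + count_list l e2 + count_list l (- e2)"
    and "real_of_int (sum_list l $ 1) = real (count_list l e1) - count_list l (- e1)"
    and "real_of_int (sum_list l $ 2) = real (count_list l e2) - count_list l (- e2)"
  using assms
proof (induction l)
  case (Cons v l)
  {
    case 1
    then have "v \<in> steps" by simp
    with 1 Cons.IH(1) show ?case unfolding steps_2 by (auto simp: steps_distinct)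
  next
    case 2
    then have "v \<in> steps" by simp
    with 2 Cons.IH(2) show ?case unfolding steps_2 by (auto simp: steps_distinct axis_component)
  next
    case 3
    then have "v \<in> steps" by simp
    with 3 Cons.IH(3) show ?case unfolding steps_2 by (auto simp: steps_distinct axis_component)
  }
qed auto

lemma abs_imbalance_le: "set l \<subseteq> steps \<Longrightarrow> \<bar>imbalance l\<bar> \<le> length l"
  using counts(1)[of l] by (simp add: imbalance_def)

text \<open>The moments needed later involve the four probabilities only through differences and
  sums over antipodal pairs: the former give the drift, the latter the covariance.\<close>

lemma step_prob_pairs:
  assumes "l \<noteq> []" "set l \<subseteq> steps"
  defines "n \<equiv> real (length l)"
  shows "step_prob a l e1 - step_prob a l (- e1) = a * real_of_int (sum_list l $ 1) / n"
    and "step_prob a l e2 - step_prob a l (- e2) = a * real_of_int (sum_list l $ 2) / n"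
    and "step_prob a l e1 + step_prob a l (- e1) = 1 / 2 + a * imbalance l / (2 * n)"
    and "step_prob a l e2 + step_prob a l (- e2) = 1 / 2 - a * imbalance l / (2 * n)"
proof -
  have n: "n > 0" using assms by (simp add: n_def)
  define c1 c2 c3 c4 where "c1 = real (count_list l e1)" and "c2 = real (count_list l (- e1))"
    and "c3 = real (count_list l e2)" and "c4 = real (count_list l (- e2))"
  note c = c1_def[symmetric] c2_def[symmetric] c3_def[symmetric] c4_def[symmetric]
  have nc: "n = c1 + c2 + c3 + c4" using counts(1)[OF assms(2)] by (simp add: n_def c)
  have w: "imbalance l = 2 * (c1 + c2) - n" "imbalance l = n - 2 * (c3 + c4)"
    unfolding imbalance_def c nc by auto
  show "step_prob a l e1 - step_prob a l (- e1) = a * real_of_int (sum_list l $ 1) / n"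
    "step_prob a l e2 - step_prob a l (- e2) = a * real_of_int (sum_list l $ 2) / n"
    unfolding counts(2,3)[OF assms(2)] step_prob_def n_def[symmetric] c using n by (simp_all add: field_simps)
  show "step_prob a l e1 + step_prob a l (- e1) = 1 / 2 + a * imbalance l / (2 * n)"
    unfolding w(1) step_prob_def n_def[symmetric] c using n by (simp add: field_simps)
  show "step_prob a l e2 + step_prob a l (- e2) = 1 / 2 - a * imbalance l / (2 * n)"
    unfolding w(2) step_prob_def n_def[symmetric] c using n by (simp add: field_simps)
qed

lemma step_prob_sum:
  assumes "l \<noteq> []" "set l \<subseteq> steps"
  shows "(\<Sum>v\<in>steps. step_prob a l v) = 1"
  unfolding sum_steps using step_prob_pairs(3,4)[OF assms, of a] by linarith

lemma step_prob_nonneg: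
  assumes "l \<noteq> []" "-1/3 \<le> a" "a \<le> 1"
  shows "0 \<le> step_prob a l v"
proof -
  define f where "f = real (count_list l v) / length l"
  have f: "0 \<le> f" "f \<le> 1" using assms count_le_length[of l v] by (auto simp: f_def)
  have "0 \<le> (1 - a) / 4 + a * f"
  proof (cases "0 \<le> a")
    case True
    then show ?thesis using f assms by simp
  next
    case False
    then have "a * 1 \<le> a * f" using f by (intro mult_left_mono_neg) auto
    then show ?thesis using assms by argo
  qed
  then show ?thesis by (simp add: step_prob_def f_def)
qed

lemma finite_distribution_step_prob:
  assumes "l \<noteq> []" "set l \<subseteq> steps" "-1/3 \<le> a" "a \<le> 1"
  shows "finite_distribution (steps :: (int ^ 2) set) (step_prob a l)"
  using assms by unfold_locales (auto simp: steps_2 step_prob_nonneg step_prob_sum[unfolded steps_2])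

lemma sqdist_snoc:
  "sqdist (l @ [e1]) - sqdist l = 2 * real_of_int (sum_list l $ 1) + 1"
  "sqdist (l @ [- e1]) - sqdist l = - 2 * real_of_int (sum_list l $ 1) + 1"
  "sqdist (l @ [e2]) - sqdist l = 2 * real_of_int (sum_list l $ 2) + 1"
  "sqdist (l @ [- e2]) - sqdist l = - 2 * real_of_int (sum_list l $ 2) + 1"
  by (auto simp: sqdist_def axis_component power2_eq_square algebra_simps)

lemma sqdist_nonneg: "0 \<le> sqdist l"
  by (simp add: sqdist_def)

lemma sqdist_increment_le:
  assumes "v \<in> steps"
  shows "\<bar>sqdist (l @ [v]) - sqdist l\<bar> \<le> 2 * sqrt (sqdist l) + 1"
proof -
  have "\<bar>real_of_int (sum_list l $ 1)\<bar> \<le> sqrt (sqdist l)" "\<bar>real_of_int (sum_list l $ 2)\<bar> \<le> sqrt (sqdist l)"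
    by (auto simp: sqdist_def intro!: real_le_rsqrt)
  with assms sqdist_snoc[of l] show ?thesis unfolding steps_2 by auto
qed

lemma imbalance_snoc:
  "imbalance (l @ [e1]) = imbalance l + 1" "imbalance (l @ [- e1]) = imbalance l + 1"
  "imbalance (l @ [e2]) = imbalance l - 1" "imbalance (l @ [- e2]) = imbalance l - 1"
  by (auto simp: imbalance_def steps_distinct)

lemma mean_sqdist_increment:
  assumes "l \<noteq> []" "set l \<subseteq> steps"
  shows "(\<Sum>v\<in>steps. step_prob a l v * (sqdist (l @ [v]) - sqdist l)) = 1 + 2 * a * sqdist l / length l"
proof -
  define x where "x = real_of_int (sum_list l $ 1)"
  define y where "y = real_of_int (sum_list l $ 2)"
  note p = step_prob_pairs[OF assms, of a, folded x_def y_def]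
  have "(\<Sum>v\<in>steps. step_prob a l v * (sqdist (l @ [v]) - sqdist l))
      = 2 * x * (step_prob a l e1 - step_prob a l (- e1)) + 2 * y * (step_prob a l e2 - step_prob a l (- e2))
        + (step_prob a l e1 + step_prob a l (- e1)) + (step_prob a l e2 + step_prob a l (- e2))"
    unfolding sum_steps sqdist_snoc by (simp add: x_def y_def algebra_simps)
  also have "\<dots> = 1 + 2 * a * sqdist l / length l"
    unfolding p sqdist_def x_def[symmetric] y_def[symmetric]
    by (simp add: power2_eq_square add_divide_distrib algebra_simps)
  finally show ?thesis .
qed

text \<open>The main term is \<open>2 Q\<close> because both axes carry about half of the
  probability. The anisotropy adds a multiple of \<open>x^2 - y^2\<close>, which is at most Q in
  absolute value.\<close>

lemma mean_sqdist_increment_square: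
  assumes "l \<noteq> []" "set l \<subseteq> steps" "-1 \<le> a" "a \<le> 1"
  defines "n \<equiv> real (length l)"
  shows "\<bar>(\<Sum>v\<in>steps. step_prob a l v * (sqdist (l @ [v]) - sqdist l)\<^sup>2) - 2 * sqdist l\<bar>
    \<le> (2 * \<bar>imbalance l\<bar> / n + 4 / n) * sqdist l + 1"
proof -
  define x where "x = real_of_int (sum_list l $ 1)"
  define y where "y = real_of_int (sum_list l $ 2)"
  define w where "w = imbalance l"
  have n: "n > 0" using assms by (simp add: n_def)
  note p = step_prob_pairs[OF assms(1,2), of a, folded x_def y_def w_def n_def]
  have Q: "sqdist l = x\<^sup>2 + y\<^sup>2" by (simp add: sqdist_def x_def y_def)
  have "(\<Sum>v\<in>steps. step_prob a l v * (sqdist (l @ [v]) - sqdist l)\<^sup>2)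
      = (4 * x\<^sup>2 + 1) * (step_prob a l e1 + step_prob a l (- e1)) + 4 * x * (step_prob a l e1 - step_prob a l (- e1))
        + (4 * y\<^sup>2 + 1) * (step_prob a l e2 + step_prob a l (- e2)) + 4 * y * (step_prob a l e2 - step_prob a l (- e2))"
    unfolding sum_steps sqdist_snoc by (simp add: x_def y_def power2_eq_square algebra_simps)
  also have "\<dots> = 2 * sqdist l + 2 * a * w / n * (x\<^sup>2 - y\<^sup>2) + 4 * a / n * sqdist l + 1"
    unfolding p Q using n by (simp add: power2_eq_square field_simps)
  finally have *: "(\<Sum>v\<in>steps. step_prob a l v * (sqdist (l @ [v]) - sqdist l)\<^sup>2) - 2 * sqdist l
    = 2 * a * w / n * (x\<^sup>2 - y\<^sup>2) + 4 * a / n * sqdist l + 1" by simp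
  have a: "\<bar>a\<bar> \<le> 1" using assms by auto
  have "\<bar>2 * a * w / n * (x\<^sup>2 - y\<^sup>2)\<bar> = \<bar>a\<bar> * (2 * \<bar>w\<bar> / n) * \<bar>x\<^sup>2 - y\<^sup>2\<bar>"
    using n by (simp add: abs_mult)
  also have "\<dots> \<le> 1 * (2 * \<bar>w\<bar> / n) * sqdist l"
  proof (intro mult_mono)
    show "\<bar>x\<^sup>2 - y\<^sup>2\<bar> \<le> sqdist l"
      unfolding Q using zero_le_power2[of x] zero_le_power2[of y] by linarith
  qed (use a n in auto)
  finally have 1: "\<bar>2 * a * w / n * (x\<^sup>2 - y\<^sup>2)\<bar> \<le> 2 * \<bar>w\<bar> / n * sqdist l" by simp
  have "\<bar>4 * a / n * sqdist l\<bar> = \<bar>a\<bar> * (4 / n) * sqdist l"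
    using n sqdist_nonneg[of l] by (simp add: abs_mult)
  also have "\<dots> \<le> 1 * (4 / n) * sqdist l"
    using a n sqdist_nonneg[of l] by (intro mult_mono) auto
  finally have 2: "\<bar>4 * a / n * sqdist l\<bar> \<le> 4 / n * sqdist l" by simp
  show ?thesis unfolding * w_def[symmetric] distrib_right using 1 2 by linarith
qed

text \<open>The imbalance is itself a one-dimensional elephant random walk: it moves by +1 or -1
  with conditional mean \<open>a w / n\<close>.\<close>

lemma mean_imbalance_square:
  assumes "l \<noteq> []" "set l \<subseteq> steps"
  shows "(\<Sum>v\<in>steps. step_prob a l v * (imbalance (l @ [v]))\<^sup>2)
    = (imbalance l)\<^sup>2 * (1 + 2 * a / length l) + 1"
proof -
  define w where "w = imbalance l"
  note p = step_prob_pairs(3,4)[OF assms, of a, folded w_def]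
  have "(\<Sum>v\<in>steps. step_prob a l v * (imbalance (l @ [v]))\<^sup>2)
      = (w + 1)\<^sup>2 * (step_prob a l e1 + step_prob a l (- e1)) + (w - 1)\<^sup>2 * (step_prob a l e2 + step_prob a l (- e2))"
    unfolding sum_steps imbalance_snoc by (simp add: w_def algebra_simps)
  also have "\<dots> = w\<^sup>2 * (1 + 2 * a / length l) + 1"
    unfolding p using assms(1) by (simp add: power2_eq_square field_simps)
  finally show ?thesis by (simp add: w_def)
qed

section \<open>The planar walk as a step process\<close>

locale planar_walk = elephant_random_walk M p N \<sigma> S
  for M :: "'w measure" and p N and \<sigma> :: "nat \<Rightarrow> 'w \<Rightarrow> int ^ 2" and S :: "nat \<Rightarrow> 'w \<Rightarrow> int ^ 2" +
  fixes a :: real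
  assumes p01: "0 \<le> p" "p \<le> 1"
    and a_eq: "a = (4 * p - 1) / 3"
begin

lemma a_bounds: "-1/3 \<le> a" "a \<le> 1"
  using p01 by (auto simp: a_eq)

sublocale step_process M "steps :: (int ^ 2) set" "step_prob a" \<sigma>
proof
  show "finite (steps :: (int ^ 2) set)" by (simp add: steps_2)
  show "AE \<omega> in M. \<sigma> 1 \<omega> \<in> steps"
    using first_step by (rule AE_mp) (auto simp: steps_2)
  show "(\<Sum>v\<in>steps. step_prob a l v) = 1" if "l \<noteq> []" "set l \<subseteq> steps" for l
    using that by (rule step_prob_sum)
  show "0 \<le> step_prob a l v" if "l \<noteq> []" for l v
    using that a_bounds by (intro step_prob_nonneg)
next
  fix n :: nat and l :: "(int ^ 2) list" and v :: "int ^ 2"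
  assume n: "n \<ge> 1" "length l = n" and v: "v \<in> steps"
  \<comment> \<open>Since \<open>p - (1 - p) / 3 = a\<close>, each recall contributes
    \<open>(1 - p) / 3 = (1 - a) / 4\<close>, plus \<open>a\<close> if it matches
    \<open>v\<close>.\<close>
  have "(\<Sum>k<n. if l ! k = v then p else (1 - p) / 3)
      = (\<Sum>k<n. (1 - p) / 3 + (if l ! k = v then a else 0))"
    by (intro sum.cong refl) (auto simp: a_eq field_simps)
  also have "\<dots> = n * ((1 - p) / 3) + (\<Sum>k\<in>{k\<in>{..<n}. l ! k = v}. a)"
    unfolding sum.distrib sum.inter_filter[OF finite_lessThan] by simp
  also have "(\<Sum>k\<in>{k\<in>{..<n}. l ! k = v}. a) = a * card {k. k < n \<and> l ! k = v}"
    by (simp add: lessThan_def)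
  also have "card {k. k < n \<and> l ! k = v} = count_list l v"
    unfolding count_list_eq_length_filter length_filter_conv_card n(2) by (metis)
  finally have "(\<Sum>k<n. if l ! k = v then p else (1 - p) / 3) / n = step_prob a l v"
    using n by (simp add: step_prob_def a_eq field_simps)
  then have eq: "(\<Sum>k<n. if l ! k = v then p else (1 - p) / 3) / real n = step_prob a l v" by simp
  have three: "2 * real CARD(2) - 1 = 3" by simp
  show "\<P>(\<omega> in M. map (\<lambda>i. \<sigma> i \<omega>) [1..<n + 1] = l \<and> \<sigma> (n + 1) \<omega> = v)
      = \<P>(\<omega> in M. map (\<lambda>i. \<sigma> i \<omega>) [1..<n + 1] = l) * step_prob a l v"
    using step_law[OF n v] by (simp only: three eq)
qed (rule measurable_step)

lemma walk_eq: "\<omega> \<in> space M \<Longrightarrow> S n \<omega> = sum_list (X n \<omega>)"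
proof (induction n)
  case 0
  then show ?case using walk_0 by (simp add: X_def)
next
  case (Suc n)
  then show ?case using walk_Suc[of \<omega> n] by (simp add: X_Suc)
qed

end

section \<open>Balance of the steps and spread of the walk\<close>

text \<open>Bernoulli's inequality for real exponents, obtained by comparing logarithmic
  derivatives.\<close>

lemma one_plus_mult_le_powr:
  fixes x b :: real
  assumes "0 \<le> x" "1 \<le> b"
  shows "1 + b * x \<le> (1 + x) powr b"
proof -
  define f where "f t = b * ln (1 + t) - ln (1 + b * t)" for t :: real
  have "\<exists>y. (f has_real_derivative y) (at t) \<and> 0 \<le> y" if "0 \<le> t" "t \<le> x" for t
  proof (intro exI conjI)
    have pos: "0 < 1 + t" "0 < 1 + b * t" "1 + t \<le> 1 + b * t"
      using that assms by (auto intro: add_pos_nonneg mult_le_cancel_right1[THEN iffD2])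
    then show "(f has_real_derivative b / (1 + t) - b / (1 + b * t)) (at t)"
      unfolding f_def by (auto intro!: derivative_eq_intros simp: field_simps)
    show "0 \<le> b / (1 + t) - b / (1 + b * t)"
      using pos assms by (auto intro!: divide_left_mono mult_pos_pos)
  qed
  then have "f 0 \<le> f x" using DERIV_nonneg_imp_nondecreasing[OF assms(1), of f] by blast
  then have "ln (1 + b * x) \<le> b * ln (1 + x)" by (simp add: f_def)
  moreover have "0 < 1 + b * x" using assms by (intro add_pos_nonneg mult_nonneg_nonneg) auto
  ultimately show ?thesis using assms by (simp add: powr_def ln_ge_iff flip: ln_le_cancel_iff)
qed

lemma sqdist_le:
  assumes "set l \<subseteq> steps"
  shows "sqdist l \<le> (real (length l))\<^sup>2"
proof -
  have *: "(b - c)\<^sup>2 + (d - e)\<^sup>2 \<le> (b + c + d + e)\<^sup>2"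
    if "0 \<le> b" "0 \<le> c" "0 \<le> d" "0 \<le> e" for b c d e :: real
  proof -
    have "(b + c + d + e)\<^sup>2 - ((b - c)\<^sup>2 + (d - e)\<^sup>2) = 2 * (2 * b * c + 2 * d * e + (b + c) * (d + e))"
      by (simp add: power2_eq_square algebra_simps)
    also have "\<dots> \<ge> 0" using that by simp
    finally show ?thesis by simp
  qed
  show ?thesis unfolding sqdist_def counts[OF assms] by (rule *) auto
qed

definition balanced :: "real \<Rightarrow> (int ^ 2) list \<Rightarrow> bool" where
  "balanced \<delta> l \<longleftrightarrow> \<bar>imbalance l\<bar> \<le> length l powr (1 - \<delta>)"

context planar_walk
begin

lemma next_mean_eq:
  assumes "l \<noteq> []" "set l \<subseteq> steps"
  shows "next_mean F l = finite_distribution.mean steps (step_prob a l) (\<lambda>v. F (l @ [v]))"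
  using finite_distribution.mean_def[OF finite_distribution_step_prob[OF assms a_bounds]]
  by (simp add: next_mean_def)

text \<open>The square of the imbalance grows at most like a power of n with exponent below 2 when
  \<open>a < 1\<close>. The term \<open>K * length l\<close> in \<open>F\<close> absorbs the
  constant 1 in its drift, and Bernoulli's inequality absorbs the rest into the power.\<close>

lemma imbalance_control:
  fixes m :: nat
  assumes a: "a < 1" and m: "m \<ge> 1"
  shows "\<P>(\<omega> in M. \<exists>n\<ge>m. \<not> balanced ((1 - a) / 8) (X n \<omega>))
    \<le> (1 + 2 / (1 + a)) * m powr (- ((1 - a) / 4))"
proof -
  \<comment> \<open>The exponent must satisfy \<open>2 a \<le> b\<close> for the drift and
    \<open>1 < b\<close> so that \<open>K * (b - 1) = 1\<close> has a positive solution;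
    \<open>2 - b = (1 - a) / 2\<close> then leaves \<open>(1 - a) / 4\<close> for the decay after
    the loss of \<open>2 \<delta>\<close> with \<open>\<delta> = (1 - a) / 8\<close>.\<close>
  define b where "b = (3 + a) / 2"
  define K where "K = 2 / (1 + a)"
  define F where "F l = ((imbalance l)\<^sup>2 + K * length l) * length l powr (- b)" for l
  define c where "c = real m powr ((1 - a) / 4)"
  have b: "1 < b" "b < 2" "2 * a \<le> b" using a a_bounds by (auto simp: b_def)
  have K: "0 < K" "1 + K = K * b" using a_bounds by (auto simp: K_def b_def field_simps)
  have c: "c > 0" using m by (simp add: c_def)
  have drift: "next_mean F l \<le> F l" if l: "1 \<le> length l" "set l \<subseteq> steps" for l
  proof -
    define n where "n = real (length l)"
    define w where "w = imbalance l"
    have n: "n \<ge> 1" using l by (simp add: n_def)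
    have ne: "l \<noteq> []" using l by auto
    have "next_mean F l = (\<Sum>v\<in>steps. (step_prob a l v * (imbalance (l @ [v]))\<^sup>2
        + step_prob a l v * (K * (n + 1))) * (n + 1) powr (- b))"
      unfolding next_mean_def F_def by (intro sum.cong refl) (simp add: n_def algebra_simps)
    also have "\<dots> = (w\<^sup>2 * (1 + 2 * a / n) + 1 + K * (n + 1)) * (n + 1) powr (- b)"
      unfolding sum_distrib_right[symmetric] sum.distrib mean_imbalance_square[OF ne l(2)]
        step_prob_sum[OF ne l(2)] by (simp add: n_def w_def)
    also have "w\<^sup>2 * (1 + 2 * a / n) + 1 + K * (n + 1) \<le> (w\<^sup>2 + K * n) * (1 + b * (1 / n))"
    proof -
      have "w\<^sup>2 * (2 * a / n) \<le> w\<^sup>2 * (b / n)" using b n by (intro mult_left_mono divide_right_mono) auto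
      moreover have "(w\<^sup>2 + K * n) * (1 + b * (1 / n)) = w\<^sup>2 + w\<^sup>2 * (b / n) + K * n + K * b"
        using n by (simp add: algebra_simps)
      moreover have "w\<^sup>2 * (1 + 2 * a / n) + 1 + K * (n + 1) = w\<^sup>2 + w\<^sup>2 * (2 * a / n) + K * n + (1 + K)"
        by (simp add: algebra_simps)
      ultimately show ?thesis using K by linarith
    qed
    also have "\<dots> \<le> (w\<^sup>2 + K * n) * (1 + 1 / n) powr b"
      using n b K by (intro mult_left_mono one_plus_mult_le_powr) auto
    also have "(1 + 1 / n) powr b = (n + 1) powr b / n powr b"
      using n by (simp add: powr_divide[symmetric] field_simps)
    also have "(w\<^sup>2 + K * n) * ((n + 1) powr b / n powr b) * (n + 1) powr (- b) = F l"
    proof -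
      have "(n + 1) powr b > 0" using n by simp
      then have "(w\<^sup>2 + K * n) * ((n + 1) powr b / n powr b) * (n + 1) powr (- b) = (w\<^sup>2 + K * n) / n powr b"
        by (simp add: powr_minus_divide)
      then show ?thesis by (simp add: F_def w_def n_def powr_minus_divide)
    qed
    finally show ?thesis by (simp add: mult_right_mono)
  qed
  \<comment> \<open>Started at time 1, where \<open>F\<close> is at most \<open>1 + K\<close> on
    every path; the decay in \<open>m\<close> comes from the level \<open>c\<close>.\<close>
  have "\<P>(\<omega> in M. X 1 \<omega> \<in> UNIV \<and> (\<exists>n\<ge>1. (\<forall>j\<in>{1..<n}. True) \<and> F (X n \<omega>) \<ge> c))
      \<le> (\<Sum>l\<in>paths 1 \<inter> UNIV. weight 1 l * F l) / c"
  proof (rule maximal_inequality)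
    show "0 \<le> F l" for l using K by (simp add: F_def)
    then show "0 \<le> F (l @ [v])" for l v by blast
  qed (use c drift in auto)
  also have "(\<Sum>l\<in>paths 1 \<inter> UNIV. weight 1 l * F l) \<le> (\<Sum>l\<in>paths 1. weight 1 l * (1 + K))"
    unfolding Int_UNIV_right
  proof (intro sum_mono mult_left_mono weight_nonneg)
    fix l assume "l \<in> paths 1"
    then have "length l = 1" "\<bar>imbalance l\<bar> \<le> 1" using abs_imbalance_le[of l] by (auto simp: paths_def)
    moreover from this(2) have "(imbalance l)\<^sup>2 \<le> 1" by (simp add: abs_square_le_1)
    ultimately show "F l \<le> 1 + K" by (simp add: F_def)
  qed
  also have "\<dots> = 1 + K" using weight_total[of 1] by (simp flip: sum_distrib_right)
  finally have 1: "\<P>(\<omega> in M. \<exists>n\<ge>1. F (X n \<omega>) \<ge> c) \<le> (1 + K) / c" using c by (simp add: divide_right_mono)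
  have "F (X n \<omega>) \<ge> c" if nb: "\<not> balanced ((1 - a) / 8) (X n \<omega>)" and n: "n \<ge> m" for n \<omega>
  proof -
    define w where "w = imbalance (X n \<omega>)"
    have n1: "real n \<ge> 1" using n m by simp
    have "c \<le> real n powr ((1 - a) / 4)"
      unfolding c_def using n a by (intro powr_mono2) auto
    also have "\<dots> = (real n powr (1 - (1 - a) / 8))\<^sup>2 * real n powr (- b)"
    proof -
      have "(1 - (1 - a) / 8) + (1 - (1 - a) / 8) + (- b) = (1 - a) / 4"
        by (simp add: b_def field_simps)
      then show ?thesis by (simp only: power2_eq_square powr_add[symmetric])
    qed
    also have "(real n powr (1 - (1 - a) / 8))\<^sup>2 \<le> \<bar>w\<bar>\<^sup>2"
      using nb by (intro power_mono) (auto simp: balanced_def w_def)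
    also have "\<bar>w\<bar>\<^sup>2 * real n powr (- b) \<le> F (X n \<omega>)"
      using K by (simp add: F_def w_def mult_right_mono)
    finally show ?thesis by (simp add: mult_right_mono)
  qed
  then have "\<P>(\<omega> in M. \<exists>n\<ge>m. \<not> balanced ((1 - a) / 8) (X n \<omega>)) \<le> \<P>(\<omega> in M. \<exists>n\<ge>1. F (X n \<omega>) \<ge> c)"
    using m by (intro finite_measure_mono) (auto, meson order_trans)
  also have "\<dots> \<le> (1 + K) / c" by (rule 1)
  also have "\<dots> = (1 + K) * m powr (- ((1 - a) / 4))" by (simp add: c_def powr_minus field_simps)
  finally show ?thesis by (simp add: K_def)
qed

lemma imbalance_control_LIMSEQ:
  assumes "a < 1"
  shows "(\<lambda>m. \<P>(\<omega> in M. \<exists>n\<ge>m. \<not> balanced ((1 - a) / 8) (X n \<omega>))) \<longlonglongrightarrow> 0"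
proof (rule tendsto_sandwich[of "\<lambda>_. 0"])
  have "(1 - a) / 4 > 0" using assms by simp
  then show "(\<lambda>m. (1 + 2 / (1 + a)) * real m powr (- ((1 - a) / 4))) \<longlonglongrightarrow> 0"
    by real_asymp
  show "\<forall>\<^sub>F m in sequentially. \<P>(\<omega> in M. \<exists>n\<ge>m. \<not> balanced ((1 - a) / 8) (X n \<omega>))
      \<le> (1 + 2 / (1 + a)) * real m powr (- ((1 - a) / 4))"
    using eventually_ge_at_top[of 1] by eventually_elim (rule imbalance_control[OF assms])
qed auto

text \<open>If Q stays below n up to time \<open>N'\<close>, the supermartingale \<open>F\<close>
  ends above \<open>ln N' / 2\<close> although it started below \<open>4 + ln m / 2\<close>.\<close>

lemma spread:
  assumes a: "1/2 \<le> a" and m: "1 \<le> m" "m \<le> N'" "2 \<le> N'"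
  shows "\<P>(\<omega> in M. \<forall>n\<in>{m..N'}. sqdist (X n \<omega>) < n) \<le> (8 + ln m) / ln N'"
proof -
  \<comment> \<open>The drift of \<open>Q / n\<close> is at least \<open>1 / (n + 1)\<close>, while
    \<open>ln n / 2\<close> grows by at most \<open>1 / (2 n)\<close>. The summand 4 keeps
    \<open>F\<close> nonnegative one step after \<open>Q < n\<close>, since then
    \<open>Q + 2 sqrt Q + 1 \<le> 4 n\<close>.\<close>
  define F where "F l = 4 - sqdist l / length l + ln (length l) / 2" for l
  define G where "G l \<longleftrightarrow> sqdist l < length l" for l
  define c where "c = ln N' / 2"
  have c: "c > 0" using m by (simp add: c_def)
  have F_nonneg: "0 \<le> F l" if "length l \<ge> 1" "sqdist l \<le> 4 * real (length l)" for l
  proof -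
    have "sqdist l / length l \<le> 4" using that by (simp add: divide_le_eq)
    moreover have "0 \<le> ln (length l)" using that by simp
    ultimately show ?thesis by (simp add: F_def)
  qed
  have "\<P>(\<omega> in M. X m \<omega> \<in> {l. G l} \<and> (\<exists>n\<ge>m. (\<forall>j\<in>{m..<n}. G (X j \<omega>)) \<and> F (X n \<omega>) \<ge> c))
      \<le> (\<Sum>l\<in>paths m \<inter> {l. G l}. weight m l * F l) / c"
  proof (rule maximal_inequality)
    show "0 \<le> F l" if "l \<in> {l. G l}" "l \<in> paths m" for l
      using that m by (intro F_nonneg) (auto simp: G_def paths_def)
    show "0 \<le> F (l @ [v])" if "m \<le> length l" "v \<in> steps" "G l" for l v
    proof (rule F_nonneg)
      define n where "n = real (length l)"
      have n: "n \<ge> 1" using that m by (simp add: n_def)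
      have "sqrt (sqdist l) \<le> n"
      proof -
        have "sqdist l \<le> n * 1" using that by (simp add: G_def n_def)
        also have "\<dots> \<le> n * n" using n by (intro mult_left_mono) auto
        finally show ?thesis using n by (intro real_le_lsqrt) (auto simp: power2_eq_square)
      qed
      then show "sqdist (l @ [v]) \<le> 4 * real (length (l @ [v]))"
        using sqdist_increment_le[OF that(2), of l] that(3) by (simp add: G_def n_def)
    qed simp
    show "next_mean F l \<le> F l" if l: "m \<le> length l" "set l \<subseteq> steps" for l
    proof -
      define n where "n = real (length l)"
      define Q where "Q = sqdist l"
      have n: "n \<ge> 1" and ne: "l \<noteq> []" using l m by (auto simp: n_def)
      have sum1: "(\<Sum>v\<in>steps. step_prob a l v) = 1" by (rule step_prob_sum[OF ne l(2)])
      have "next_mean F l = (\<Sum>v\<in>steps. step_prob a l v * (4 + ln (n + 1) / 2 - Q / (n + 1))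
          - (step_prob a l v * (sqdist (l @ [v]) - sqdist l)) / (n + 1))"
        unfolding next_mean_def F_def
        by (intro sum.cong refl)
           (simp add: n_def Q_def diff_divide_distrib algebra_simps)
      also have "\<dots> = (4 + ln (n + 1) / 2 - Q / (n + 1)) - (1 + 2 * a * Q / n) / (n + 1)"
        unfolding sum_subtractf sum_distrib_right[symmetric] sum_divide_distrib[symmetric] sum1
          mean_sqdist_increment[OF ne l(2)] by (simp add: n_def Q_def)
      also have "\<dots> \<le> (4 + ln (n + 1) / 2 - Q / (n + 1)) - (1 + Q / n) / (n + 1)"
      proof (intro diff_left_mono divide_right_mono add_left_mono)
        have "1 * Q \<le> (2 * a) * Q" using a sqdist_nonneg[of l] by (intro mult_right_mono) (auto simp: Q_def)
        then show "Q \<le> 2 * a * Q" by simp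
      qed (use n in auto)
      also have "\<dots> = 4 + ln (n + 1) / 2 - Q / n - 1 / (n + 1)"
      proof -
        have "Q + Q / n = (Q / n) * (n + 1)" using n by (simp add: field_simps)
        then have "(Q + Q / n) / (n + 1) = Q / n" using n by simp
        then have "Q / (n + 1) + Q / n / (n + 1) = Q / n" by (simp only: add_divide_distrib)
        then show ?thesis by (simp add: add_divide_distrib)
      qed
      also have "\<dots> \<le> 4 + ln n / 2 - Q / n"
      proof -
        have "ln (n + 1) - ln n = ln (1 + 1 / n)"
          using n by (simp add: ln_divide_pos[symmetric] add_divide_distrib add.commute flip: ln_div)
        also have "\<dots> \<le> 1 / n" using n by (intro ln_add_one_self_le_self) auto
        finally have "ln (n + 1) - ln n \<le> 1 / n" .
        moreover have "1 / n / 2 \<le> 1 / (n + 1)" using n by (simp add: field_simps)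
        moreover have "4 + x / 2 - z - u \<le> 4 + y / 2 - z" if "x - y \<le> r" "r / 2 \<le> u" for x y z u r :: real
          using that by (simp add: field_simps)
        ultimately show ?thesis by blast
      qed
      finally show ?thesis by (simp add: F_def n_def Q_def)
    qed
  qed (use m c in auto)
  also have "(\<Sum>l\<in>paths m \<inter> {l. G l}. weight m l * F l) \<le> (\<Sum>l\<in>paths m \<inter> {l. G l}. weight m l * (4 + ln m / 2))"
    using sqdist_nonneg by (intro sum_mono mult_left_mono weight_nonneg) (auto simp: F_def paths_def)
  also have "\<dots> \<le> (\<Sum>l\<in>paths m. weight m l * (4 + ln m / 2))"
    using m by (intro sum_mono2 finite_paths) (auto intro!: mult_nonneg_nonneg weight_nonneg add_nonneg_nonneg)
  also have "\<dots> = 4 + ln m / 2" using weight_total[of m] m by (simp flip: sum_distrib_right)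
  finally have 1: "\<P>(\<omega> in M. X m \<omega> \<in> {l. G l} \<and> (\<exists>n\<ge>m. (\<forall>j\<in>{m..<n}. G (X j \<omega>)) \<and> F (X n \<omega>) \<ge> c))
      \<le> (4 + ln m / 2) / c" using c by (simp add: divide_right_mono)
  have "F (X N' \<omega>) \<ge> c" if "sqdist (X N' \<omega>) < N'" for \<omega>
    using that m by (simp add: F_def c_def field_simps)
  then have "\<P>(\<omega> in M. \<forall>n\<in>{m..N'}. sqdist (X n \<omega>) < n)
      \<le> \<P>(\<omega> in M. X m \<omega> \<in> {l. G l} \<and> (\<exists>n\<ge>m. (\<forall>j\<in>{m..<n}. G (X j \<omega>)) \<and> F (X n \<omega>) \<ge> c))"
    using m by (intro finite_measure_mono) (auto simp: G_def intro!: exI[of _ N'])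
  also have "\<dots> \<le> (4 + ln m / 2) / c" by (rule 1)
  also have "\<dots> = (8 + ln m) / ln N'" using c by (simp add: c_def field_simps)
  finally show ?thesis .
qed

end

section \<open>Transience\<close>

text \<open>\<open>sqdist\<close> takes integer values, so \<open>max 1\<close> changes it only at
  the origin. There the quotient would be 0 by convention, and the barrier would vanish where it has
  to be large.\<close>

definition barrier :: "(int ^ 2) list \<Rightarrow> real" where
  "barrier l = sqrt (ln (1 + 4 * length l * ln (length l) / max 1 (sqdist l)) / ln (length l))"

text \<open>Outside the ball \<open>Q \<le> sqrt n\<close> the distance exceeds
  \<open>n powr (1/4)\<close> and \<open>1 / Q\<close> is below \<open>1 / sqrt n\<close>; the
  second condition then makes the distance large against \<open>s^2\<close>, the third bounds
  \<open>\<rho> * s^2\<close>.\<close>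

lemma transience_thresholds:
  fixes \<delta> :: real
  assumes "0 < \<delta>"
  shows "\<forall>\<^sub>F x in at_top. 1000 \<le> ln x \<and> 2000000 * (ln x)\<^sup>2 \<le> x powr (1/4)
    \<and> (2 * x powr (- \<delta>) + 4 / x + 1 / sqrt x) * (ln x)\<^sup>2 \<le> 1 / 5000"
proof (intro eventually_conj)
  show "\<forall>\<^sub>F x::real in at_top. 1000 \<le> ln x" by real_asymp
  show "\<forall>\<^sub>F x::real in at_top. 2000000 * (ln x)\<^sup>2 \<le> x powr (1/4)" by real_asymp
  have "((\<lambda>x::real. (2 * x powr (- \<delta>) + 4 / x + 1 / sqrt x) * (ln x)\<^sup>2) \<longlongrightarrow> 0) at_top"
  proof -
    have "((\<lambda>x::real. x powr (- \<delta>) * (ln x)\<^sup>2) \<longlongrightarrow> 0) at_top" using assms by real_asymp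
    moreover have "((\<lambda>x::real. (4 / x + 1 / sqrt x) * (ln x)\<^sup>2) \<longlongrightarrow> 0) at_top" by real_asymp
    ultimately have "((\<lambda>x::real. 2 * (x powr (- \<delta>) * (ln x)\<^sup>2) + (4 / x + 1 / sqrt x) * (ln x)\<^sup>2) \<longlongrightarrow> 2 * 0 + 0) at_top"
      by (intro tendsto_add tendsto_mult tendsto_const)
    then show ?thesis by (simp add: algebra_simps)
  qed
  then have "\<forall>\<^sub>F x in at_top. (2 * x powr (- \<delta>) + 4 / x + 1 / sqrt x) * (ln x)\<^sup>2 < 1 / 5000"
    by (rule order_tendstoD) simp
  then show "\<forall>\<^sub>F x in at_top. (2 * x powr (- \<delta>) + 4 / x + 1 / sqrt x) * (ln x)\<^sup>2 \<le> 1 / 5000"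
    by eventually_elim simp
qed

lemma measure_eq_0I:
  assumes "\<And>e::real. e > 0 \<Longrightarrow> measure M A \<le> e"
  shows "measure M A = 0"
  using field_le_epsilon[of "measure M A" 0] assms by (simp add: measure_le_0_iff)

context planar_walk
begin

lemma barrier_drift:
  assumes a: "1/2 \<le> a" "a < 1"
  obtains n0 where "\<And>l. \<lbrakk>n0 \<le> length l; set l \<subseteq> steps; balanced ((1 - a) / 8) l; sqrt (length l) < sqdist l\<rbrakk>
    \<Longrightarrow> next_mean barrier l \<le> barrier l"
proof -
  define \<delta> where "\<delta> = (1 - a) / 8"
  have "0 < \<delta>" using a by (simp add: \<delta>_def)
  from transience_thresholds[OF this] obtain b where b: "\<And>x. b \<le> x \<Longrightarrow> 1000 \<le> ln x \<and>
      2000000 * (ln x)\<^sup>2 \<le> x powr (1/4) \<and> (2 * x powr (- \<delta>) + 4 / x + 1 / sqrt x) * (ln x)\<^sup>2 \<le> 1 / 5000"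
    by (auto simp: eventually_at_top_linorder)
  show thesis
  proof
    fix l :: "(int ^ 2) list"
    assume len: "nat \<lceil>max 1 b\<rceil> \<le> length l" and l: "set l \<subseteq> steps"
      and bal: "balanced ((1 - a) / 8) l" and far: "sqrt (length l) < sqdist l"
    define n where "n = real (length l)"
    define Q where "Q = sqdist l"
    define k where "k = sqrt Q"
    define s where "s = ln n"
    define s' where "s' = ln (n + 1)"
    \<comment> \<open>The relative error of the second moment: anisotropy, the drift correction
      \<open>4 / n\<close>, and the additive constant 1 measured against Q.\<close>
    define \<rho> where "\<rho> = 2 * \<bar>imbalance l\<bar> / n + 4 / n + 1 / Q"
    define D where "D v = sqdist (l @ [v]) - Q" for v
    have n: "1 \<le> n" "b \<le> n" using len unfolding n_def by linarith+
    have ne: "l \<noteq> []" using n by (auto simp: n_def)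
    have s: "1000 \<le> s" and k4: "2000000 * s\<^sup>2 \<le> n powr (1/4)"
      and small: "(2 * n powr (- \<delta>) + 4 / n + 1 / sqrt n) * s\<^sup>2 \<le> 1 / 5000"
      using b[OF n(2)] by (auto simp: s_def)
    have Qn: "sqrt n < Q" using far by (simp add: Q_def n_def)
    have Q: "0 < Q" using Qn n by (smt (verit) real_sqrt_ge_zero)
    have Qk: "Q = k\<^sup>2" using Q by (simp add: k_def)
    have "n powr (1/4) = sqrt (sqrt n)"
      using n by (simp add: powr_half_sqrt[symmetric] powr_powr)
    also have "\<dots> \<le> k" unfolding k_def using Qn by simp
    finally have ks: "2000000 * s\<^sup>2 \<le> k" using k4 by linarith
    have "1000\<^sup>2 \<le> s\<^sup>2" using s by (intro power_mono) auto
    then have k: "4 \<le> k" using ks by simp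
    have "Q \<le> n\<^sup>2" using sqdist_le[OF l] by (simp add: Q_def n_def)
    then have kn: "k \<le> n" unfolding k_def using n by (intro real_le_lsqrt) auto
    have D: "\<bar>D v\<bar> \<le> 3 * k" "1 \<le> Q + D v" if "v \<in> steps" for v
    proof -
      have d: "\<bar>D v\<bar> \<le> 2 * k + 1" using sqdist_increment_le[OF that, of l] by (simp add: D_def k_def Q_def)
      then show "\<bar>D v\<bar> \<le> 3 * k" using k by linarith
      have "4 * k \<le> k * k" using k by (intro mult_right_mono) auto
      then have "4 * k \<le> Q" by (simp add: Qk power2_eq_square)
      then show "1 \<le> Q + D v" using d k by linarith
    qed
    interpret fd: finite_distribution "steps :: (int ^ 2) set" "step_prob a l"
      by (rule finite_distribution_step_prob[OF ne l a_bounds])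
    have m1: "fd.mean D = 1 + 2 * a * Q / n"
      unfolding fd.mean_def D_def Q_def n_def by (rule mean_sqdist_increment[OF ne l])
    have "\<bar>fd.mean (\<lambda>v. (D v)\<^sup>2) - 2 * Q\<bar> \<le> (2 * \<bar>imbalance l\<bar> / n + 4 / n) * Q + 1"
      unfolding fd.mean_def D_def Q_def n_def
      using mean_sqdist_increment_square[OF ne l, of a] a by simp
    also have "\<dots> = \<rho> * Q" using Q by (simp add: \<rho>_def distrib_right)
    finally have m2: "\<bar>fd.mean (\<lambda>v. (D v)\<^sup>2) - 2 * Q\<bar> \<le> \<rho> * Q" .
    have \<rho>0: "0 \<le> \<rho>" using n Q unfolding \<rho>_def by (intro add_nonneg_nonneg) auto
    have "\<rho> \<le> 2 * n powr (- \<delta>) + 4 / n + 1 / sqrt n"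
    proof -
      have "\<bar>imbalance l\<bar> / n \<le> n powr (1 - \<delta>) / n"
        using bal n by (intro divide_right_mono) (auto simp: balanced_def n_def \<delta>_def)
      also have "\<dots> = n powr (- \<delta>)" using n by (simp add: powr_diff powr_minus_divide)
      finally have "\<bar>imbalance l\<bar> / n \<le> n powr (- \<delta>)" .
      moreover have "1 / Q \<le> 1 / sqrt n" using Qn n Q by (intro divide_left_mono) auto
      ultimately show ?thesis by (simp add: \<rho>_def)
    qed
    then have "\<rho> * s\<^sup>2 \<le> (2 * n powr (- \<delta>) + 4 / n + 1 / sqrt n) * s\<^sup>2" by (intro mult_right_mono) auto
    then have \<rho>s: "\<rho> * s\<^sup>2 \<le> 1 / 5000" using small by linarith
    have "\<rho> * 1 \<le> \<rho> * s\<^sup>2" using \<rho>0 \<open>1000\<^sup>2 \<le> s\<^sup>2\<close> by (intro mult_left_mono) auto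
    then have \<rho>1: "\<rho> \<le> 1" using \<rho>s by linarith
    have "next_mean barrier l = fd.mean (\<lambda>v. sqrt (ln (1 + 4 * (n + 1) * s' / (k\<^sup>2 + D v)) / s'))"
      unfolding next_mean_eq[OF ne l]
      using D(2) by (intro fd.mean_cong) (simp add: barrier_def n_def s'_def Qk[symmetric] D_def add.commute)
    also have "\<dots> \<le> sqrt (ln (1 + 4 * n * s / k\<^sup>2) / s)"
    proof (rule fd.transience_drift)
      have "1 * Q \<le> (2 * a) * Q" using a Q by (intro mult_right_mono) auto
      then have "Q / n \<le> 2 * a * Q / n" using n by (intro divide_right_mono) auto
      then show "k\<^sup>2 / n + 1 \<le> fd.mean D" unfolding m1 Qk[symmetric] by simp
      show "fd.mean (\<lambda>v. (D v)\<^sup>2) \<le> k\<^sup>2 * (2 + \<rho>)"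
        using m2 unfolding Qk[symmetric] by (simp add: algebra_simps)
      have "\<rho> * Q \<le> 1 * Q" using \<rho>1 Q by (intro mult_right_mono) auto
      then show "k\<^sup>2 \<le> fd.mean (\<lambda>v. (D v)\<^sup>2)"
        using m2 unfolding Qk[symmetric] by linarith
    qed (use s_def s'_def s ks kn D \<rho>0 \<rho>s in auto)
    also have "\<dots> = barrier l"
    proof -
      have "1 \<le> Q" using Qn n by (smt (verit) real_sqrt_ge_one)
      then show ?thesis by (simp add: barrier_def n_def s_def Qk[symmetric] Q_def max_absorb2)
    qed
    finally show "next_mean barrier l \<le> barrier l" .
  qed
qed

lemma barrier_nonneg: "1 \<le> length l \<Longrightarrow> 0 \<le> barrier l"
  unfolding barrier_def
  by (intro real_sqrt_ge_zero divide_nonneg_nonneg ln_ge_zero) auto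

text \<open>Every path that keeps visiting \<open>x\<close> falls into one of three events of
  probability at most \<open>e / 3\<close>: the balance fails after \<open>m\<close>; Q stays below
  n throughout \<open>{m..K}\<close>; or, after the first time \<open>t\<close> in
  \<open>{m..K}\<close> with \<open>Q \<ge> t\<close>, where the barrier is tiny, the path enters
  the ball \<open>Q \<le> sqrt n\<close>, where the barrier is at least \<open>c\<close>.
  \<open>K\<close> is chosen after \<open>m\<close> because the bound in \<open>spread\<close> grows
  with \<open>m\<close>.\<close>

lemma prob_visits_infinitely_often:
  assumes a: "1/2 \<le> a" "a < 1"
  shows "\<P>(\<omega> in M. \<forall>k. \<exists>n\<ge>k. sum_list (X n \<omega>) = x) = 0"
proof (rule measure_eq_0I)
  fix e :: real assume e: "e > 0"
  define G where "G l \<longleftrightarrow> balanced ((1 - a) / 8) l \<and> sqrt (length l) < sqdist l" for l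
  define c where "c = sqrt (1 / 2)"
  define r where "r = (real_of_int (x $ 1))\<^sup>2 + (real_of_int (x $ 2))\<^sup>2"
  obtain n0 where n0: "\<And>l. \<lbrakk>n0 \<le> length l; set l \<subseteq> steps; G l\<rbrakk> \<Longrightarrow> next_mean barrier l \<le> barrier l"
    using barrier_drift[OF a] unfolding G_def by metis
  have c: "c > 0" by (simp add: c_def)
  have "((\<lambda>t. sqrt (ln (1 + 4 * ln (real t)) / ln t)) \<longlongrightarrow> 0) sequentially" by real_asymp
  then have ev1: "\<forall>\<^sub>F t in sequentially. sqrt (ln (1 + 4 * ln (real t)) / ln t) < c * e / 3"
    using e c by (intro order_tendstoD) auto
  have ev2: "\<forall>\<^sub>F m in sequentially. \<P>(\<omega> in M. \<exists>n\<ge>m. \<not> balanced ((1 - a) / 8) (X n \<omega>)) < e / 3"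
    using imbalance_control_LIMSEQ[OF a(2)] e by (intro order_tendstoD) auto
  obtain t0 where t0: "\<And>t. t \<ge> t0 \<Longrightarrow> sqrt (ln (1 + 4 * ln (real t)) / ln t) < c * e / 3"
    using ev1 unfolding eventually_sequentially by blast
  obtain m0 where m0: "\<And>m. m \<ge> m0 \<Longrightarrow> \<P>(\<omega> in M. \<exists>n\<ge>m. \<not> balanced ((1 - a) / 8) (X n \<omega>)) < e / 3"
    using ev2 unfolding eventually_sequentially by blast
  define m where "m = max (max t0 m0) (max n0 3)"
  have m: "m \<ge> t0" "m \<ge> m0" "m \<ge> n0" "m \<ge> 3" by (auto simp: m_def)
  have "((\<lambda>N. (8 + ln (real m)) / ln (real N)) \<longlongrightarrow> 0) sequentially" by real_asymp
  then have "\<forall>\<^sub>F N in sequentially. (8 + ln (real m)) / ln (real N) < e / 3"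
    using e by (intro order_tendstoD) auto
  then obtain N0 where N0: "\<And>N. N \<ge> N0 \<Longrightarrow> (8 + ln (real m)) / ln (real N) < e / 3"
    unfolding eventually_sequentially by blast
  define K where "K = max N0 m"
  have K: "K \<ge> m" "(8 + ln (real m)) / ln (real K) < e / 3" using N0[of K] by (auto simp: K_def)
  define I where "I t = {l. length l = t \<and> real t \<le> sqdist l \<and> (\<forall>j\<in>{m..<t}. sqdist (take j l) < j)}" for t
  define V where "V t = {\<omega>\<in>space M. X t \<omega> \<in> I t \<and>
    (\<exists>n\<ge>t. (\<forall>j\<in>{t..<n}. G (X j \<omega>)) \<and> barrier (X n \<omega>) \<ge> c)}" for t
  have V_le: "measure M (V t) \<le> (e / 3) * \<P>(\<omega> in M. X t \<omega> \<in> I t)" if t: "t \<ge> m" for t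
  proof -
    have "measure M (V t) \<le> (\<Sum>l\<in>paths t \<inter> I t. weight t l * barrier l) / c"
      unfolding V_def
    proof (rule maximal_inequality)
      show "0 \<le> barrier l" if "l \<in> paths t" for l
        using that t m by (intro barrier_nonneg) (auto simp: paths_def)
      show "0 \<le> barrier (l @ [v])" for l v by (rule barrier_nonneg) simp
      show "next_mean barrier l \<le> barrier l" if "t \<le> length l" "set l \<subseteq> steps" "G l" for l
        using that t m by (intro n0) auto
    qed (use t m c in auto)
    also have "(\<Sum>l\<in>paths t \<inter> I t. weight t l * barrier l) \<le> (\<Sum>l\<in>paths t \<inter> I t. weight t l * (c * e / 3))"
    proof (intro sum_mono mult_left_mono weight_nonneg)
      fix l assume "l \<in> paths t \<inter> I t"
      then have l: "length l = t" "real t \<le> sqdist l" by (auto simp: I_def)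
      have t3: "real t \<ge> 3" using t m by simp
      have lt: "0 < ln (real t)" using t3 by simp
      have "4 * real t * ln t / max 1 (sqdist l) \<le> 4 * real t * ln t / t"
        using l t3 lt by (intro divide_left_mono) auto
      also have "\<dots> = 4 * ln t" using t3 by simp
      finally have 1: "4 * real t * ln t / max 1 (sqdist l) \<le> 4 * ln t" .
      have "0 \<le> 4 * real t * ln t / max 1 (sqdist l)" using t3 lt by (intro divide_nonneg_nonneg) auto
      then have "ln (1 + 4 * real t * ln t / max 1 (sqdist l)) \<le> ln (1 + 4 * ln (real t))"
        using 1 by (intro ln_mono) auto
      then have "barrier l \<le> sqrt (ln (1 + 4 * ln (real t)) / ln t)"
        unfolding barrier_def l(1) using lt by (intro real_sqrt_le_mono divide_right_mono) auto
      then show "barrier l \<le> c * e / 3" using t0[of t] t m by simp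
    qed
    also have "\<dots> / c = (e / 3) * \<P>(\<omega> in M. X t \<omega> \<in> I t)"
    proof -
      have "(\<Sum>l\<in>paths t \<inter> I t. weight t l * (c * e / 3)) = \<P>(\<omega> in M. X t \<omega> \<in> I t) * (c * e / 3)"
        using t m by (subst prob_X_eq_sum) (auto simp only: sum_distrib_right)
      then show ?thesis using c by simp
    qed
    finally show ?thesis using c by (simp add: divide_right_mono)
  qed
  have V_sum: "measure M (\<Union>t\<in>{m..K}. V t) \<le> e / 3"
  proof -
    have "measure M (\<Union>t\<in>{m..K}. V t) \<le> (\<Sum>t\<in>{m..K}. measure M (V t))"
      by (rule finite_measure_subadditive_finite) (auto simp: V_def)
    also have "\<dots> \<le> (\<Sum>t\<in>{m..K}. (e / 3) * \<P>(\<omega> in M. X t \<omega> \<in> I t))"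
      by (intro sum_mono V_le) auto
    also have "\<dots> = (e / 3) * (\<Sum>t\<in>{m..K}. \<P>(\<omega> in M. X t \<omega> \<in> I t))" by (simp add: sum_distrib_left)
    \<comment> \<open>\<open>I t\<close> says that \<open>t\<close> is the first time from
      \<open>m\<close> on with \<open>Q \<ge> t\<close>. These events are disjoint, so summing over
      \<open>t\<close> costs no factor.\<close>
    also have "(\<Sum>t\<in>{m..K}. \<P>(\<omega> in M. X t \<omega> \<in> I t)) = measure M (\<Union>t\<in>{m..K}. {\<omega>\<in>space M. X t \<omega> \<in> I t})"
    proof (rule finite_measure_finite_Union[symmetric])
      have disj: "\<not> (X s \<omega> \<in> I s \<and> X t \<omega> \<in> I t)" if "s < t" "s \<in> {m..K}" for s t \<omega>
      proof
        assume *: "X s \<omega> \<in> I s \<and> X t \<omega> \<in> I t"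
        then have "sqdist (take s (X t \<omega>)) < s" using that by (auto simp: I_def)
        then show False using * that by (simp add: take_X I_def)
      qed
      show "disjoint_family_on (\<lambda>t. {\<omega>\<in>space M. X t \<omega> \<in> I t}) {m..K}"
        unfolding disjoint_family_on_def
      proof (intro ballI impI)
        fix s t assume "s \<in> {m..K}" "t \<in> {m..K}" "s \<noteq> t"
        then show "{\<omega>\<in>space M. X s \<omega> \<in> I s} \<inter> {\<omega>\<in>space M. X t \<omega> \<in> I t} = {}"
          using disj[of s t] disj[of t s] by (cases "s < t") auto
      qed
    qed auto
    also have "(e / 3) * \<dots> \<le> (e / 3) * 1" using e by (intro mult_left_mono) auto
    finally show ?thesis by simp
  qed
  define B where "B = {\<omega>\<in>space M. \<exists>n\<ge>m. \<not> balanced ((1 - a) / 8) (X n \<omega>)}"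
  define U where "U = {\<omega>\<in>space M. \<forall>n\<in>{m..K}. sqdist (X n \<omega>) < n}"
  have "{\<omega>\<in>space M. \<forall>k. \<exists>n\<ge>k. sum_list (X n \<omega>) = x} \<subseteq> B \<union> U \<union> (\<Union>t\<in>{m..K}. V t)"
  proof
    fix \<omega> assume \<omega>: "\<omega> \<in> {\<omega>\<in>space M. \<forall>k. \<exists>n\<ge>k. sum_list (X n \<omega>) = x}"
    show "\<omega> \<in> B \<union> U \<union> (\<Union>t\<in>{m..K}. V t)"
    proof (rule ccontr)
      assume neg: "\<omega> \<notin> B \<union> U \<union> (\<Union>t\<in>{m..K}. V t)"
      then obtain t1 where t1: "t1 \<in> {m..K}" "sqdist (X t1 \<omega>) \<ge> t1" using \<omega> by (auto simp: U_def not_less)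
      define t where "t = (LEAST t. t \<ge> m \<and> sqdist (X t \<omega>) \<ge> t)"
      have t: "t \<ge> m" "sqdist (X t \<omega>) \<ge> t"
        unfolding t_def using LeastI[of "\<lambda>t. t \<ge> m \<and> sqdist (X t \<omega>) \<ge> t" t1] t1 by auto
      have "t \<le> t1" unfolding t_def using t1 by (intro Least_le) auto
      then have tK: "t \<in> {m..K}" using t t1 by auto
      have before: "sqdist (X j \<omega>) < j" if "j \<in> {m..<t}" for j
        using not_less_Least[of j "\<lambda>t. t \<ge> m \<and> sqdist (X t \<omega>) \<ge> t"] that unfolding t_def by auto
      have It: "X t \<omega> \<in> I t" using t before by (auto simp: I_def take_X)
      \<comment> \<open>From time \<open>r\<^sup>2\<close> on, the ball
        \<open>Q \<le> sqrt n\<close> contains \<open>x\<close>, so a late visit to \<open>x\<close>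
        is a return to the ball.\<close>
      obtain n1 where n1: "n1 \<ge> max t (nat \<lceil>r\<^sup>2\<rceil>)" "sum_list (X n1 \<omega>) = x" using \<omega> by blast
      have "r\<^sup>2 \<le> real n1" using n1(1) by linarith
      then have "sqrt (r\<^sup>2) \<le> sqrt (real n1)" by (rule real_sqrt_le_mono)
      moreover have "sqdist (X n1 \<omega>) = r" using n1(2) by (simp add: sqdist_def r_def)
      moreover have "0 \<le> r" by (simp add: r_def)
      ultimately have n1': "n1 \<ge> t" "sqdist (X n1 \<omega>) \<le> sqrt n1" using n1(1) by auto
      define n where "n = (LEAST n. n \<ge> t \<and> sqdist (X n \<omega>) \<le> sqrt n)"
      have n: "n \<ge> t" "sqdist (X n \<omega>) \<le> sqrt n"
        unfolding n_def using LeastI[of "\<lambda>n. n \<ge> t \<and> sqdist (X n \<omega>) \<le> sqrt n" n1] n1' by auto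
      have "sqrt j < sqdist (X j \<omega>)" if "j \<in> {t..<n}" for j
        using not_less_Least[of j "\<lambda>n. n \<ge> t \<and> sqdist (X n \<omega>) \<le> sqrt n"] that unfolding n_def by auto
      moreover have "balanced ((1 - a) / 8) (X j \<omega>)" if "j \<ge> m" for j using neg \<omega> that by (auto simp: B_def)
      ultimately have good: "\<forall>j\<in>{t..<n}. G (X j \<omega>)" using t by (auto simp: G_def)
      have n3: "real n \<ge> 3" using n t m by simp
      have "exp 1 \<le> real n" using exp_le n3 by linarith
      then have ln: "1 \<le> ln (real n)" using n3 by (subst ln_ge_iff) auto
      \<comment> \<open>In the ball the quotient \<open>4 n ln n / Q\<close> is at least
        \<open>sqrt n\<close>, whose logarithm is half of \<open>ln n\<close>; hence
        \<open>c = sqrt (1 / 2)\<close>.\<close>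
      have "c \<le> barrier (X n \<omega>)"
      proof -
        have "1 \<le> sqrt (real n)" using n3 by simp
        then have mx: "max 1 (sqdist (X n \<omega>)) \<le> sqrt n" using n by simp
        have "sqrt n * 1 \<le> sqrt n * (4 * ln n)" using ln by (intro mult_left_mono) auto
        also have "\<dots> = 4 * real n * ln n / sqrt n"
          using n3 by (simp add: field_simps)
        also have "\<dots> \<le> 4 * real n * ln n / max 1 (sqdist (X n \<omega>))"
          using mx n3 ln by (intro divide_left_mono mult_nonneg_nonneg mult_pos_pos) auto
        finally have "sqrt n \<le> 1 + 4 * real n * ln n / max 1 (sqdist (X n \<omega>))" by simp
        then have "ln (sqrt n) \<le> ln (1 + 4 * real n * ln n / max 1 (sqdist (X n \<omega>)))"
          using n3 by (intro ln_mono) (auto intro: add_pos_nonneg)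
        moreover have "ln (sqrt n) = ln n / 2" using n3 by (simp add: ln_sqrt)
        ultimately have "1 / 2 \<le> ln (1 + 4 * real n * ln n / max 1 (sqdist (X n \<omega>))) / ln n"
          using ln by (simp add: field_simps)
        then show ?thesis unfolding c_def barrier_def by simp
      qed
      then have "\<omega> \<in> V t" using It good n \<omega> by (auto simp: V_def)
      then show False using neg tK by blast
    qed
  qed
  then have "\<P>(\<omega> in M. \<forall>k. \<exists>n\<ge>k. sum_list (X n \<omega>) = x) \<le> measure M (B \<union> U \<union> (\<Union>t\<in>{m..K}. V t))"
    by (intro finite_measure_mono) (auto simp: B_def U_def V_def)
  also have "\<dots> \<le> measure M (B \<union> U) + measure M (\<Union>t\<in>{m..K}. V t)"
    by (intro measure_Un_le) (auto simp: B_def U_def V_def)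
  also have "measure M (B \<union> U) \<le> measure M B + measure M U"
    by (intro measure_Un_le) (auto simp: B_def U_def)
  also have "measure M B < e / 3" using m0[of m] m by (simp add: B_def)
  also have "measure M U \<le> e / 3"
  proof -
    have "measure M U \<le> (8 + ln (real m)) / ln (real K)"
      unfolding U_def using m K by (intro spread[OF a(1)]) auto
    then show ?thesis using K(2) by linarith
  qed
  finally show "\<P>(\<omega> in M. \<forall>k. \<exists>n\<ge>k. sum_list (X n \<omega>) = x) \<le> e" using V_sum by linarith
qed

text \<open>The case \<open>a = 1\<close> is set apart because the imbalance is then almost surely
  n, so the steps never become balanced.\<close>

lemma straight_line:
  assumes "a = 1" "n \<ge> 1"
  shows "weight n (replicate n e1) = 1"
  using assms(2)
proof (induction n rule: nat_induct_at_least)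
  case base
  have "AE \<omega> in M. X 1 \<omega> = [e1]" using first_step by (rule AE_mp) (auto simp: X_def)
  then show ?case unfolding weight_def by (subst prob_Collect_eq_1) auto
next
  case (Suc n)
  have e1_step: "e1 \<in> steps" by (simp add: steps_2)
  have "count_list (replicate n e1) e1 = n" by (induction n) auto
  then have "step_prob a (replicate n e1) e1 = 1" using Suc.hyps assms by (simp add: step_prob_def)
  moreover have "replicate n e1 \<in> paths n" by (auto simp: paths_def e1_step)
  moreover have "replicate n e1 @ [e1] = replicate (Suc n) e1" by (simp add: replicate_append_same)
  ultimately show ?case using weight_snoc[of n "replicate n e1" e1] Suc e1_step by simp
qed

lemma transient_walk:
  assumes "1/2 \<le> a"
  shows "transient M S"
  unfolding transient_def
proof
  fix x :: "int ^ 2"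
  have "AE \<omega> in M. \<not> (\<forall>k. \<exists>n\<ge>k. sum_list (X n \<omega>) = x)"
  proof (cases "a < 1")
    case True
    then show ?thesis
      using prob_visits_infinitely_often[OF assms, of x] by (subst (asm) prob_Collect_eq_0) auto
  next
    case False
    then have a1: "a = 1" using a_bounds by simp
    have "AE \<omega> in M. X n \<omega> = replicate n e1" if "n \<ge> 1" for n
      using straight_line[OF a1 that] unfolding weight_def by (subst (asm) prob_Collect_eq_1) auto
    then have "AE \<omega> in M. \<forall>n\<in>{1..}. X n \<omega> = replicate n e1" by (intro AE_ball_countable') auto
    then show ?thesis
    proof (rule AE_mp, intro AE_I2 impI notI)
      fix \<omega> assume line: "\<forall>n\<in>{1..}. X n \<omega> = replicate n e1" and "\<forall>k. \<exists>n\<ge>k. sum_list (X n \<omega>) = x"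
      then obtain n where n: "n \<ge> max 1 (nat (x $ 1 + 1))" "sum_list (X n \<omega>) = x" by blast
      have "sum_list (replicate n e1) $ 1 = int n" by (induction n) (auto simp: axis_component)
      moreover have "X n \<omega> = replicate n e1" using line n by auto
      ultimately show False using n by auto
    qed
  qed
  then have "AE \<omega> in M. finite {n. S n \<omega> = x}"
  proof (rule AE_mp, intro AE_I2 impI)
    fix \<omega> assume \<omega>: "\<omega> \<in> space M" "\<not> (\<forall>k. \<exists>n\<ge>k. sum_list (X n \<omega>) = x)"
    then obtain k where "\<forall>n\<ge>k. S n \<omega> \<noteq> x" by (auto simp: walk_eq)
    then have "{n. S n \<omega> = x} \<subseteq> {..<k}" by (auto simp: not_le[symmetric])
    then show "finite {n. S n \<omega> = x}" by (rule finite_subset) simp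
  qed
  moreover have "{\<omega>\<in>space M. finite {n. S n \<omega> = x}} \<in> events"
  proof -
    have "{\<omega>\<in>space M. finite {n. S n \<omega> = x}} = {\<omega>\<in>space M. \<exists>k. \<forall>n\<ge>k. sum_list (X n \<omega>) \<noteq> x}"
    proof (intro Collect_cong conj_cong refl)
      fix \<omega> assume "\<omega> \<in> space M"
      then show "finite {n. S n \<omega> = x} \<longleftrightarrow> (\<exists>k. \<forall>n\<ge>k. sum_list (X n \<omega>) \<noteq> x)"
        unfolding finite_nat_set_iff_bounded by (auto simp: walk_eq) (meson not_le)+
    qed
    then show ?thesis by simp
  qed
  ultimately show "\<P>(\<omega> in M. finite {n. S n \<omega> = x}) = 1" by (subst prob_Collect_eq_1) auto
qed

end

section \<open>Recurrence\<close>

text \<open>One function \<open>h\<close> of one variable controls both ranges. For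
  \<open>Q \<le> n\<close> the errors are at most \<open>h Q\<close>, which is below
  \<open>1 / (16 (ln Q)^2)\<close>. For \<open>Q > n\<close> they are at most \<open>h n\<close>,
  which is below \<open>\<alpha> / 16\<close>, and \<open>n < Q\<close> does the rest. The
  coefficient 14 is the sum of the 10 and the 4 in front of \<open>1 / n\<close> and
  \<open>1 / Q\<close>.\<close>

lemma recurrence_thresholds:
  fixes \<alpha> \<delta> :: real
  assumes "0 < \<alpha>" "0 < \<delta>"
  obtains R where "10000 \<le> R"
    and "\<And>n Q \<rho>. \<lbrakk>R \<le> n; R \<le> Q; 0 \<le> \<rho>; \<rho> \<le> 2 * n powr (- \<delta>) + 4 / n + 1 / Q\<rbrakk> \<Longrightarrow>
      \<rho> \<le> 1 \<and> 1 / ln Q + 1 / n \<le> \<alpha> / 16 \<and> 8 / \<alpha> \<le> ln n \<and>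
      n * (2 * (\<rho> + 1 / Q + 1 / n) + 86 / sqrt Q - 1 / (16 * (ln Q)\<^sup>2)) \<le> \<alpha> / 16 * Q"
proof -
  define h where "h x = 4 * x powr (- \<delta>) + 14 / x + 86 / sqrt x" for x :: real
  have "((\<lambda>x::real. x powr (- \<delta>) * (ln x)\<^sup>2) \<longlongrightarrow> 0) at_top" using assms by real_asymp
  moreover have "((\<lambda>x::real. (14 / x + 86 / sqrt x) * (ln x)\<^sup>2) \<longlongrightarrow> 0) at_top" by real_asymp
  ultimately have "((\<lambda>x::real. 4 * (x powr (- \<delta>) * (ln x)\<^sup>2) + (14 / x + 86 / sqrt x) * (ln x)\<^sup>2) \<longlongrightarrow> 4 * 0 + 0) at_top"
    by (intro tendsto_add tendsto_mult tendsto_const)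
  then have "((\<lambda>x. h x * (ln x)\<^sup>2) \<longlongrightarrow> 0) at_top" by (simp add: h_def algebra_simps)
  then have 1: "\<forall>\<^sub>F x in at_top. h x * (ln x)\<^sup>2 < 1 / 16" by (rule order_tendstoD) simp
  have "((\<lambda>x::real. x powr (- \<delta>)) \<longlongrightarrow> 0) at_top" using assms by real_asymp
  moreover have "((\<lambda>x::real. 14 / x + 86 / sqrt x) \<longlongrightarrow> 0) at_top" by real_asymp
  ultimately have "((\<lambda>x::real. 4 * x powr (- \<delta>) + (14 / x + 86 / sqrt x)) \<longlongrightarrow> 4 * 0 + 0) at_top"
    by (intro tendsto_add tendsto_mult tendsto_const)
  then have "(h \<longlongrightarrow> 0) at_top" by (simp add: h_def[abs_def] algebra_simps)
  then have 2: "\<forall>\<^sub>F x in at_top. h x < min (1 / 2) (\<alpha> / 16)"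
    using assms by (intro order_tendstoD) auto
  have 3: "\<forall>\<^sub>F x::real in at_top. 1 / ln x < \<alpha> / 32"
  proof (rule order_tendstoD)
    show "((\<lambda>x::real. 1 / ln x) \<longlongrightarrow> 0) at_top" by real_asymp
  qed (use assms in auto)
  have 4: "\<forall>\<^sub>F x::real in at_top. 1 / x < \<alpha> / 32"
  proof (rule order_tendstoD)
    show "((\<lambda>x::real. 1 / x) \<longlongrightarrow> 0) at_top" by real_asymp
  qed (use assms in auto)
  have 5: "\<forall>\<^sub>F x::real in at_top. 8 / \<alpha> \<le> ln x"
    using ln_at_top unfolding filterlim_at_top by blast
  from eventually_conj[OF 1 eventually_conj[OF 2 eventually_conj[OF 3 eventually_conj[OF 4 5]]]]
  obtain b where b: "\<And>x. b \<le> x \<Longrightarrow> h x * (ln x)\<^sup>2 < 1 / 16 \<and> h x < min (1 / 2) (\<alpha> / 16) \<and>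
      1 / ln x < \<alpha> / 32 \<and> 1 / x < \<alpha> / 32 \<and> 8 / \<alpha> \<le> ln x"
    by (auto simp: eventually_at_top_linorder)
  show thesis
  proof
    show "10000 \<le> max b 10000" by simp
    fix n Q \<rho> :: real
    assume n: "max b 10000 \<le> n" and Q: "max b 10000 \<le> Q" and \<rho>: "0 \<le> \<rho>" "\<rho> \<le> 2 * n powr (- \<delta>) + 4 / n + 1 / Q"
    have pos: "10000 \<le> n" "10000 \<le> Q" using n Q by auto
    have bn: "h n < 1 / 2" "h n < \<alpha> / 16" "1 / n < \<alpha> / 32" "8 / \<alpha> \<le> ln n" using b[of n] n by auto
    have bQ: "h Q * (ln Q)\<^sup>2 < 1 / 16" "h Q < 1 / 2" "1 / ln Q < \<alpha> / 32" using b[of Q] Q by auto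
    have hn: "h n = 4 * n powr (- \<delta>) + 14 * (1 / n) + 86 / sqrt n"
      and hQ: "h Q = 4 * Q powr (- \<delta>) + 14 * (1 / Q) + 86 / sqrt Q" by (simp_all add: h_def)
    have nn: "0 \<le> n powr (- \<delta>)" "0 \<le> 1 / n" "0 \<le> 86 / sqrt n" "0 \<le> Q powr (- \<delta>)" "0 \<le> 1 / Q" "0 \<le> 86 / sqrt Q"
      using pos by auto
    have \<rho>': "\<rho> \<le> 2 * n powr (- \<delta>) + 4 * (1 / n) + 1 / Q" using \<rho>(2) by simp
    have "\<rho> \<le> 1" using \<rho>' nn bn bQ hn hQ by linarith
    moreover have "1 / ln Q + 1 / n \<le> \<alpha> / 16" using bn bQ by linarith
    moreover have "n * (2 * (\<rho> + 1 / Q + 1 / n) + 86 / sqrt Q - 1 / (16 * (ln Q)\<^sup>2)) \<le> \<alpha> / 16 * Q"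
    proof -
      define t where "t = 2 * (\<rho> + 1 / Q + 1 / n) + 86 / sqrt Q"
      have t: "t \<le> 4 * n powr (- \<delta>) + 10 * (1 / n) + 4 * (1 / Q) + 86 / sqrt Q"
        using \<rho>' unfolding t_def distrib_left by linarith
      have "exp 1 \<le> Q" using exp_le pos by linarith
      then have ln: "1 \<le> ln Q" using pos by (subst ln_ge_iff) auto
      show ?thesis
      proof (cases "Q \<le> n")
        case True
        have "n powr (- \<delta>) \<le> Q powr (- \<delta>)" using True pos assms by (intro powr_mono2') auto
        moreover have "1 / n \<le> 1 / Q" using True pos by (intro divide_left_mono) auto
        ultimately have "t \<le> h Q" using t hQ by linarith
        also have "h Q \<le> 1 / (16 * (ln Q)\<^sup>2)"
          using bQ(1) ln by (simp add: field_simps)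
        finally have "t - 1 / (16 * (ln Q)\<^sup>2) \<le> 0" by simp
        then have "n * (t - 1 / (16 * (ln Q)\<^sup>2)) \<le> 0" using pos by (intro mult_nonneg_nonpos) auto
        also have "0 \<le> \<alpha> / 16 * Q" using assms pos by simp
        finally show ?thesis by (simp add: t_def)
      next
        case False
        have "86 / sqrt Q \<le> 86 / sqrt n" using False pos by (intro divide_left_mono) auto
        moreover have "1 / Q \<le> 1 / n" using False pos by (intro divide_left_mono) auto
        ultimately have "t \<le> h n" using t hn by linarith
        moreover have "0 \<le> 1 / (16 * (ln Q)\<^sup>2)" by simp
        ultimately have "t - 1 / (16 * (ln Q)\<^sup>2) \<le> \<alpha> / 16" using bn by linarith
        then have "n * (t - 1 / (16 * (ln Q)\<^sup>2)) \<le> n * (\<alpha> / 16)" using pos by (intro mult_left_mono) auto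
        also have "\<dots> \<le> Q * (\<alpha> / 16)" using False assms by (intro mult_right_mono) auto
        finally show ?thesis by (simp add: t_def mult.commute)
      qed
    qed
    ultimately show "\<rho> \<le> 1 \<and> 1 / ln Q + 1 / n \<le> \<alpha> / 16 \<and> 8 / \<alpha> \<le> ln n \<and>
      n * (2 * (\<rho> + 1 / Q + 1 / n) + 86 / sqrt Q - 1 / (16 * (ln Q)\<^sup>2)) \<le> \<alpha> / 16 * Q"
      using bn by blast
  qed
qed

context planar_walk
begin

lemma potential_drift:
  assumes a: "a < 1/2"
  obtains R n0 where "10000 \<le> R"
    "\<And>l. \<lbrakk>n0 \<le> length l; set l \<subseteq> steps; balanced ((1 - a) / 8) l; R \<le> sqdist l\<rbrakk>
      \<Longrightarrow> next_mean (\<lambda>l. log_potential (16 / (1 - 2 * a)) (length l) (sqdist l)) l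
        \<le> log_potential (16 / (1 - 2 * a)) (length l) (sqdist l)"
proof -
  define \<delta> where "\<delta> = (1 - a) / 8"
  define \<alpha> where "\<alpha> = 1 - 2 * a"
  have "0 < \<delta>" "0 < \<alpha>" using a by (simp_all add: \<delta>_def \<alpha>_def)
  then obtain R where R: "10000 \<le> R"
    and th: "\<And>n Q \<rho>. \<lbrakk>R \<le> n; R \<le> Q; 0 \<le> \<rho>; \<rho> \<le> 2 * n powr (- \<delta>) + 4 / n + 1 / Q\<rbrakk> \<Longrightarrow>
      \<rho> \<le> 1 \<and> 1 / ln Q + 1 / n \<le> \<alpha> / 16 \<and> 8 / \<alpha> \<le> ln n \<and>
      n * (2 * (\<rho> + 1 / Q + 1 / n) + 86 / sqrt Q - 1 / (16 * (ln Q)\<^sup>2)) \<le> \<alpha> / 16 * Q"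
    using recurrence_thresholds by metis
  show thesis
  proof
    show "10000 \<le> R" by (rule R)
    fix l :: "(int ^ 2) list"
    assume len: "nat \<lceil>R\<rceil> \<le> length l" and l: "set l \<subseteq> steps"
      and bal: "balanced ((1 - a) / 8) l" and far: "R \<le> sqdist l"
    define n where "n = real (length l)"
    define Q where "Q = sqdist l"
    define k where "k = sqrt Q"
    define \<rho> where "\<rho> = 2 * \<bar>imbalance l\<bar> / n + 4 / n + 1 / Q"
    define D where "D v = sqdist (l @ [v]) - Q" for v
    have n: "R \<le> n" using len R unfolding n_def by linarith
    have ne: "l \<noteq> []" using n R by (auto simp: n_def)
    have Q: "R \<le> Q" using far by (simp add: Q_def)
    have Qk: "Q = k\<^sup>2" using Q R by (simp add: k_def)
    have "sqrt (100\<^sup>2) \<le> k" unfolding k_def using Q R by (intro real_sqrt_le_mono) auto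
    then have k: "100 \<le> k" by simp
    have "Q \<le> n\<^sup>2" using sqdist_le[OF l] by (simp add: Q_def n_def)
    then have kn: "k \<le> n" unfolding k_def using n R by (intro real_le_lsqrt) auto
    have D: "\<bar>D v\<bar> \<le> 3 * k" if "v \<in> steps" for v
      using sqdist_increment_le[OF that, of l] k by (simp add: D_def k_def Q_def)
    interpret fd: finite_distribution "steps :: (int ^ 2) set" "step_prob a l"
      by (rule finite_distribution_step_prob[OF ne l a_bounds])
    have m1: "fd.mean D = 1 + 2 * a * Q / n"
      unfolding fd.mean_def D_def Q_def n_def by (rule mean_sqdist_increment[OF ne l])
    have "\<bar>fd.mean (\<lambda>v. (D v)\<^sup>2) - 2 * Q\<bar> \<le> (2 * \<bar>imbalance l\<bar> / n + 4 / n) * Q + 1"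
      unfolding fd.mean_def D_def Q_def n_def
      using mean_sqdist_increment_square[OF ne l, of a] a_bounds by simp
    also have "\<dots> = \<rho> * Q" using Q R by (simp add: \<rho>_def distrib_right)
    finally have m2: "\<bar>fd.mean (\<lambda>v. (D v)\<^sup>2) - 2 * Q\<bar> \<le> \<rho> * Q" .
    have \<rho>0: "0 \<le> \<rho>" using n Q R unfolding \<rho>_def by (intro add_nonneg_nonneg) auto
    have \<rho>: "\<rho> \<le> 2 * n powr (- \<delta>) + 4 / n + 1 / Q"
    proof -
      have "\<bar>imbalance l\<bar> / n \<le> n powr (1 - \<delta>) / n"
        using bal n R by (intro divide_right_mono) (auto simp: balanced_def n_def \<delta>_def)
      also have "\<dots> = n powr (- \<delta>)" using n R by (simp add: powr_diff powr_minus_divide)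
      finally show ?thesis by (simp add: \<rho>_def)
    qed
    note th = th[OF n Q \<rho>0 \<rho>]
    have "next_mean (\<lambda>l. log_potential (16 / (1 - 2 * a)) (length l) (sqdist l)) l
        = fd.mean (\<lambda>v. log_potential (16 / (1 - 2 * a)) (n + 1) (k\<^sup>2 + D v))"
      unfolding next_mean_eq[OF ne l]
      by (intro fd.mean_cong) (simp add: n_def Qk[symmetric] D_def add.commute)
    also have "\<dots> \<le> log_potential (16 / (1 - 2 * a)) n (k\<^sup>2)"
    proof (rule fd.recurrence_drift)
      show "-1/2 \<le> a" using a_bounds by simp
      show "n * (2 * (\<rho> + 1 / k\<^sup>2 + 1 / n) + 86 / k - 1 / (16 * (ln (k\<^sup>2))\<^sup>2)) \<le> (1 - 2 * a) / 16 * k\<^sup>2"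
        using th unfolding Qk[symmetric] by (simp add: k_def \<alpha>_def)
    qed (use a k kn D m1 m2 \<rho>0 th in \<open>auto simp: Qk[symmetric] \<alpha>_def\<close>)
    finally show "next_mean (\<lambda>l. log_potential (16 / (1 - 2 * a)) (length l) (sqdist l)) l
        \<le> log_potential (16 / (1 - 2 * a)) (length l) (sqdist l)"
      by (simp add: n_def Q_def Qk[symmetric])
  qed
qed

section \<open>Almost sure returns to a fixed ball\<close>

lemma AE_eventually_balanced:
  assumes "a < 1"
  shows "AE \<omega> in M. \<exists>m. \<forall>n\<ge>m. balanced ((1 - a) / 8) (X n \<omega>)"
proof -
  have "\<P>(\<omega> in M. \<forall>m. \<exists>n\<ge>m. \<not> balanced ((1 - a) / 8) (X n \<omega>)) \<le> 0"
    using imbalance_control_LIMSEQ[OF assms]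
  proof (rule LIMSEQ_le_const, intro exI allI impI)
    show "\<P>(\<omega> in M. \<forall>m. \<exists>n\<ge>m. \<not> balanced ((1 - a) / 8) (X n \<omega>))
      \<le> \<P>(\<omega> in M. \<exists>n\<ge>m. \<not> balanced ((1 - a) / 8) (X n \<omega>))" for m
      by (intro finite_measure_mono) auto
  qed
  then have "\<P>(\<omega> in M. \<forall>m. \<exists>n\<ge>m. \<not> balanced ((1 - a) / 8) (X n \<omega>)) = 0"
    by (simp only: measure_le_0_iff)
  then have "AE \<omega> in M. \<not> (\<forall>m. \<exists>n\<ge>m. \<not> balanced ((1 - a) / 8) (X n \<omega>))"
    by (subst (asm) prob_Collect_eq_0) auto
  then show ?thesis by simp
qed

lemma AE_not_if_bounded:
  assumes [measurable]: "{\<omega>\<in>space M. P \<omega>} \<in> events"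
    and le: "\<And>c. 0 < c \<Longrightarrow> \<P>(\<omega> in M. P \<omega>) \<le> C / c"
  shows "AE \<omega> in M. \<not> P \<omega>"
proof -
  have "\<P>(\<omega> in M. P \<omega>) = 0"
  proof (rule measure_eq_0I)
    fix e :: real assume e: "e > 0"
    have "\<P>(\<omega> in M. P \<omega>) \<le> C / ((\<bar>C\<bar> + 1) / e)" using e by (intro le) auto
    also have "\<dots> = e * (C / (\<bar>C\<bar> + 1))" by simp
    also have "\<dots> \<le> e * 1" using e by (intro mult_left_mono) (auto simp: divide_le_eq)
    finally show "\<P>(\<omega> in M. P \<omega>) \<le> e" by simp
  qed
  then show ?thesis by (subst (asm) prob_Collect_eq_0) auto
qed

text \<open>If the walk stayed balanced and outside the ball from time \<open>m\<close> on, the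
  potential would exceed every level, being at least \<open>ln (ln n)\<close>. The maximal
  inequality bounds the probability of this by a constant that depends only on \<open>m\<close>,
  divided by the level.\<close>

lemma AE_returns_to_ball:
  assumes a: "a < 1/2"
  obtains R where "AE \<omega> in M. \<forall>m. \<exists>n\<ge>m. sqdist (X n \<omega>) < R"
proof -
  define c where "c = 16 / (1 - 2 * a)"
  define F where "F = (\<lambda>l. log_potential c (length l) (sqdist l))"
  obtain R n0 where R: "10000 \<le> R"
    and *: "\<And>l. \<lbrakk>n0 \<le> length l; set l \<subseteq> steps; balanced ((1 - a) / 8) l; R \<le> sqdist l\<rbrakk>
      \<Longrightarrow> next_mean (\<lambda>l. log_potential (16 / (1 - 2 * a)) (length l) (sqdist l)) l
        \<le> log_potential (16 / (1 - 2 * a)) (length l) (sqdist l)"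
  proof (rule potential_drift[OF a])
    fix R n0
    assume "10000 \<le> R" and "\<And>l. \<lbrakk>n0 \<le> length l; set l \<subseteq> steps; balanced ((1 - a) / 8) l; R \<le> sqdist l\<rbrakk>
      \<Longrightarrow> next_mean (\<lambda>l. log_potential (16 / (1 - 2 * a)) (length l) (sqdist l)) l
        \<le> log_potential (16 / (1 - 2 * a)) (length l) (sqdist l)"
    then show thesis by (rule that)
  qed
  have drift: "next_mean F l \<le> F l"
    if "n0 \<le> length l" "set l \<subseteq> steps" "balanced ((1 - a) / 8) l" "R \<le> sqdist l" for l
    unfolding F_def c_def using that by (rule *)
  define G where "G l \<longleftrightarrow> balanced ((1 - a) / 8) l \<and> R \<le> sqdist l" for l
  have c: "0 \<le> c" using a by (simp add: c_def)
  have F_ge: "ln (ln (length l)) \<le> F l" if "3 \<le> length l" "3 \<le> sqdist l" for l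
    unfolding F_def using that c by (intro log_potential_ge) auto
  have lnln: "0 \<le> ln (ln (real n))" if "3 \<le> n" for n :: nat
  proof -
    have "exp 1 \<le> real n" using exp_le that by linarith
    then have "1 \<le> ln (real n)" using that by (subst ln_ge_iff) auto
    then show ?thesis by simp
  qed
  have F_nonneg: "0 \<le> F l" if "3 \<le> length l" "3 \<le> sqdist l" for l
    using F_ge[OF that] lnln[OF that(1)] by linarith
  have never: "AE \<omega> in M. \<not> (\<forall>n\<ge>m. G (X n \<omega>))" if m: "m \<ge> max n0 3" for m
  proof (rule AE_not_if_bounded)
    show "{\<omega>\<in>space M. \<forall>n\<ge>m. G (X n \<omega>)} \<in> events" by simp
    fix b :: real assume b: "0 < b"
    have "filterlim (\<lambda>n. ln (ln (real n))) at_top sequentially" by real_asymp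
    then have "\<forall>\<^sub>F n in sequentially. b \<le> ln (ln (real n))" unfolding filterlim_at_top by blast
    then obtain n1 where n1: "\<And>n. n \<ge> n1 \<Longrightarrow> b \<le> ln (ln (real n))" unfolding eventually_sequentially by blast
    have "\<P>(\<omega> in M. \<forall>n\<ge>m. G (X n \<omega>))
        \<le> \<P>(\<omega> in M. X m \<omega> \<in> {l. G l} \<and> (\<exists>n\<ge>m. (\<forall>j\<in>{m..<n}. G (X j \<omega>)) \<and> F (X n \<omega>) \<ge> b))"
    proof (rule finite_measure_mono)
      show "{\<omega>\<in>space M. \<forall>n\<ge>m. G (X n \<omega>)} \<subseteq>
        {\<omega>\<in>space M. X m \<omega> \<in> {l. G l} \<and> (\<exists>n\<ge>m. (\<forall>j\<in>{m..<n}. G (X j \<omega>)) \<and> F (X n \<omega>) \<ge> b)}"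
      proof
        fix \<omega> assume \<omega>: "\<omega> \<in> {\<omega>\<in>space M. \<forall>n\<ge>m. G (X n \<omega>)}"
        define n where "n = max m n1"
        have "b \<le> ln (ln (real n))" using n1[of n] by (simp add: n_def)
        also have "\<dots> \<le> F (X n \<omega>)"
        proof -
          have "G (X n \<omega>)" using \<omega> by (simp add: n_def)
          then have "3 \<le> sqdist (X n \<omega>)" using R by (simp add: G_def)
          moreover have "3 \<le> n" using m by (auto simp: n_def)
          ultimately show ?thesis using F_ge[of "X n \<omega>"] by simp
        qed
        finally have "F (X n \<omega>) \<ge> b" .
        moreover have "n \<ge> m" "\<omega> \<in> space M" "X m \<omega> \<in> {l. G l}" "\<forall>j\<in>{m..<n}. G (X j \<omega>)"
          using \<omega> by (auto simp: n_def)
        ultimately show "\<omega> \<in> {\<omega>\<in>space M. X m \<omega> \<in> {l. G l} \<and>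
            (\<exists>n\<ge>m. (\<forall>j\<in>{m..<n}. G (X j \<omega>)) \<and> F (X n \<omega>) \<ge> b)}"
          by blast
      qed
    qed auto
    also have "\<dots> \<le> (\<Sum>l\<in>paths m \<inter> {l. G l}. weight m l * F l) / b"
    proof (rule maximal_inequality)
      show "0 \<le> F l" if "l \<in> {l. G l}" "l \<in> paths m" for l
        using that m R by (intro F_nonneg) (auto simp: G_def paths_def)
      show "0 \<le> F (l @ [v])" if "m \<le> length l" "v \<in> steps" "G l" for l v
      proof (rule F_nonneg)
        define k where "k = sqrt (sqdist l)"
        have Q: "sqdist l = k * k" using sqdist_nonneg[of l] by (simp add: k_def)
        have "sqrt (100\<^sup>2) \<le> k" unfolding k_def using that R by (intro real_sqrt_le_mono) (auto simp: G_def)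
        then have k: "100 \<le> k" by simp
        then have "100 * k \<le> k * k" by (intro mult_right_mono) auto
        moreover have "\<bar>sqdist (l @ [v]) - sqdist l\<bar> \<le> 2 * k + 1"
          using sqdist_increment_le[OF that(2), of l] by (simp add: k_def)
        ultimately show "3 \<le> sqdist (l @ [v])" using k Q by linarith
      qed (use that m in auto)
      show "next_mean F l \<le> F l" if "m \<le> length l" "set l \<subseteq> steps" "G l" for l
        using that m by (intro drift) (auto simp: G_def)
    qed (use m b in auto)
    finally show "\<P>(\<omega> in M. \<forall>n\<ge>m. G (X n \<omega>)) \<le> (\<Sum>l\<in>paths m \<inter> {l. G l}. weight m l * F l) / b" .
  qed
  have "AE \<omega> in M. \<forall>m\<in>{max n0 3..}. \<not> (\<forall>n\<ge>m. G (X n \<omega>))"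
    using never by (intro AE_ball_countable') auto
  moreover have "AE \<omega> in M. \<exists>m. \<forall>n\<ge>m. balanced ((1 - a) / 8) (X n \<omega>)"
    using a by (intro AE_eventually_balanced) simp
  ultimately have "AE \<omega> in M. \<forall>m. \<exists>n\<ge>m. sqdist (X n \<omega>) < R"
  proof eventually_elim
    case (elim \<omega>)
    then obtain m1 where m1: "\<And>n. n \<ge> m1 \<Longrightarrow> balanced ((1 - a) / 8) (X n \<omega>)" by blast
    show ?case
    proof
      fix m
      have "max (max m m1) (max n0 3) \<in> {max n0 3..}" by simp
      then obtain n where "n \<ge> max (max m m1) (max n0 3)" "\<not> G (X n \<omega>)" using elim(1) by blast
      then show "\<exists>n\<ge>m. sqdist (X n \<omega>) < R" using m1[of n] by (auto simp: G_def not_le)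
    qed
  qed
  then show thesis by (rule that)
qed

section \<open>From one vertex visited infinitely often to all vertices\<close>

lemma step_prob_lower_bound:
  assumes a: "a < 1/2"
  obtains n0 where "\<And>l v. \<lbrakk>n0 \<le> length l; set l \<subseteq> steps; balanced ((1 - a) / 8) l; v \<in> steps\<rbrakk>
    \<Longrightarrow> 1 / 12 \<le> step_prob a l v"
proof -
  have "(1 - a) / 8 > 0" using a by simp
  then have "((\<lambda>x::real. x powr (- ((1 - a) / 8))) \<longlongrightarrow> 0) at_top" by real_asymp
  then have "\<forall>\<^sub>F x in at_top. x powr (- ((1 - a) / 8)) < 1 / 2" by (rule order_tendstoD) simp
  then obtain b where b: "\<And>x. b \<le> x \<Longrightarrow> x powr (- ((1 - a) / 8)) < 1 / 2"
    by (auto simp: eventually_at_top_linorder)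
  show thesis
  proof
    fix l :: "(int ^ 2) list" and v :: "int ^ 2"
    assume len: "nat \<lceil>max 1 b\<rceil> \<le> length l" and l: "set l \<subseteq> steps"
      and bal: "balanced ((1 - a) / 8) l" and v: "v \<in> steps"
    define n where "n = real (length l)"
    define f where "f = count_list l v / n"
    have n: "1 \<le> n" "b \<le> n" using len unfolding n_def by linarith+
    have sp: "step_prob a l v = (1 - a) / 4 + a * f" by (simp add: step_prob_def f_def n_def)
    have f0: "0 \<le> f" using n by (simp add: f_def)
    \<comment> \<open>For \<open>a \<ge> 0\<close> the uniform part alone gives more than 1/8. For
      \<open>a < 0\<close> frequent steps are disfavoured, but the balance caps each frequency at
      3/4, which leaves \<open>1/4 + a / 2\<close>, and \<open>a \<ge> - 1/3\<close> turns this into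
      1/12.\<close>
    show "1 / 12 \<le> step_prob a l v"
    proof (cases "0 \<le> a")
      case True
      then have "0 \<le> a * f" using f0 by simp
      then show ?thesis unfolding sp using a by argo
    next
      case False
      have "\<bar>imbalance l\<bar> \<le> n powr (1 - (1 - a) / 8)" using bal by (simp add: balanced_def n_def)
      also have "\<dots> = n * n powr (- ((1 - a) / 8))" using n by (simp add: powr_diff powr_minus_divide)
      also have "\<dots> \<le> n * (1 / 2)" using n b[of n] by (intro mult_left_mono) auto
      finally have "\<bar>imbalance l\<bar> \<le> n / 2" by simp
      then have "count_list l v \<le> 3 / 4 * n"
        using v counts(1)[OF l] unfolding steps_2 imbalance_def n_def abs_le_iff by auto
      then have "f \<le> 3 / 4" using n by (simp add: f_def field_simps)
      then have "a * (3 / 4) \<le> a * f" using False by (intro mult_left_mono_neg) auto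
      then show ?thesis unfolding sp using a_bounds by argo
    qed
  qed
qed

text \<open>As long as the walk has not reached \<open>y + v\<close>, each visit to \<open>y\<close> multiplies the potential by
  \<open>12/11\<close>, which compensates for the probability at least \<open>1/12\<close> of stepping to \<open>y + v\<close>.\<close>

lemma AE_neighbour_visited:
  assumes a: "a < 1/2" and v: "v \<in> steps"
  shows "AE \<omega> in M. (\<forall>k. \<exists>n\<ge>k. sum_list (X n \<omega>) = y) \<longrightarrow> (\<forall>k. \<exists>n\<ge>k. sum_list (X n \<omega>) = y + v)"
proof -
  obtain n0 where n0: "\<And>l v. \<lbrakk>n0 \<le> length l; set l \<subseteq> steps; balanced ((1 - a) / 8) l; v \<in> steps\<rbrakk>
    \<Longrightarrow> 1 / 12 \<le> step_prob a l v"
    using step_prob_lower_bound[OF a] by metis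
  define G where "G l \<longleftrightarrow> balanced ((1 - a) / 8) l" for l
  define P where "P m \<omega> \<longleftrightarrow> (\<forall>n\<ge>m. G (X n \<omega>)) \<and> (\<forall>k. \<exists>n\<ge>k. sum_list (X n \<omega>) = y)
    \<and> (\<forall>n>m. sum_list (X n \<omega>) \<noteq> y + v)" for m \<omega>
  have never: "AE \<omega> in M. \<not> P m \<omega>" if m: "m \<ge> max n0 1" for m
  proof (rule AE_not_if_bounded[where C = 1])
    show "{\<omega>\<in>space M. P m \<omega>} \<in> events" unfolding P_def by measurable
    fix c :: real assume c: "0 < c"
    \<comment> \<open>Only visits to \<open>y\<close> strictly before the current time count, so the
      factor 12/11 is applied in the very step that may reach \<open>y + v\<close> and set
      \<open>F\<close> to 0. Likewise \<open>hit\<close> looks at times after \<open>m\<close> only,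
      which makes \<open>F\<close> equal to 1 at the start.\<close>
    define J where "J l = {j\<in>{m..<length l}. sum_list (take j l) = y}" for l
    define hit where "hit l \<longleftrightarrow> (\<exists>j\<in>{m<..length l}. sum_list (take j l) = y + v)" for l
    define F where "F l = (if hit l then 0 else (12 / 11 :: real) ^ card (J l))" for l
    have finJ: "finite (J l)" for l by (simp add: J_def)
    have hit_snoc: "hit (l @ [u]) \<longleftrightarrow> hit l \<or> sum_list l + u = y + v" if "m \<le> length l" for l u
    proof -
      have "{m<..length (l @ [u])} = insert (Suc (length l)) {m<..length l}" using that by auto
      then show ?thesis unfolding hit_def by auto
    qed
    have J_snoc: "card (J (l @ [u])) = card (J l) + (if sum_list l = y then 1 else 0)" if "m \<le> length l" for l u
    proof -
      have "J (l @ [u]) = J l \<union> (if sum_list l = y then {length l} else {})"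
        using that by (auto simp: J_def less_Suc_eq split: if_splits)
      moreover have "length l \<notin> J l" by (simp add: J_def)
      ultimately show ?thesis using finJ by simp
    qed
    have drift: "next_mean F l \<le> F l" if l: "m \<le> length l" "set l \<subseteq> steps" "G l" for l
    proof -
      have ne: "l \<noteq> []" using l m by auto
      have sum1: "(\<Sum>u\<in>steps. step_prob a l u) = 1" by (rule step_prob_sum[OF ne l(2)])
      have q0: "0 \<le> step_prob a l u" for u using ne a_bounds by (intro step_prob_nonneg)
      show ?thesis
      proof (cases "hit l")
        case True
        then show ?thesis using l by (simp add: next_mean_def F_def hit_snoc)
      next
        case False
        define z where "z = (12 / 11 :: real) ^ card (J l)"
        have z: "0 < z" "F l = z" using False by (auto simp: z_def F_def)
        show ?thesis
        proof (cases "sum_list l = y")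
          case True
          have "next_mean F l = (\<Sum>u\<in>steps. step_prob a l u * (if u = v then 0 else z * (12 / 11)))"
            unfolding next_mean_def using l False True
            by (intro sum.cong refl) (auto simp: F_def hit_snoc J_snoc z_def)
          also have "\<dots> = (\<Sum>u\<in>steps. step_prob a l u * (z * (12 / 11)) - (if u = v then step_prob a l v * (z * (12 / 11)) else 0))"
            by (intro sum.cong refl) auto
          also have "\<dots> = z * (12 / 11) - step_prob a l v * (z * (12 / 11))"
            unfolding sum_subtractf sum_distrib_right[symmetric] sum1 using v finite_V by simp
          also have "\<dots> = z * (12 / 11) * (1 - step_prob a l v)" by (simp add: algebra_simps)
          also have "\<dots> \<le> z * (12 / 11) * (11 / 12)"
            using n0[of l v] l m v z by (intro mult_left_mono) (auto simp: G_def)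
          finally show ?thesis using z by simp
        next
          case neq: False
          have "next_mean F l \<le> (\<Sum>u\<in>steps. step_prob a l u * z)"
            unfolding next_mean_def using l False neq z q0
            by (intro sum_mono mult_left_mono) (auto simp: F_def hit_snoc J_snoc z_def)
          also have "\<dots> = z" unfolding sum_distrib_right[symmetric] sum1 by simp
          finally show ?thesis using z by simp
        qed
      qed
    qed
    have "\<P>(\<omega> in M. P m \<omega>)
        \<le> \<P>(\<omega> in M. X m \<omega> \<in> UNIV \<and> (\<exists>n\<ge>m. (\<forall>j\<in>{m..<n}. G (X j \<omega>)) \<and> F (X n \<omega>) \<ge> c))"
    proof (rule finite_measure_mono)
      show "{\<omega>\<in>space M. P m \<omega>} \<subseteq>
        {\<omega>\<in>space M. X m \<omega> \<in> UNIV \<and> (\<exists>n\<ge>m. (\<forall>j\<in>{m..<n}. G (X j \<omega>)) \<and> F (X n \<omega>) \<ge> c)}"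
      proof
        fix \<omega> assume \<omega>: "\<omega> \<in> {\<omega>\<in>space M. P m \<omega>}"
        define A where "A = {j. m \<le> j \<and> sum_list (X j \<omega>) = y}"
        have "infinite A"
          unfolding infinite_nat_iff_unbounded_le
        proof
          fix k
          obtain n where "n \<ge> max k m" "sum_list (X n \<omega>) = y" using \<omega> unfolding P_def by blast
          then show "\<exists>n\<ge>k. n \<in> A" by (auto simp: A_def)
        qed
        obtain d where d: "c < (12 / 11) ^ d" using real_arch_pow[of "12 / 11" c] by auto
        obtain B where B: "finite B" "card B = d" "B \<subseteq> A"
          using infinite_arbitrarily_large[OF \<open>infinite A\<close>] by blast
        obtain n1 where n1: "B \<subseteq> {..<n1}" using B(1) finite_nat_iff_bounded by blast
        define n where "n = max m n1"
        have "B \<subseteq> J (X n \<omega>)"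
        proof
          fix j assume "j \<in> B"
          then have "m \<le> j" "sum_list (X j \<omega>) = y" "j < n" using B n1 by (auto simp: A_def n_def)
          then show "j \<in> J (X n \<omega>)" by (simp add: J_def take_X)
        qed
        then have "d \<le> card (J (X n \<omega>))" using B finJ card_mono by blast
        then have "c \<le> (12 / 11) ^ card (J (X n \<omega>))"
          using d power_increasing[of d "card (J (X n \<omega>))" "12 / 11 :: real"] by linarith
        moreover have "\<not> hit (X n \<omega>)"
          using \<omega> unfolding hit_def P_def by (auto simp: take_X)
        ultimately have "F (X n \<omega>) \<ge> c" by (simp add: F_def)
        then show "\<omega> \<in> {\<omega>\<in>space M. X m \<omega> \<in> UNIV \<and>
            (\<exists>n\<ge>m. (\<forall>j\<in>{m..<n}. G (X j \<omega>)) \<and> F (X n \<omega>) \<ge> c)}"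
          using \<omega> by (auto simp: P_def n_def intro!: exI[of _ "max m n1"])
      qed
    qed auto
    also have "\<dots> \<le> (\<Sum>l\<in>paths m \<inter> UNIV. weight m l * F l) / c"
    proof (rule maximal_inequality)
      show "0 \<le> F l" for l by (simp add: F_def)
      then show "0 \<le> F (l @ [u])" for l u by blast
    qed (use m c drift in auto)
    also have "(\<Sum>l\<in>paths m \<inter> UNIV. weight m l * F l) = (\<Sum>l\<in>paths m. weight m l)"
      by (intro sum.cong) (auto simp: F_def J_def hit_def paths_def)
    also have "\<dots> = 1" using m by (intro weight_total) auto
    finally show "\<P>(\<omega> in M. P m \<omega>) \<le> 1 / c" .
  qed
  have "AE \<omega> in M. \<forall>m\<in>{max n0 1..}. \<not> P m \<omega>" using never by (intro AE_ball_countable') auto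
  moreover have "AE \<omega> in M. \<exists>m. \<forall>n\<ge>m. balanced ((1 - a) / 8) (X n \<omega>)"
    using a by (intro AE_eventually_balanced) simp
  ultimately show ?thesis
  proof eventually_elim
    case (elim \<omega>)
    then obtain m1 where m1: "\<And>n. n \<ge> m1 \<Longrightarrow> G (X n \<omega>)" unfolding G_def by blast
    show ?case
    proof (intro impI allI, rule ccontr)
      fix k assume vis: "\<forall>k. \<exists>n\<ge>k. sum_list (X n \<omega>) = y" and "\<not> (\<exists>n\<ge>k. sum_list (X n \<omega>) = y + v)"
      then have "P (max (max k m1) (max n0 1)) \<omega>" using m1 unfolding P_def by auto
      then show False using elim(1) by auto
    qed
  qed
qed

lemma steps_generate:
  fixes Z :: "(int ^ 2) set"
  assumes z: "z \<in> Z" and closed: "\<And>y v. \<lbrakk>y \<in> Z; v \<in> steps\<rbrakk> \<Longrightarrow> y + v \<in> Z"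
  shows "x \<in> Z"
proof -
  have line: "y + k *s e \<in> Z" if "y \<in> Z" "e \<in> {e1, e2}" for y e and k :: int
  proof (induction k rule: int_induct[where k = 0])
    case base
    then show ?case using that by simp
  next
    case (step1 i)
    have "e \<in> steps" using that by (auto simp: steps_2)
    with step1(2) have "(y + i *s e) + e \<in> Z" by (rule closed)
    then show ?case by (simp add: vector_sadd_rdistrib algebra_simps)
  next
    case (step2 i)
    have "- e \<in> steps" using that by (auto simp: steps_2)
    with step2(2) have "(y + i *s e) + (- e) \<in> Z" by (rule closed)
    then show ?case by (simp add: vector_ssub_ldistrib vec_eq_iff algebra_simps)
  qed
  have "z + (x $ 1 - z $ 1) *s e1 + (x $ 2 - z $ 2) *s e2 \<in> Z"
    using z by (intro line) auto
  also have "z + (x $ 1 - z $ 1) *s e1 + (x $ 2 - z $ 2) *s e2 = x"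
    by (simp add: vec_eq_iff forall_2 axis_component)
  finally show ?thesis .
qed

lemma finite_ball: "finite {z :: int ^ 2. (real_of_int (z $ 1))\<^sup>2 + (real_of_int (z $ 2))\<^sup>2 < R}"
proof -
  define b where "b = \<lceil>\<bar>R\<bar>\<rceil>"
  have "z \<in> (\<lambda>(i, j). \<chi> k. if k = 1 then i else j) ` ({- b..b} \<times> {- b..b})"
    if "(real_of_int (z $ 1))\<^sup>2 + (real_of_int (z $ 2))\<^sup>2 < R" for z :: "int ^ 2"
  proof -
    have "\<bar>i\<bar> \<le> b" if "(real_of_int i)\<^sup>2 < R" for i :: int
    proof -
      have "\<bar>i\<bar> * 1 \<le> \<bar>i\<bar> * \<bar>i\<bar>" by (cases "i = 0") (auto simp del: abs_mult_self_eq)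
      then have "\<bar>i\<bar> \<le> i\<^sup>2" by (simp add: power2_eq_square)
      then have "real_of_int \<bar>i\<bar> \<le> (real_of_int i)\<^sup>2" by (metis of_int_le_iff of_int_power)
      then show ?thesis using that unfolding b_def by linarith
    qed
    moreover have "(real_of_int (z $ 1))\<^sup>2 < R" "(real_of_int (z $ 2))\<^sup>2 < R"
      using that zero_le_power2[of "real_of_int (z $ 1)"] zero_le_power2[of "real_of_int (z $ 2)"] by linarith+
    ultimately have "\<bar>z $ 1\<bar> \<le> b" "\<bar>z $ 2\<bar> \<le> b" by blast+
    then have "z $ 1 \<in> {- b..b}" "z $ 2 \<in> {- b..b}" by auto
    then show ?thesis
      by (intro image_eqI[of _ _ "(z $ 1, z $ 2)"]) (auto simp: vec_eq_iff forall_2)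
  qed
  then have "{z :: int ^ 2. (real_of_int (z $ 1))\<^sup>2 + (real_of_int (z $ 2))\<^sup>2 < R}
      \<subseteq> (\<lambda>(i, j). \<chi> k. if k = 1 then i else j) ` ({- b..b} \<times> {- b..b})"
    by blast
  then show ?thesis by (rule finite_subset) simp
qed

lemma recurrent_walk:
  assumes a: "a < 1/2"
  shows "recurrent M S"
proof -
  obtain R where R: "AE \<omega> in M. \<forall>m. \<exists>n\<ge>m. sqdist (X n \<omega>) < R"
    using AE_returns_to_ball[OF a] by blast
  \<comment> \<open>The vertex visited infinitely often depends on the path, so the implication is
    needed for all \<open>y\<close> on one event; countability of the lattice provides it.\<close>
  have "AE \<omega> in M. \<forall>v\<in>steps. \<forall>y. (\<forall>k. \<exists>n\<ge>k. sum_list (X n \<omega>) = y) \<longrightarrow> (\<forall>k. \<exists>n\<ge>k. sum_list (X n \<omega>) = y + v)"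
    using a by (intro AE_ball_countable' AE_all_countable[THEN iffD2] allI AE_neighbour_visited) auto
  with R have vis: "AE \<omega> in M. \<forall>x. \<forall>k. \<exists>n\<ge>k. sum_list (X n \<omega>) = x"
  proof eventually_elim
    case (elim \<omega>)
    define Z where "Z = {y. \<forall>k. \<exists>n\<ge>k. sum_list (X n \<omega>) = y}"
    define T where "T = {n. sqdist (X n \<omega>) < R}"
    have "infinite T" unfolding T_def infinite_nat_iff_unbounded_le using elim(1) by blast
    moreover have "finite ((\<lambda>n. sum_list (X n \<omega>)) ` T)"
      by (rule finite_subset[OF _ finite_ball[of R]]) (auto simp: T_def sqdist_def)
    \<comment> \<open>Infinitely many returns to a finite set of lattice points: some point is hit
      infinitely often.\<close>
    ultimately obtain n0 where "n0 \<in> T" and inf: "infinite {n \<in> T. sum_list (X n \<omega>) = sum_list (X n0 \<omega>)}"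
      using pigeonhole_infinite[of T "\<lambda>n. sum_list (X n \<omega>)"] by blast
    have "sum_list (X n0 \<omega>) \<in> Z"
      using inf unfolding Z_def infinite_nat_iff_unbounded_le by blast
    then have "x \<in> Z" for x
      by (rule steps_generate) (use elim(2) in \<open>auto simp: Z_def\<close>)
    then show ?case by (auto simp: Z_def)
  qed
  show ?thesis unfolding recurrent_def
  proof
    fix x :: "int ^ 2"
    have eq: "{\<omega>\<in>space M. infinite {n. S n \<omega> = x}} = {\<omega>\<in>space M. \<forall>k. \<exists>n\<ge>k. sum_list (X n \<omega>) = x}"
      by (intro Collect_cong conj_cong refl) (simp add: infinite_nat_iff_unbounded_le walk_eq)
    show "\<P>(\<omega> in M. infinite {n. S n \<omega> = x}) = 1"
      unfolding eq using vis by (subst prob_Collect_eq_1) auto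
  qed
qed

end

theorem theorem1p3:
  fixes M :: "'w measure"
    and p :: real
    and N :: "nat \<Rightarrow> 'w \<Rightarrow> nat"
    and \<sigma> S :: "nat \<Rightarrow> 'w \<Rightarrow> int ^ 2"
  assumes "p \<in> {0..1}"
    and "elephant_random_walk M p N \<sigma> S"
  shows "(p < 5/8 \<longrightarrow> recurrent M S) \<and> (p \<ge> 5/8 \<longrightarrow> transient M S)"
proof -
  interpret planar_walk M p N \<sigma> S "(4 * p - 1) / 3"
    using assms by (intro planar_walk.intro planar_walk_axioms.intro) auto
  show ?thesis
    using recurrent_walk transient_walk by (auto simp: field_simps)
qed

end
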